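(* Let $n>4$ be an integer. For every smooth function $f$ of one real variable with $f(0)=0$, the infinitesimal automorphism algebra of the hypersurface $M_f\subset\mathbb{C}^{n+1}$ at the origin satisfies $$2n+1\leq \dim_{\mathbb{R}}\mathfrak{hol}(M_f,0)\leq 2n+4,$$ and each of the dimensions $2n+1,\,2n+2,\,2n+3,\,2n+4$ is realized by some hypersurface $M_f$.
   Context: Coordinates on $\mathbb{C}^{n+1}$ are $z=(z_0,\dots,z_n)$ with $z_j=x_j+iy_j$. For a function $f$ of one real variable, $M_f\subset\mathbb{C}^{n+1}$ denotes the real hypersurface $$x_0=f(x_1)+\sum_{0<j<j+k\leq n}x_jx_kx_n^{n-j-k},$$ where the sum runs over all ordered pairs of positive integers $(j,k)$ with $j+k\le n$. For a real hypersurface $M\ni 0$ in $\mathbb{C}^{n+1}$, $\mathfrak{hol}(M,0)$ is the real Lie algebra of germs at $0$ of holomorphic vector fields on $\mathbb{C}^{n+1}$ whose real part is tangent to $M$. *)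

theory Defs
  imports "HOL-Analysis.Analysis"
begin

definition smooth :: "(real \<Rightarrow> real) \<Rightarrow> bool" where
  "smooth f \<longleftrightarrow> (\<forall>k. (deriv ^^ k) f differentiable_on UNIV)"

text \<open>
  The coordinates \<open>z\<^sub>0, \<dots>, z\<^sub>n\<close> of a point \<open>z :: complex ^ 'm\<close> are \<open>z $ c 0, \<dots>, z $ c n\<close>, where
  \<open>c\<close> enumerates the index type \<open>'m\<close> bijectively by \<open>{0..n}\<close>. The sum is over ordered pairs,
  and \<open>0 ^ 0 = 1\<close>.
\<close>

definition M_hyp :: "nat \<Rightarrow> (nat \<Rightarrow> 'm) \<Rightarrow> (real \<Rightarrow> real) \<Rightarrow> (complex ^ 'm::finite) set" where
  "M_hyp n c f =
    {z. let x = (\<lambda>i. Re (z $ c i)) in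
        x 0 = f (x 1) + (\<Sum>(j, k) | 0 < j \<and> j < j + k \<and> j + k \<le> n. x j * x k * x n ^ (n - j - k))}"

text \<open>
  For an embedded real submanifold \<open>M\<close> this is the usual real tangent space at \<open>p\<close>, as the set of
  velocities of curves in \<open>M\<close>; the curve needs to be differentiable only when it passes through \<open>p\<close>.
\<close>

definition tangent_space :: "'a::real_normed_vector set \<Rightarrow> 'a \<Rightarrow> 'a set" where
  "tangent_space M p =
    {v. \<exists>\<gamma> :: real \<Rightarrow> 'a. \<gamma> 0 = p \<and> (\<forall>\<^sub>F t in nhds 0. \<gamma> t \<in> M) \<and>
          (\<gamma> has_vector_derivative v) (at 0)}"

text \<open>
  A vector field \<open>\<Sum>\<^sub>j X\<^sub>j \<partial>/\<partial>z\<^sub>j\<close> is given by its vector \<open>X\<close> of coefficient functions.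
\<close>

definition holomorphic_vf_on :: "(complex ^ 'm::finite \<Rightarrow> complex ^ 'm) \<Rightarrow> (complex ^ 'm) set \<Rightarrow> bool" where
  "holomorphic_vf_on X U \<longleftrightarrow>
    (\<forall>z\<in>U. \<exists>D. (X has_derivative D) (at z) \<and> Vector_Spaces.linear (*s) (*s) D)"

text \<open>
  With \<open>X\<^sub>j = u\<^sub>j + i v\<^sub>j\<close>, the real part of \<open>\<Sum>\<^sub>j X\<^sub>j \<partial>/\<partial>z\<^sub>j\<close> is
  \<open>1/2 \<Sum>\<^sub>j (u\<^sub>j \<partial>/\<partial>x\<^sub>j + v\<^sub>j \<partial>/\<partial>y\<^sub>j)\<close>, so under the identification of the real tangent spaces of
  \<open>complex ^ 'm\<close> with \<open>complex ^ 'm\<close> it is the vector field \<open>X/2\<close>.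
\<close>

definition re_part :: "(complex ^ 'm::finite \<Rightarrow> complex ^ 'm) \<Rightarrow> complex ^ 'm \<Rightarrow> complex ^ 'm" where
  "re_part X p = (1/2) *\<^sub>R X p"

text \<open>Germs at the origin of arbitrary vector fields, as a real vector space.\<close>

quotient_type (overloaded) 'm vf_germ =
  "complex ^ 'm::finite \<Rightarrow> complex ^ 'm" / "\<lambda>X Y. \<forall>\<^sub>F z in nhds 0. X z = Y z"
  morphisms rep_germ germ
proof (rule equivpI)
  show "reflp (\<lambda>X Y :: complex ^ 'm \<Rightarrow> complex ^ 'm. \<forall>\<^sub>F z in nhds 0. X z = Y z)"
    by (simp add: reflp_def)
  show "symp (\<lambda>X Y :: complex ^ 'm \<Rightarrow> complex ^ 'm. \<forall>\<^sub>F z in nhds 0. X z = Y z)"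
    by (simp add: symp_def eq_commute)
  show "transp (\<lambda>X Y :: complex ^ 'm \<Rightarrow> complex ^ 'm. \<forall>\<^sub>F z in nhds 0. X z = Y z)"
    by (rule transpI) (auto elim: eventually_elim2)
qed

instantiation vf_germ :: (finite) real_vector
begin

lift_definition zero_vf_germ :: "'a vf_germ" is "\<lambda>_. 0" .

lift_definition plus_vf_germ :: "'a vf_germ \<Rightarrow> 'a vf_germ \<Rightarrow> 'a vf_germ" is "\<lambda>X Y z. X z + Y z"
  by (auto elim: eventually_elim2)

lift_definition uminus_vf_germ :: "'a vf_germ \<Rightarrow> 'a vf_germ" is "\<lambda>X z. - X z"
  by (auto elim: eventually_mono)

lift_definition minus_vf_germ :: "'a vf_germ \<Rightarrow> 'a vf_germ \<Rightarrow> 'a vf_germ" is "\<lambda>X Y z. X z - Y z"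
  by (auto elim: eventually_elim2)

lift_definition scaleR_vf_germ :: "real \<Rightarrow> 'a vf_germ \<Rightarrow> 'a vf_germ" is "\<lambda>r X z. r *\<^sub>R X z"
  by (auto elim: eventually_mono)

instance
  by standard (transfer; simp add: algebra_simps)+

end

text \<open>
  Only the underlying real vector space of the Lie algebra \<open>\<h>\<o>\<l>(M, 0)\<close> is used, through
  \<^const>\<open>dim\<close>. Beware that \<^const>\<open>dim\<close> is \<open>0\<close> on infinite-dimensional spaces; a statement
  giving a positive value or lower bound therefore includes finite-dimensionality.
\<close>

definition hol :: "(complex ^ 'm::finite) set \<Rightarrow> 'm vf_germ set" where
  "hol M = {germ X | X. \<exists>U. open U \<and> 0 \<in> U \<and> holomorphic_vf_on X U \<and>
                         (\<forall>p\<in>M \<inter> U. re_part X p \<in> tangent_space M p)}"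

end

theory Submission
  imports Defs "HOL-Complex_Analysis.Conformal_Mappings"
begin

text \<open>
  Restrict the tangency condition to curves in \<open>M\<^sub>f\<close> issuing from the purely imaginary points, which lie
  on \<open>M\<^sub>f\<close>, and compare Taylor coefficients up to order three. A holomorphic function which vanishes at
  the purely imaginary points is zero, and a relation between the real parts there differentiates to a
  relation between the imaginary parts of the derivatives. For \<open>n > 4\<close> the resulting linear relations
  make the components affine up to a cubic polynomial in \<open>z\<^sub>1\<close>, so that an infinitesimal
  automorphism is an explicit polynomial field in the imaginary translations \<open>al\<close>, in
  parameters \<open>be\<close>, in two weights \<open>a\<close>, \<open>b\<close> and in coefficients that absorb the cubic Taylor polynomial
  of \<open>f\<close>. The only condition that remains is an ordinary differential equation near \<open>0\<close>,
  \<open>(be\<^sub>1 + (a + b) s) f' - (2 a + n b) f = cubic polynomial\<close>, where the right-hand side is determined by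
  the left. Thus the algebra is a linear subspace of a space of dimension \<open>2 n + 4\<close> which contains
  \<open>be\<^sub>1 = a = b = 0\<close>, and \<open>f = 0, x\<^sup>4, x\<^sup>5, x\<^sup>5 + x\<^sup>6\<close> impose zero to three further conditions.
\<close>

section \<open>Holomorphic functions of several variables\<close>

text \<open>The obstacle is that \<open>f\<close> is merely smooth, so the defining equation cannot
  be complexified. But it involves real parts only: at all imaginary points the hypersurface looks
  alike, \<open>f\<close> enters through its Taylor coefficients at 0, and these points form a
  maximal totally real set. Several orders are needed because the quadratic part of the polynomial,
  the pairs with \<open>j + k = n\<close>, does not contain \<open>x_n\<close> and leaves a skew
  matrix of first derivatives free; the cubic part, with \<open>j + k = n - 1\<close>, removes this
  freedom. Only the \<open>z_0\<close>-derivative of the last component requires a further order.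
  The weights make the polynomial homogeneous: \<open>a + j b\<close> for \<open>z_j\<close>,
  \<open>b\<close> for \<open>z_n\<close>, \<open>2 a + n b\<close> for \<open>z_0\<close>. The
  entry \<open>be_0\<close> belongs to a rotation-like field, \<open>i z_1\<close> in component
  \<open>n - 1\<close> and \<open>i z_1^2\<close> in component 0, tangent for every
  \<open>f\<close>. The \<open>n + 1\<close> entries of \<open>al\<close>, those of
  \<open>be\<close>, and \<open>a\<close>, \<open>b\<close> add up to \<open>2 n + 4\<close>. Since
  cubic polynomials are absorbed, the first condition is the coefficient of \<open>s^4\<close> in
  the differential equation, which explains the choice of examples.\<close>

definition chol :: "(complex ^ 'm::finite \<Rightarrow> complex) \<Rightarrow> (complex ^ 'm) set \<Rightarrow> bool" where
  "chol G U \<longleftrightarrow> (\<forall>z\<in>U. \<exists>g :: 'm \<Rightarrow> complex. (G has_derivative (\<lambda>h. \<Sum>k\<in>UNIV. h $ k * g k)) (at z))"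

definition pd :: "'m::finite \<Rightarrow> (complex ^ 'm \<Rightarrow> complex) \<Rightarrow> complex ^ 'm \<Rightarrow> complex" where
  "pd k G z = frechet_derivative G (at z) (axis k 1)"

lemma sum_axis: "(\<Sum>k\<in>UNIV. axis l a $ k * g k) = a * (g l :: complex)"
  by (simp add: axis_def if_distrib[of "\<lambda>x. x * _"] sum.delta' cong: if_cong)

lemma pd_eqI:
  assumes "(G has_derivative (\<lambda>h. \<Sum>k\<in>UNIV. h $ k * g k)) (at z)"
  shows "pd k G z = g k"
  unfolding pd_def frechet_derivative_at[OF assms, symmetric] by (simp add: sum_axis)

lemma chol_has_derivative:
  assumes "chol G U" "z \<in> U"
  shows "(G has_derivative (\<lambda>h. \<Sum>k\<in>UNIV. h $ k * pd k G z)) (at z)"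
proof -
  obtain g where g: "(G has_derivative (\<lambda>h. \<Sum>k\<in>UNIV. h $ k * g k)) (at z)"
    using assms unfolding chol_def by blast
  show ?thesis using g pd_eqI[OF g] by simp
qed

lemma chol_subset: "chol G U \<Longrightarrow> V \<subseteq> U \<Longrightarrow> chol G V"
  unfolding chol_def by blast

lemma chol_continuous_on: "chol G U \<Longrightarrow> continuous_on U G"
  by (meson chol_has_derivative continuous_at_imp_continuous_on has_derivative_continuous)

lemma cholI:
  assumes "\<And>z. z \<in> U \<Longrightarrow> (G has_derivative (\<lambda>h. \<Sum>k\<in>UNIV. h $ k * g z k)) (at z)"
  shows "chol G U"
  unfolding chol_def using assms by blast

lemma pd_cong:
  assumes "open U" "z \<in> U" "\<And>w. w \<in> U \<Longrightarrow> G w = H w"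
  shows "pd k G z = pd k H z"
proof -
  have "(G has_derivative D) (at z) \<longleftrightarrow> (H has_derivative D) (at z)" for D
    using assms by (metis has_derivative_transform_within_open)
  then show ?thesis unfolding pd_def frechet_derivative_def by simp
qed

lemma chol_const [intro]: "chol (\<lambda>z. a) U"
  by (rule cholI[where g = "\<lambda>_ _. 0"]) simp

lemma pd_const [simp]: "pd k (\<lambda>z. a) z = 0"
  by (rule pd_eqI[where g = "\<lambda>_. 0"]) simp

lemma nth_deriv: "((\<lambda>z::complex^'m::finite. z $ l) has_derivative (\<lambda>h. \<Sum>k\<in>UNIV. h $ k * (if k = l then 1 else 0))) (at z)"
  by (rule has_derivative_eq_rhs[OF bounded_linear_imp_has_derivative[OF bounded_linear_vec_nth]])
     (auto simp: if_distrib[of "\<lambda>x. _ * x"] cong: if_cong)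

lemma chol_nth [intro]: "chol (\<lambda>z. z $ l) U"
  by (rule cholI[OF nth_deriv])

lemma pd_nth: "pd k (\<lambda>z. z $ l) z = (if k = l then 1 else 0)"
  by (rule pd_eqI[OF nth_deriv])

lemma add_deriv:
  assumes "chol G U" "chol H U" "z \<in> U"
  shows "((\<lambda>z. G z + H z) has_derivative (\<lambda>h. \<Sum>k\<in>UNIV. h $ k * (pd k G z + pd k H z))) (at z)"
  using has_derivative_add[OF chol_has_derivative[OF assms(1,3)] chol_has_derivative[OF assms(2,3)]]
  by (simp add: sum.distrib algebra_simps)

lemma mult_deriv:
  assumes "chol G U" "chol H U" "z \<in> U"
  shows "((\<lambda>z. G z * H z) has_derivative (\<lambda>h. \<Sum>k\<in>UNIV. h $ k * (pd k G z * H z + G z * pd k H z))) (at z)"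
  by (rule has_derivative_eq_rhs[OF has_derivative_mult[OF chol_has_derivative[OF assms(1,3)] chol_has_derivative[OF assms(2,3)]]])
     (simp add: sum.distrib algebra_simps sum_distrib_left)

lemma chol_add [intro]: "chol G U \<Longrightarrow> chol H U \<Longrightarrow> chol (\<lambda>z. G z + H z) U"
  by (rule cholI[OF add_deriv])

lemma chol_mult [intro]: "chol G U \<Longrightarrow> chol H U \<Longrightarrow> chol (\<lambda>z. G z * H z) U"
  by (rule cholI[OF mult_deriv])

lemma chol_cmult [intro]: "chol G U \<Longrightarrow> chol (\<lambda>z. a * G z) U"
  by (rule chol_mult[OF chol_const])

lemma chol_diff [intro]: "chol G U \<Longrightarrow> chol H U \<Longrightarrow> chol (\<lambda>z. G z - H z) U"
  using chol_add[OF _ chol_cmult[where a = "-1"], of G U H] by simp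

lemma chol_sum [intro]: "(\<And>i. i \<in> A \<Longrightarrow> chol (G i) U) \<Longrightarrow> chol (\<lambda>z. \<Sum>i\<in>A. G i z) U"
  by (induction A rule: infinite_finite_induct) auto

lemma pd_add: "chol G U \<Longrightarrow> chol H U \<Longrightarrow> z \<in> U \<Longrightarrow> pd k (\<lambda>z. G z + H z) z = pd k G z + pd k H z"
  by (rule pd_eqI[OF add_deriv])

lemma pd_mult: "chol G U \<Longrightarrow> chol H U \<Longrightarrow> z \<in> U \<Longrightarrow> pd k (\<lambda>z. G z * H z) z = pd k G z * H z + G z * pd k H z"
  by (rule pd_eqI[OF mult_deriv])

lemma pd_cmult: "chol G U \<Longrightarrow> z \<in> U \<Longrightarrow> pd k (\<lambda>z. a * G z) z = a * pd k G z"
  using pd_mult[OF chol_const] by simp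

lemma pd_diff: "chol G U \<Longrightarrow> chol H U \<Longrightarrow> z \<in> U \<Longrightarrow> pd k (\<lambda>z. G z - H z) z = pd k G z - pd k H z"
  using pd_add[of G U "\<lambda>z. (-1) * H z" z k] by (simp add: pd_cmult[where U = U and a = "-1", simplified] chol_cmult[where a = "-1", simplified])

lemma norm_axis_complex: "norm (axis k a :: complex ^ 'm::finite) = norm a"
proof -
  have "norm (axis k a :: complex ^ 'm) = sqrt (\<Sum>i\<in>UNIV. (if i = k then (norm a)\<^sup>2 else 0))"
    unfolding norm_vec_def L2_set_def by (intro arg_cong[where f = sqrt] sum.cong) (auto simp: axis_def)
  then show ?thesis by simp
qed

lemma bounded_linear_axis: "bounded_linear (\<lambda>u. axis k u :: complex ^ 'm::finite)"
  by (rule bounded_linear_intro[where K = 1])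
     (simp_all add: norm_axis_complex, simp_all add: vec_eq_iff axis_def)

section \<open>Cauchy's formula and the regularity of partial derivatives\<close>

lemma chol_slice:
  assumes "chol G U" "w + axis k u \<in> U"
  shows "((\<lambda>u. G (w + axis k u)) has_field_derivative pd k G (w + axis k u)) (at u)"
proof -
  have "((\<lambda>u. w + axis k u) has_derivative (\<lambda>u. axis k u)) (at u)"
    using has_derivative_add[OF has_derivative_const bounded_linear_imp_has_derivative[OF bounded_linear_axis]] by fastforce
  from has_derivative_compose[OF this chol_has_derivative[OF assms]]
  show ?thesis by (simp add: has_field_derivative_def sum_axis mult.commute[of _ "pd k G _"])
qed

lemma axis_continuous [continuous_intros]:
  "continuous_on A f \<Longrightarrow> continuous_on A (\<lambda>x. axis k (f x) :: complex ^ 'm::finite)"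
  by (rule bounded_linear.continuous_on[OF bounded_linear_axis])

lemma axis_zero [simp]: "axis k 0 = 0"
  by (simp add: vec_eq_iff axis_def)

lemma shifted_ball:
  fixes w z0 :: "complex ^ 'm::finite" and u :: complex
  assumes "w \<in> ball z0 r" "norm u < 2 * r"
  shows "w + axis k u \<in> ball z0 (3 * r)"
proof -
  have "dist z0 (w + axis k u) \<le> dist z0 w + dist w (w + axis k u)" by (rule dist_triangle)
  also have "dist w (w + axis k u) = norm u" by (simp add: dist_norm norm_axis_complex)
  finally show ?thesis using assms by simp
qed

text \<open>Cauchy's formula on the circle of radius \<open>r\<close> around \<open>w\<close> in the
  complex line of direction \<open>k\<close>, parametrized over \<open>[0, 1]\<close> so that
  theorems on parameter integrals apply. \<open>chol\<close> gives only pointwise differentiability;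
  all regularity of \<open>pd\<close> is drawn from this integral. The radius \<open>3 * r\<close>
  leaves room for a moving centre \<open>w\<close> and a disc of radius \<open>2 * r\<close> around
  it.\<close>

lemma pd_Cauchy:
  assumes "chol G (ball z0 (3 * r))" "r > 0" "w \<in> ball z0 r"
  shows "pd k G w = integral (cbox 0 1) (\<lambda>t. exp (- (2 * of_real pi * \<i> * of_real t)) / of_real r * G (w + axis k (of_real r * exp (2 * of_real pi * \<i> * of_real t))))"
proof -
  define h where "h = (\<lambda>u. G (w + axis k u))"
  have inb: "w + axis k u \<in> ball z0 (3 * r)" if "norm u < 2 * r" for u
    by (rule shifted_ball[OF assms(3) that])
  have d: "(h has_field_derivative pd k G (w + axis k u)) (at u)" if "norm u < 2 * r" for u
    unfolding h_def by (rule chol_slice[OF assms(1) inb[OF that]])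
  have "h holomorphic_on ball 0 (2 * r)"
    unfolding holomorphic_on_def field_differentiable_def
    using d by (meson has_field_derivative_at_within mem_ball_0)
  then have hol: "continuous_on (cball 0 r) h" "h holomorphic_on ball 0 r"
    using assms(2)
    by (auto intro!: holomorphic_on_imp_continuous_on elim!: holomorphic_on_subset)
  have "(h has_field_derivative (1 / (2 * of_real pi * \<i>) * contour_integral (circlepath 0 r) (\<lambda>u. h u / (u - 0)^2))) (at 0)"
    by (rule Cauchy_derivative_integral_circlepath[OF hol]) (use assms in auto)
  moreover have "(h has_field_derivative pd k G w) (at 0)"
    using d[of 0] assms(2) by simp
  ultimately have "pd k G w = 1 / (2 * of_real pi * \<i>) * contour_integral (circlepath 0 r) (\<lambda>u. h u / u^2)"
    using DERIV_unique by fastforce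
  also have "\<dots> = integral {0..1} (\<lambda>t. 1 / (2 * of_real pi * \<i>) * (h (circlepath 0 r t) / (circlepath 0 r t)^2 * vector_derivative (circlepath 0 r) (at t)))"
    unfolding contour_integral_integral by (rule integral_mult_right[symmetric])
  also have "\<dots> = integral {0..1} (\<lambda>t. exp (- (2 * of_real pi * \<i> * of_real t)) / of_real r * G (w + axis k (of_real r * exp (2 * of_real pi * \<i> * of_real t))))"
    using assms(2)
    by (intro integral_cong, unfold vector_derivative_circlepath)
       (simp add: circlepath h_def power2_eq_square exp_minus field_simps)
  finally show ?thesis by simp
qed


lemma pd_continuous_on_ball:
  assumes "chol G (ball z0 (3 * r))" "r > 0"
  shows "continuous_on (ball z0 r) (pd k G)"
proof -
  have "continuous_on (ball z0 r \<times> cbox 0 1)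
    (\<lambda>(w, t :: real). exp (- (2 * of_real pi * \<i> * of_real t)) / of_real r * G (w + axis k (of_real r * exp (2 * of_real pi * \<i> * of_real t))))"
    unfolding split_beta
    by (intro continuous_intros continuous_on_compose2[OF chol_continuous_on[OF assms(1)]] axis_continuous)
       (use assms(2) in \<open>auto intro!: shifted_ball[unfolded mem_ball] simp: norm_mult\<close>)
  from integral_continuous_on_param[OF this]
  show ?thesis
    by (rule continuous_on_eq) (simp add: pd_Cauchy[OF assms])
qed

lemma pd_continuous_on:
  assumes "chol G U" "open U"
  shows "continuous_on U (pd k G)"
proof (intro continuous_at_imp_continuous_on ballI)
  fix z assume "z \<in> U"
  then obtain e where e: "e > 0" "ball z e \<subseteq> U" using assms(2) open_contains_ball by blast
  have "continuous_on (ball z (e/3)) (pd k G)"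
    by (rule pd_continuous_on_ball) (use e assms in \<open>auto intro: chol_subset\<close>)
  then show "isCont (pd k G) z"
    using e continuous_on_eq_continuous_at[OF open_ball, of z "e/3" "pd k G"] by simp
qed

text \<open>Differentiation under the integral sign in \<open>pd_Cauchy\<close>. The coefficients
  obtained are again Cauchy integrals, with \<open>pd l G\<close> in place of \<open>G\<close>; this
  yields both \<open>chol_pd\<close> and \<open>pd_commute\<close>.\<close>

lemma pd_pd_ball:
  assumes "chol G (ball z0 (3 * r))" "r > 0" "w \<in> ball z0 r"
  shows "(pd k G has_derivative (\<lambda>h. \<Sum>l\<in>UNIV. h $ l *
    integral (cbox 0 1) (\<lambda>t. exp (- (2 * of_real pi * \<i> * of_real t)) / of_real r * pd l G (w + axis k (of_real r * exp (2 * of_real pi * \<i> * of_real t)))))) (at w)"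
proof -
  define E where "E = (\<lambda>t. exp (- (2 * of_real pi * \<i> * of_real t)) / of_real r)"
  define b :: "real \<Rightarrow> complex ^ 'a" where "b = (\<lambda>t. axis k (of_real r * exp (2 * of_real pi * \<i> * of_real t)))"
  define P :: "'a \<Rightarrow> ((complex ^ 'a) \<Rightarrow>\<^sub>L complex)" where "P = (\<lambda>l. Blinfun (\<lambda>h. h $ l))"
  have P: "blinfun_apply (P l) h = h $ l" for l h
    unfolding P_def by (simp add: bounded_linear_Blinfun_apply[OF bounded_linear_vec_nth])
  \<comment> \<open>\<open>leibniz_rule\<close> expects the derivative of the integrand as a bounded
    linear operator depending continuously on \<open>w\<close> and \<open>t\<close>, so the
    coordinate sum is rebuilt from the projections \<open>P\<close>.\<close>
  define fx where "fx = (\<lambda>w t. \<Sum>l\<in>UNIV. blinfun_mult_right (E t * pd l G (w + b t)) o\<^sub>L P l)"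
  have fx: "blinfun_apply (fx w t) h = (\<Sum>l\<in>UNIV. h $ l * (E t * pd l G (w + b t)))" for w t h
    unfolding fx_def by (simp add: blinfun.sum_left P mult_ac)
  have inb: "w + b t \<in> ball z0 (3 * r)" if "w \<in> ball z0 r" for w t
    unfolding b_def using that assms(2) by (intro shifted_ball) (auto simp: norm_mult)
  have contE: "continuous_on A E" for A unfolding E_def by (intro continuous_intros) (use assms(2) in auto)
  have contb: "continuous_on A b" for A unfolding b_def by (intro continuous_intros axis_continuous)
  have contpd: "continuous_on (ball z0 (3 * r)) (pd l G)" for l
    by (rule pd_continuous_on[OF assms(1)]) simp
  have cfx: "continuous_on (ball z0 r \<times> cbox 0 1) (\<lambda>(w, t). fx w t)"
    unfolding split_beta fx_def
  proof (intro continuous_on_sum bounded_bilinear.continuous_on[OF bounded_bilinear_blinfun_compose]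
      bounded_linear.continuous_on[OF bounded_linear_blinfun_mult_right] continuous_on_mult continuous_on_const)
    show "continuous_on (ball z0 r \<times> cbox 0 1) (\<lambda>x. E (snd x))"
      by (rule continuous_on_compose2[OF contE[of UNIV] continuous_on_snd[OF continuous_on_id]]) auto
    have "continuous_on (ball z0 r \<times> cbox 0 1) (\<lambda>x. fst x + b (snd x))"
      by (intro continuous_on_add continuous_on_fst continuous_on_id
          continuous_on_compose2[OF contb[of UNIV] continuous_on_snd[OF continuous_on_id]]) auto
    then show "continuous_on (ball z0 r \<times> cbox 0 1) (\<lambda>x. pd l G (fst x + b (snd x)))" for l
      by (rule continuous_on_compose2[OF contpd]) (auto simp del: mem_ball intro: inb)
  qed
  have "((\<lambda>w. integral (cbox 0 1) (\<lambda>t. E t * G (w + b t))) has_derivative integral (cbox 0 1) (fx w)) (at w within ball z0 r)"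
  proof (rule leibniz_rule)
    fix x and t :: real assume x: "x \<in> ball z0 r"
    have "((\<lambda>x. x + b t) has_derivative (\<lambda>h. h)) (at x)"
      using has_derivative_add[OF has_derivative_ident has_derivative_const] by fastforce
    from has_derivative_compose[OF this chol_has_derivative[OF assms(1) inb[OF x]]]
    have "((\<lambda>x. E t * G (x + b t)) has_derivative (\<lambda>h. E t * (\<Sum>l\<in>UNIV. h $ l * pd l G (x + b t)))) (at x)"
      by (rule has_derivative_mult_right)
    moreover have "blinfun_apply (fx x t) = (\<lambda>h. E t * (\<Sum>l\<in>UNIV. h $ l * pd l G (x + b t)))"
      by (rule ext) (simp add: fx sum_distrib_left mult.left_commute)
    ultimately show "((\<lambda>x. E t * G (x + b t)) has_derivative blinfun_apply (fx x t)) (at x within ball z0 r)"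
      by (simp add: has_derivative_at_withinI)
  next
    fix x assume x: "x \<in> ball z0 r"
    show "(\<lambda>t. E t * G (x + b t)) integrable_on cbox 0 1"
      by (intro integrable_continuous continuous_intros contE continuous_on_compose2[OF chol_continuous_on[OF assms(1)]] contb)
         (use inb[OF x] in auto)
  qed (use cfx assms in auto)
  then have D: "((\<lambda>w. integral (cbox 0 1) (\<lambda>t. E t * G (w + b t))) has_derivative integral (cbox 0 1) (fx w)) (at w)"
    using assms(3) by (simp add: at_within_open[OF _ open_ball])
  have int: "(\<lambda>t. E t * pd l G (w + b t)) integrable_on cbox 0 1" for l
    by (intro integrable_continuous continuous_intros contE continuous_on_compose2[OF contpd] contb)
       (use inb[OF assms(3)] in auto)
  have "continuous_on (cbox 0 1) (\<lambda>t. case (w, t) of (w, t) \<Rightarrow> fx w t)"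
    by (rule continuous_on_compose2[OF cfx continuous_on_Pair[OF continuous_on_const continuous_on_id]])
       (use assms(3) in auto)
  then have "fx w integrable_on cbox 0 1"
    by (intro integrable_continuous) simp
  then have "blinfun_apply (integral (cbox 0 1) (fx w)) h = (\<Sum>l\<in>UNIV. h $ l * integral (cbox 0 1) (\<lambda>t. E t * pd l G (w + b t)))" for h
    using int by (simp add: blinfun_apply_integral fx integral_sum integrable_on_mult_right)
  then have "((\<lambda>w. integral (cbox 0 1) (\<lambda>t. E t * G (w + b t))) has_derivative
     (\<lambda>h. \<Sum>l\<in>UNIV. h $ l * integral (cbox 0 1) (\<lambda>t. E t * pd l G (w + b t)))) (at w)"
    by (intro has_derivative_eq_rhs[OF D]) auto
  then show ?thesis
    unfolding E_def b_def
    by (rule has_derivative_transform_within_open[OF _ open_ball])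
       (use assms in \<open>auto simp: pd_Cauchy[OF assms(1,2)]\<close>)
qed

lemma ball_third:
  assumes "open U" "z \<in> U"
  obtains r where "r > 0" "ball z (3 * r) \<subseteq> U"
proof -
  obtain e where e: "e > 0" "ball z e \<subseteq> U" using assms open_contains_ball by blast
  then show ?thesis using that[of "e/3"] by simp
qed

lemma chol_pd [intro]:
  assumes "chol G U" "open U"
  shows "chol (pd k G) U"
  unfolding chol_def
proof
  fix z assume z: "z \<in> U"
  obtain r where r: "r > 0" "ball z (3 * r) \<subseteq> U" using ball_third[OF assms(2) z] .
  show "\<exists>g. (pd k G has_derivative (\<lambda>h. \<Sum>l\<in>UNIV. h $ l * g l)) (at z)"
    by (rule exI, rule pd_pd_ball[OF chol_subset[OF assms(1) r(2)] r(1)]) (use r in simp)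
qed

text \<open>Differentiating Cauchy's integral for \<open>pd l G\<close> in direction
  \<open>k\<close> puts \<open>pd k G\<close> under the integral sign, and this is Cauchy's integral
  for \<open>pd l (pd k G)\<close>.\<close>

lemma pd_commute:
  assumes "chol G U" "open U" "z \<in> U"
  shows "pd k (pd l G) z = pd l (pd k G) z"
proof -
  obtain r where r: "r > 0" "ball z (3 * r) \<subseteq> U" using ball_third[OF assms(2,3)] .
  note G = chol_subset[OF assms(1) r(2)]
  show ?thesis
    using pd_eqI[OF pd_pd_ball[OF G r(1), of z l], of k] pd_Cauchy[OF chol_pd[OF G open_ball, of k] r(1), of z l] r
    by simp
qed

section \<open>The purely imaginary points as a uniqueness set\<close>

definition ipts :: "real \<Rightarrow> (complex ^ 'm::finite) set" where
  "ipts r = {p \<in> ball 0 r. \<forall>k. Re (p $ k) = 0}"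

lemma chol_line:
  assumes "chol G U" "a + \<tau> *s x \<in> U"
  shows "((\<lambda>\<tau>. G (a + \<tau> *s x)) has_field_derivative (\<Sum>k\<in>UNIV. x $ k * pd k G (a + \<tau> *s x))) (at \<tau>)"
proof -
  have bl: "bounded_linear (\<lambda>\<tau>. \<tau> *s x)"
    by (rule bounded_linear_intro[where K = "norm x"])
       (simp_all add: vec_eq_iff distrib_right norm_vec_def norm_mult L2_set_right_distrib)
  have "((\<lambda>\<tau>. a + \<tau> *s x) has_derivative (\<lambda>h. h *s x)) (at \<tau>)"
    using has_derivative_add[OF has_derivative_const bounded_linear_imp_has_derivative[OF bl]] by fastforce
  from has_derivative_compose[OF this chol_has_derivative[OF assms]]
  show ?thesis
    by (rule has_derivative_imp_has_field_derivative) (simp add: sum_distrib_left mult.assoc)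
qed

text \<open>On the segment from \<open>\<i>y\<close> to \<open>z = x + \<i>y\<close>, parametrized by \<open>\<i>y + \<tau>x\<close>, the function vanishes
  for small imaginary \<open>\<tau>\<close>, hence identically.\<close>

lemma zero_on_ipts_imp_zero:
  assumes "chol G (ball 0 r)" "\<And>p. p \<in> ipts r \<Longrightarrow> G p = 0" "z \<in> ball 0 r"
  shows "G z = 0"
proof -
  define x :: "complex ^ 'a" where "x = (\<chi> k. of_real (Re (z $ k)))"
  define y where "y = z - x"
  define S where "S = {\<tau> :: complex. y + \<tau> *s x \<in> ball 0 r}"
  have y: "y $ k = \<i> * of_real (Im (z $ k))" for k
    unfolding y_def x_def by (simp add: complex_eq_iff)
  have "norm (y $ k) \<le> norm (z $ k)" for k
    using abs_Im_le_cmod[of "z $ k"] by (simp add: y norm_mult)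
  then have yr: "norm y < r" using norm_le_componentwise_cart[of y z] assms(3) by simp
  have contl: "continuous_on UNIV (\<lambda>\<tau>. y + \<tau> *s x)"
    by (rule continuous_on_add[OF continuous_on_const])
       (auto simp: vector_scalar_mult_def intro!: continuous_on_vec_lambda continuous_intros)
  have S: "open S"
    using open_vimage[OF open_ball contl, of 0 r] unfolding S_def vimage_def by simp
  have "convex S"
  proof (rule convexI)
    fix \<sigma> \<tau> and u v :: real assume a: "\<sigma> \<in> S" "\<tau> \<in> S" "0 \<le> u" "0 \<le> v" "u + v = 1"
    have "y + (u *\<^sub>R \<sigma> + v *\<^sub>R \<tau>) *s x = u *\<^sub>R (y + \<sigma> *s x) + v *\<^sub>R (y + \<tau> *s x)"
    proof -
      have "y = u *\<^sub>R y + v *\<^sub>R y" by (metis a(5) scaleR_add_left scaleR_one)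
      moreover have "(u *\<^sub>R \<sigma> + v *\<^sub>R \<tau>) *s x = u *\<^sub>R (\<sigma> *s x) + v *\<^sub>R (\<tau> *s x)"
        by (simp add: vec_eq_iff algebra_simps scaleR_conv_of_real[where 'a = complex])
      ultimately show ?thesis by (simp add: scaleR_add_right)
    qed
    then show "u *\<^sub>R \<sigma> + v *\<^sub>R \<tau> \<in> S"
      using a convexD[OF convex_ball, of "y + \<sigma> *s x" 0 r "y + \<tau> *s x" u v] unfolding S_def by simp
  qed
  then have conn: "connected S" by (rule convex_connected)
  have S0: "0 \<in> S" unfolding S_def using yr by simp
  have S1: "1 \<in> S" unfolding S_def y_def using assms(3) by simp
  obtain e where e: "e > 0" "ball 0 e \<subseteq> S" using S S0 open_contains_ball by blast
  define T where "T = (\<lambda>s. \<i> * of_real s) ` {0<..<e}"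
  have "(\<lambda>\<tau>. G (y + \<tau> *s x)) 1 = 0"
  proof (rule analytic_continuation[where f = "\<lambda>\<tau>. G (y + \<tau> *s x)" and S = S and U = T and \<xi> = 0 and w = 1])
    show "(\<lambda>\<tau>. G (y + \<tau> *s x)) holomorphic_on S"
      unfolding holomorphic_on_def field_differentiable_def
    proof
      fix \<tau> assume "\<tau> \<in> S"
      then have "y + \<tau> *s x \<in> ball 0 r" by (simp only: S_def mem_Collect_eq)
      from has_field_derivative_at_within[OF chol_line[OF assms(1) this]]
      show "\<exists>f'. ((\<lambda>\<tau>. G (y + \<tau> *s x)) has_field_derivative f') (at \<tau> within S)" by (rule exI)
    qed
    show "T \<subseteq> S" using e(2) unfolding T_def by (auto simp: norm_mult subset_iff)
    show "0 islimpt T"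
    proof (rule islimptI)
      fix V :: "complex set" assume "0 \<in> V" "open V"
      then obtain d where d: "d > 0" "ball 0 d \<subseteq> V" using open_contains_ball by blast
      define s where "s = min d e / 2"
      have "\<i> * of_real s \<in> T" unfolding T_def by (rule imageI) (use d e in \<open>auto simp: s_def\<close>)
      moreover have "\<i> * of_real s \<in> V" using d e unfolding s_def by (intro subsetD[OF d(2)]) (auto simp: norm_mult)
      moreover have "\<i> * of_real s \<noteq> 0" unfolding s_def using d e by simp
      ultimately show "\<exists>y\<in>T. y \<in> V \<and> y \<noteq> 0" by blast
    qed
    show "G (y + \<tau> *s x) = 0" if "\<tau> \<in> T" for \<tau>
    proof (rule assms(2))
      have "\<tau> \<in> S" using that \<open>T \<subseteq> S\<close> by blast
      moreover obtain s where "\<tau> = \<i> * of_real s" using \<open>\<tau> \<in> T\<close> unfolding T_def by blast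
      ultimately show "y + \<tau> *s x \<in> ipts r" unfolding ipts_def S_def by (auto simp: y x_def)
    qed
  qed (use S conn S0 S1 in auto)
  then show ?thesis unfolding y_def by simp
qed

text \<open>Moving \<open>p\<close> in the imaginary direction of coordinate \<open>k\<close> stays
  inside the imaginary points, and the derivative of \<open>Re G\<close> along this line is
  \<open>Re (\<i> * pd k G p) = - Im (pd k G p)\<close>. Real and imaginary parts therefore
  alternate with each differentiation.\<close>

lemma Im_pd_zero:
  assumes "chol G (ball 0 r)" "\<And>p. p \<in> ipts r \<Longrightarrow> Re (G p) = 0" "p \<in> ipts r"
  shows "Im (pd k G p) = 0"
proof -
  define h where "h = (\<lambda>s :: real. G (p + axis k (\<i> * of_real s)))"
  have p: "p \<in> ball 0 r" using assms(3) by (simp add: ipts_def)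
  have "((\<lambda>s :: real. \<i> * of_real s) has_vector_derivative \<i>) (at 0)"
    by (auto intro!: derivative_eq_intros)
  moreover have "((\<lambda>u. G (p + axis k u)) has_field_derivative pd k G p) (at (\<i> * of_real 0))"
    using chol_slice[OF assms(1), of p k 0] p by simp
  ultimately have "(h has_vector_derivative \<i> * pd k G p) (at 0)"
    unfolding h_def using field_vector_diff_chain_at[of "\<lambda>s. \<i> * of_real s" \<i> 0 "\<lambda>u. G (p + axis k u)" "pd k G p"]
    by (simp add: o_def)
  from bounded_linear.has_vector_derivative[OF bounded_linear_Re this]
  have "((\<lambda>s. Re (h s)) has_vector_derivative - Im (pd k G p)) (at 0)" by simp
  moreover have ev: "\<forall>\<^sub>F s in nhds 0. Re (h s) = 0"
  proof -
    have "continuous_on UNIV (\<lambda>s :: real. p + axis k (\<i> * of_real s))"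
      by (intro continuous_intros)
    from eventually_nhds_in_open[OF open_vimage[OF open_ball[of 0 r] this], of 0]
    have "\<forall>\<^sub>F s :: real in nhds 0. p + axis k (\<i> * of_real s) \<in> ball 0 r"
      using p by simp
    then show ?thesis
    proof eventually_elim
      case (elim s)
      have "Re ((p + axis k (\<i> * of_real s)) $ j) = 0" for j
        using assms(3) by (simp add: ipts_def axis_def)
      then show ?case unfolding h_def using elim by (intro assms(2)) (simp add: ipts_def)
    qed
  qed
  ultimately have "((\<lambda>s :: real. 0 :: real) has_vector_derivative - Im (pd k G p)) (at 0)"
    using has_vector_derivative_cong_ev[where f = "\<lambda>s. Re (h s)" and g = "\<lambda>s. 0" and x = 0 and S = UNIV] eventually_nhds_x_imp_x[OF ev] ev
    by simp
  then show ?thesis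
    using vector_derivative_unique_at[OF _ has_vector_derivative_const[of 0 "at 0"]] by fastforce
qed

text \<open>The partial derivatives are holomorphic, so being constant on the imaginary points they
  are constant on the ball; the difference to the linear function then has zero derivative on a
  convex set.\<close>

lemma affine_if_pd_const:
  assumes "chol G (ball 0 r)" "r > 0" "\<And>k p. p \<in> ipts r \<Longrightarrow> pd k G p = \<kappa> k" "z \<in> ball 0 r"
  shows "G z = G 0 + (\<Sum>k\<in>UNIV. \<kappa> k * z $ k)"
proof -
  have "pd k G z - \<kappa> k = 0" if "z \<in> ball 0 r" for k z
    by (rule zero_on_ipts_imp_zero[OF chol_diff[OF chol_pd[OF assms(1) open_ball] chol_const]])
       (simp_all add: assms(3) that[simplified])
  then have k: "pd k G z = \<kappa> k" if "z \<in> ball 0 r" for k z using that by simp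
  define H where "H = (\<lambda>z. G z - (\<Sum>k\<in>UNIV. \<kappa> k * z $ k))"
  have "(H has_derivative (\<lambda>h. 0)) (at z within ball 0 r)" if "z \<in> ball 0 r" for z
  proof -
    have "((\<lambda>z. \<Sum>k\<in>UNIV. \<kappa> k * z $ k) has_derivative (\<lambda>h. \<Sum>k\<in>UNIV. \<kappa> k * h $ k)) (at z)"
      by (rule has_derivative_sum, rule has_derivative_mult_right,
          rule bounded_linear_imp_has_derivative, rule bounded_linear_vec_nth)
    from has_derivative_diff[OF chol_has_derivative[OF assms(1) that] this]
    have "(H has_derivative (\<lambda>h. (\<Sum>l\<in>UNIV. h $ l * pd l G z) - (\<Sum>l\<in>UNIV. \<kappa> l * h $ l))) (at z)"
      unfolding H_def .
    then have "(H has_derivative (\<lambda>h. 0)) (at z)" by (simp add: k[OF that] mult.commute)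
    then show ?thesis by (rule has_derivative_at_withinI)
  qed
  then have "\<exists>c. \<forall>z\<in>ball 0 r. H z = c"
    by (rule has_derivative_zero_constant[OF convex_ball])
  then obtain c where c: "\<forall>z\<in>ball 0 r. H z = c" ..
  have "H z = H 0" using bspec[OF c assms(4)] bspec[OF c, of 0] assms(2) by simp
  then show ?thesis unfolding H_def by (simp add: algebra_simps)
qed

section \<open>Taylor expansions along curves\<close>

text \<open>A Taylor expansion with Peano remainder, so that no higher derivatives of composite
  functions have to be computed. The value at 0 is a separate condition because the limit does not
  see it; entries of \<open>a\<close> beyond \<open>N\<close> carry no information.\<close>

definition jet :: "nat \<Rightarrow> (real \<Rightarrow> real) \<Rightarrow> (nat \<Rightarrow> real) \<Rightarrow> bool" where
  "jet N h a \<longleftrightarrow> h 0 = a 0 \<and> ((\<lambda>t. (h t - (\<Sum>i\<le>N. a i * t ^ i)) / t ^ N) \<longlongrightarrow> 0) (at 0)"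

lemma jet_cong:
  assumes "jet N h a" "\<And>i. i \<le> N \<Longrightarrow> a i = b i"
  shows "jet N h b"
proof -
  have "(\<Sum>i\<le>N. a i * t ^ i) = (\<Sum>i\<le>N. b i * t ^ i)" for t
    using assms(2) by (intro sum.cong) auto
  then show ?thesis using assms unfolding jet_def by simp
qed

lemma jet_cong_ev:
  assumes "jet N h a" "\<forall>\<^sub>F t in nhds 0. h t = k t"
  shows "jet N k a"
  unfolding jet_def
proof
  show "k 0 = a 0" using assms eventually_nhds_x_imp_x[OF assms(2)] unfolding jet_def by simp
  have "\<forall>\<^sub>F t in at 0. h t = k t"
    using assms(2) by (auto simp: eventually_at_filter elim: eventually_mono)
  then have "\<forall>\<^sub>F t in at 0. (h t - (\<Sum>i\<le>N. a i * t ^ i)) / t ^ N = (k t - (\<Sum>i\<le>N. a i * t ^ i)) / t ^ N"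
    by eventually_elim simp
  with assms(1) show "((\<lambda>t. (k t - (\<Sum>i\<le>N. a i * t ^ i)) / t ^ N) \<longlongrightarrow> 0) (at 0)"
    unfolding jet_def by (auto intro: Lim_transform_eventually)
qed

lemma jet_polynomial_tendsto: "((\<lambda>t. \<Sum>i\<le>N. a i * t ^ i) \<longlongrightarrow> (a 0 :: real)) (at 0)"
proof -
  have "isCont (\<lambda>t. \<Sum>i\<le>N. a i * t ^ i) 0" by (intro continuous_intros)
  moreover have "(\<Sum>i\<le>N. a i * 0 ^ i) = a 0"
    by (simp add: power_0_left if_distrib[of "\<lambda>x. _ * x"] sum.delta cong: if_cong)
  ultimately show ?thesis by (simp add: isCont_def)
qed

lemma jet_tendsto:
  assumes "jet N h a"
  shows "(h \<longlongrightarrow> a 0) (at 0)"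
proof -
  let ?R = "\<lambda>t. (h t - (\<Sum>i\<le>N. a i * t ^ i)) / t ^ N"
  have "((\<lambda>t. ?R t * t ^ N + (\<Sum>i\<le>N. a i * t ^ i)) \<longlongrightarrow> 0 * 0 ^ N + a 0) (at 0)"
    using assms unfolding jet_def by (intro tendsto_intros jet_polynomial_tendsto) auto
  moreover have "\<forall>\<^sub>F t in at 0. ?R t * t ^ N + (\<Sum>i\<le>N. a i * t ^ i) = h t"
    unfolding eventually_at_filter by (intro always_eventually) auto
  ultimately have "(h \<longlongrightarrow> 0 * 0 ^ N + a 0) (at 0)" by (rule Lim_transform_eventually)
  then show ?thesis by simp
qed

text \<open>Uniqueness of the coefficients: once those below \<open>i\<close> vanish, the remainder
  quotient times \<open>t ^ (N - i)\<close> tends, up to sign, both to 0 and to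
  \<open>a i\<close>.\<close>

lemma jet_zero:
  assumes "jet N h a" "\<forall>\<^sub>F t in nhds 0. h t = 0" "i \<le> N"
  shows "a i = 0"
  using assms(3)
proof (induction i rule: less_induct)
  case (less i)
  have "jet N (\<lambda>_. 0) a" using jet_cong_ev[OF assms(1,2)] .
  then have "((\<lambda>t. - ((0 - (\<Sum>i\<le>N. a i * t ^ i)) / t ^ N) * t ^ (N - i)) \<longlongrightarrow> - 0 * 0 ^ (N - i)) (at 0)"
    unfolding jet_def by (intro tendsto_intros) auto
  moreover have "\<forall>\<^sub>F t in at 0. - ((0 - (\<Sum>j\<le>N. a j * t ^ j)) / t ^ N) * t ^ (N - i) = (\<Sum>j\<le>N-i. a (j + i) * t ^ j)"
    unfolding eventually_at_filter
  proof (intro always_eventually allI impI)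
    fix t :: real assume t: "t \<noteq> 0"
    have "(\<Sum>j\<le>N. a j * t ^ j) = (\<Sum>j\<in>{i..N}. a j * t ^ j)"
      by (rule sum.mono_neutral_right) (use less in auto)
    also have "\<dots> = (\<Sum>j\<le>N-i. a (j + i) * t ^ (j + i))"
      by (rule sum.reindex_bij_witness[of _ "\<lambda>j. j + i" "\<lambda>j. j - i"]) (use less.prems in auto)
    also have "\<dots> = t ^ i * (\<Sum>j\<le>N-i. a (j + i) * t ^ j)"
      by (simp add: sum_distrib_left power_add mult_ac)
    finally have *: "(\<Sum>j\<le>N. a j * t ^ j) = t ^ i * (\<Sum>j\<le>N-i. a (j + i) * t ^ j)" .
    have "t ^ N = t ^ i * t ^ (N - i)" using less.prems by (simp flip: power_add)
    then show "- ((0 - (\<Sum>j\<le>N. a j * t ^ j)) / t ^ N) * t ^ (N - i) = (\<Sum>j\<le>N-i. a (j + i) * t ^ j)"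
      using t by (simp add: *)
  qed
  ultimately have "((\<lambda>t. \<Sum>j\<le>N-i. a (j + i) * t ^ j) \<longlongrightarrow> - 0 * 0 ^ (N - i)) (at 0)"
    by (rule Lim_transform_eventually)
  moreover have "((\<lambda>t. \<Sum>j\<le>N-i. a (j + i) * t ^ j) \<longlongrightarrow> a (0 + i)) (at 0)"
    by (rule jet_polynomial_tendsto)
  ultimately show ?case using tendsto_unique[OF at_neq_bot] by fastforce
qed

lemma jet_add:
  assumes "jet N h a" "jet N k b"
  shows "jet N (\<lambda>t. h t + k t) (\<lambda>i. a i + b i)"
proof -
  have "((\<lambda>t. (h t - (\<Sum>i\<le>N. a i * t ^ i)) / t ^ N + (k t - (\<Sum>i\<le>N. b i * t ^ i)) / t ^ N) \<longlongrightarrow> 0 + 0) (at 0)"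
    using assms unfolding jet_def by (intro tendsto_add) auto
  then show ?thesis using assms unfolding jet_def
    by (simp add: sum.distrib algebra_simps add_divide_distrib[symmetric])
qed

lemma jet_monom: "jet N (\<lambda>t. c * t ^ d) (\<lambda>i. if i = d then c else 0)"
proof (cases "d \<le> N")
  case True
  then have "(\<Sum>i\<le>N. (if i = d then c else 0) * t ^ i) = c * t ^ d" for t :: real
    by (simp add: if_distrib[of "\<lambda>x. x * _"] sum.delta cong: if_cong)
  then show ?thesis unfolding jet_def by (simp add: power_0_left)
next
  case False
  have z: "(\<Sum>i\<le>N. (if i = d then c else 0) * t ^ i) = 0" for t :: real
    by (rule sum.neutral) (use False in auto)
  have "((\<lambda>t. c * t ^ (d - N)) \<longlongrightarrow> c * 0 ^ (d - N)) (at 0)" by (intro tendsto_intros)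
  moreover have "\<forall>\<^sub>F t in at 0. c * t ^ (d - N) = c * t ^ d / t ^ N"
    using False by (auto simp: eventually_at_filter power_diff)
  ultimately have "((\<lambda>t. c * t ^ d / t ^ N) \<longlongrightarrow> c * 0 ^ (d - N)) (at 0)"
    by (rule Lim_transform_eventually)
  then have "((\<lambda>t. c * t ^ d / t ^ N) \<longlongrightarrow> 0) (at 0)" using False by (simp add: power_0_left)
  then show ?thesis unfolding jet_def using False by (simp add: z power_0_left)
qed

lemma jet_const: "jet N (\<lambda>t. c) (\<lambda>i. if i = 0 then c else 0)"
  using jet_monom[of N c 0] by simp

lemma jet_sum:
  assumes "\<And>j. j \<in> A \<Longrightarrow> jet N (h j) (a j)"
  shows "jet N (\<lambda>t. \<Sum>j\<in>A. h j t) (\<lambda>i. \<Sum>j\<in>A. a j i)"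
  using assms
proof (induction A rule: infinite_finite_induct)
  case (insert x F)
  then show ?case by (simp add: jet_add)
qed (use jet_const[of N 0] in auto)

lemma jet_mult:
  assumes "jet N h a" "jet N k b"
  shows "jet N (\<lambda>t. h t * k t) (\<lambda>i. \<Sum>j\<le>i. a j * b (i - j))"
proof -
  \<comment> \<open>The entries beyond \<open>N\<close> are arbitrary, while
    \<open>polynomial_product\<close> asks for coefficients that vanish beyond the degree.\<close>
  define a' where "a' = (\<lambda>i. if i \<le> N then a i else 0)"
  define b' where "b' = (\<lambda>i. if i \<le> N then b i else 0)"
  define c where "c = (\<lambda>i. \<Sum>j\<le>i. a' j * b' (i - j))"
  have c: "c i = (\<Sum>j\<le>i. a j * b (i - j))" if "i \<le> N" for i
    unfolding c_def a'_def b'_def using that by (intro sum.cong) auto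
  have prod: "(\<Sum>i\<le>N. a i * t ^ i) * (\<Sum>i\<le>N. b i * t ^ i) = (\<Sum>i\<le>N. c i * t ^ i) + (\<Sum>i\<in>{N<..N+N}. c i * t ^ i)" for t
  proof -
    have "(\<Sum>i\<le>N. a i * t ^ i) * (\<Sum>i\<le>N. b i * t ^ i) = (\<Sum>i\<le>N. a' i * t ^ i) * (\<Sum>i\<le>N. b' i * t ^ i)"
      unfolding a'_def b'_def by (intro arg_cong2[where f = "(*)"] sum.cong) auto
    also have "\<dots> = (\<Sum>i\<le>N+N. c i * t ^ i)"
      unfolding c_def by (rule polynomial_product) (auto simp: a'_def b'_def)
    also have "{..N+N} = {..N} \<union> {N<..N+N}" by auto
    also have "(\<Sum>i\<in>{..N} \<union> {N<..N+N}. c i * t ^ i) = (\<Sum>i\<le>N. c i * t ^ i) + (\<Sum>i\<in>{N<..N+N}. c i * t ^ i)"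
      by (rule sum.union_disjoint) auto
    finally show ?thesis .
  qed
  let ?A = "\<lambda>t. \<Sum>i\<le>N. a i * t ^ i" and ?B = "\<lambda>t. \<Sum>i\<le>N. b i * t ^ i"
  have "((\<lambda>t. (h t - ?A t) / t ^ N * k t + ?A t * ((k t - ?B t) / t ^ N) + (\<Sum>i\<in>{N<..N+N}. c i * t ^ (i - N)))
      \<longlongrightarrow> 0 * b 0 + a 0 * 0 + (\<Sum>i\<in>{N<..N+N}. c i * 0 ^ (i - N))) (at 0)"
    using assms jet_tendsto[OF assms(2)] unfolding jet_def
    by (intro tendsto_intros jet_polynomial_tendsto) auto
  moreover have "(\<Sum>i\<in>{N<..N+N}. c i * 0 ^ (i - N)) = 0"
    by (rule sum.neutral) auto
  ultimately have lim: "((\<lambda>t. (h t - ?A t) / t ^ N * k t + ?A t * ((k t - ?B t) / t ^ N) + (\<Sum>i\<in>{N<..N+N}. c i * t ^ (i - N)))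
      \<longlongrightarrow> 0) (at 0)" by simp
  moreover have "\<forall>\<^sub>F t in at 0. (h t - ?A t) / t ^ N * k t + ?A t * ((k t - ?B t) / t ^ N) + (\<Sum>i\<in>{N<..N+N}. c i * t ^ (i - N))
      = (h t * k t - (\<Sum>i\<le>N. c i * t ^ i)) / t ^ N"
    unfolding eventually_at_filter
  proof (intro always_eventually allI impI)
    fix t :: real assume t: "t \<noteq> 0"
    have "(\<Sum>i\<in>{N<..N+N}. c i * t ^ (i - N)) = (\<Sum>i\<in>{N<..N+N}. c i * t ^ i) / t ^ N"
      unfolding sum_divide_distrib using t by (intro sum.cong) (auto simp: power_diff)
    moreover have "(\<Sum>i\<in>{N<..N+N}. c i * t ^ i) = ?A t * ?B t - (\<Sum>i\<le>N. c i * t ^ i)"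
      using prod[of t] by simp
    ultimately show "(h t - ?A t) / t ^ N * k t + ?A t * ((k t - ?B t) / t ^ N) + (\<Sum>i\<in>{N<..N+N}. c i * t ^ (i - N))
      = (h t * k t - (\<Sum>i\<le>N. c i * t ^ i)) / t ^ N"
      using t by (simp add: field_simps)
  qed
  ultimately have "((\<lambda>t. (h t * k t - (\<Sum>i\<le>N. c i * t ^ i)) / t ^ N) \<longlongrightarrow> 0) (at 0)"
    by (rule Lim_transform_eventually)
  then have "jet N (\<lambda>t. h t * k t) c"
    using assms c[of 0] unfolding jet_def by simp
  then show ?thesis by (rule jet_cong) (rule c)
qed

lemma jet_cmult: "jet N h a \<Longrightarrow> jet N (\<lambda>t. c * h t) (\<lambda>i. c * a i)"
proof -
  assume a: "jet N h a"
  show ?thesis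
    by (rule jet_cong[OF jet_mult[OF jet_const[of N c] a]])
       (simp add: if_distrib[of "\<lambda>x. x * _"] sum.delta cong: if_cong)
qed

text \<open>Expansions can be integrated, by l'Hopital's rule. Peano expansions cannot be
  differentiated, so higher jets are built upwards from those of the derivatives.\<close>

lemma jet_deriv:
  assumes "\<forall>\<^sub>F t in nhds 0. (h has_real_derivative h' t) (at t)" "jet N h' b"
  shows "jet (Suc N) h (\<lambda>i. case i of 0 \<Rightarrow> h 0 | Suc j \<Rightarrow> b j / real (Suc j))"
proof -
  let ?a = "\<lambda>i. case i of 0 \<Rightarrow> h 0 | Suc j \<Rightarrow> b j / real (Suc j)"
  let ?p = "\<lambda>t. \<Sum>i\<le>Suc N. ?a i * t ^ i"
  have p: "?p t = h 0 + (\<Sum>i\<le>N. b i / real (Suc i) * t ^ Suc i)" for t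
    by (subst sum.atMost_Suc_shift) simp
  have dp: "(?p has_real_derivative (\<Sum>i\<le>N. b i * t ^ i)) (at t)" for t
  proof -
    have "((\<lambda>t. b i / real (Suc i) * t ^ Suc i) has_real_derivative b i * t ^ i) (at t)" for i
      using DERIV_cmult[OF DERIV_pow[of "Suc i" t UNIV], of "b i / real (Suc i)"] by simp
    from DERIV_add[OF DERIV_const DERIV_sum[OF this]] show ?thesis unfolding p by simp
  qed
  have "h differentiable (at 0)"
    using eventually_nhds_x_imp_x[OF assms(1)] real_differentiable_def by blast
  then have "isCont h 0" by (simp add: differentiable_imp_continuous_within)
  then have h0: "(h \<longlongrightarrow> h 0) (at 0)" by (simp add: isCont_def)
  have "((\<lambda>t. (h t - ?p t) / t ^ Suc N) \<longlongrightarrow> 0) (at 0)"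
  proof (rule lhopital)
    show "((\<lambda>t. h t - ?p t) \<longlongrightarrow> 0) (at 0)"
      using tendsto_diff[OF h0 jet_polynomial_tendsto[of ?a "Suc N"]] by simp
    show "((\<lambda>t :: real. t ^ Suc N) \<longlongrightarrow> 0) (at 0)"
      using tendsto_power[OF tendsto_ident_at[of "0 :: real" UNIV], of "Suc N"] by simp
    show "\<forall>\<^sub>F t :: real in at 0. t ^ Suc N \<noteq> 0"
      unfolding eventually_at_filter by (intro always_eventually) auto
    show "\<forall>\<^sub>F t :: real in at 0. real (Suc N) * t ^ N \<noteq> 0"
      unfolding eventually_at_filter by (intro always_eventually) auto
    show "\<forall>\<^sub>F t in at 0. ((\<lambda>t. h t - ?p t) has_real_derivative (h' t - (\<Sum>i\<le>N. b i * t ^ i))) (at t)"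
      unfolding eventually_at_filter using assms(1)
    proof eventually_elim
      case (elim t)
      then show ?case by (intro impI DERIV_diff[OF _ dp])
    qed
    show "\<forall>\<^sub>F t in at 0. ((\<lambda>t. t ^ Suc N) has_real_derivative real (Suc N) * t ^ N) (at t)"
      using DERIV_pow[of "Suc N"] by (intro always_eventually allI) simp
    have "((\<lambda>t. inverse (real (Suc N)) * ((h' t - (\<Sum>i\<le>N. b i * t ^ i)) / t ^ N)) \<longlongrightarrow> inverse (real (Suc N)) * 0) (at 0)"
      using assms(2) unfolding jet_def by (intro tendsto_intros) auto
    then show "((\<lambda>t. (h' t - (\<Sum>i\<le>N. b i * t ^ i)) / (real (Suc N) * t ^ N)) \<longlongrightarrow> 0) (at 0)"
      by (simp only: divide_inverse inverse_mult_distrib mult_ac mult_zero_left)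
  qed
  then show ?thesis unfolding jet_def by simp
qed

lemma jet_0: "isCont h 0 \<Longrightarrow> jet 0 h (\<lambda>_. h 0)"
  unfolding jet_def isCont_def using tendsto_diff[of h "h 0" "at 0" "\<lambda>_. h 0" "h 0"] by simp

lemma jet_scale:
  assumes "jet N h a"
  shows "jet N (\<lambda>t. h (s * t)) (\<lambda>i. a i * s ^ i)"
proof (cases "s = 0")
  case True
  then have "h (s * t) = a 0" for t using assms unfolding jet_def by simp
  then show ?thesis
    using jet_cong[OF jet_const[of N "a 0"], of "\<lambda>i. a i * s ^ i"] True by (auto simp: power_0_left)
next
  case False
  have "filterlim (\<lambda>t. s * t) (at 0) (at 0)"
    unfolding filterlim_at using False tendsto_mult[OF tendsto_const tendsto_ident_at, of s "0::real" UNIV]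
    by (auto simp: eventually_at_filter)
  with assms have "((\<lambda>t. (h (s * t) - (\<Sum>i\<le>N. a i * (s * t) ^ i)) / (s * t) ^ N) \<longlongrightarrow> 0) (at 0)"
    unfolding jet_def using filterlim_compose by blast
  then have "((\<lambda>t. s ^ N * ((h (s * t) - (\<Sum>i\<le>N. a i * (s * t) ^ i)) / (s * t) ^ N)) \<longlongrightarrow> s ^ N * 0) (at 0)"
    by (intro tendsto_intros)
  then show ?thesis
    using assms False unfolding jet_def by (simp add: power_mult_distrib mult_ac)
qed

lemma smooth_DERIV:
  assumes "smooth f"
  shows "((deriv ^^ k) f has_real_derivative (deriv ^^ Suc k) f t) (at t)"
proof -
  have "(deriv ^^ k) f differentiable (at t)"
    using assms unfolding smooth_def differentiable_on_def by simp
  then show ?thesis by (simp add: DERIV_deriv_iff_real_differentiable)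
qed

lemma jet_smooth:
  assumes "smooth f"
  shows "jet N ((deriv ^^ k) f) (\<lambda>i. (deriv ^^ (k + i)) f 0 / fact i)"
proof (induction N arbitrary: k)
  case 0
  have "isCont ((deriv ^^ k) f) 0" using smooth_DERIV[OF assms, of k 0] DERIV_isCont by blast
  from jet_0[OF this] show ?case by (rule jet_cong) simp
next
  case (Suc N)
  have "\<forall>\<^sub>F t in nhds 0. ((deriv ^^ k) f has_real_derivative (deriv ^^ Suc k) f t) (at t)"
    by (intro always_eventually allI smooth_DERIV assms)
  from jet_deriv[OF this Suc.IH] show ?case
    by (rule jet_cong) (auto split: nat.split)
qed

section \<open>The tangency equations\<close>

definition idx_pairs :: "nat \<Rightarrow> (nat \<times> nat) set" where
  "idx_pairs n = {(j, k). 0 < j \<and> j < j + k \<and> j + k \<le> n}"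

definition hyp_poly :: "nat \<Rightarrow> (nat \<Rightarrow> real) \<Rightarrow> real" where
  "hyp_poly n x = (\<Sum>(j, k)\<in>idx_pairs n. x j * x k * x n ^ (n - j - k))"

text \<open>The differential of \<open>hyp_poly n\<close> at \<open>x\<close> in direction
  \<open>v\<close>. Symmetry of the sum in \<open>j\<close> and \<open>k\<close> merges the
  derivatives of the two linear factors into \<open>2 * v j * x k\<close>. For
  \<open>j + k = n\<close> the truncated exponent is harmless, as the factor in front is 0.\<close>

definition d_hyp_poly :: "nat \<Rightarrow> (nat \<Rightarrow> real) \<Rightarrow> (nat \<Rightarrow> real) \<Rightarrow> real" where
  "d_hyp_poly n x v = (\<Sum>(j, k)\<in>idx_pairs n. 2 * v j * x k * x n ^ (n - j - k)
     + real (n - j - k) * x j * x k * x n ^ (n - j - k - 1) * v n)"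

lemma finite_idx_pairs [simp]: "finite (idx_pairs n)"
  by (rule finite_subset[of _ "{..n} \<times> {..n}"]) (auto simp: idx_pairs_def)

lemma sum_idx_pairs_swap: "(\<Sum>(j, k)\<in>idx_pairs n. g k j) = (\<Sum>(j, k)\<in>idx_pairs n. g j k)"
  by (rule sum.reindex_bij_witness[of _ prod.swap prod.swap]) (auto simp: idx_pairs_def)

lemma hyp_poly_has_derivative:
  assumes "\<And>i. i \<in> {1..n} \<Longrightarrow> ((\<lambda>t. x t i) has_real_derivative v i) (at t)"
  shows "((\<lambda>t. hyp_poly n (x t)) has_real_derivative d_hyp_poly n (x t) v) (at t)"
proof -
  have "((\<lambda>t. \<Sum>p\<in>idx_pairs n. x t (fst p) * x t (snd p) * x t n ^ (n - fst p - snd p)) has_real_derivative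
    (\<Sum>p\<in>idx_pairs n. v (fst p) * x t (snd p) * x t n ^ (n - fst p - snd p) + v (snd p) * x t (fst p) * x t n ^ (n - fst p - snd p)
      + real (n - fst p - snd p) * x t (fst p) * x t (snd p) * x t n ^ (n - fst p - snd p - 1) * v n)) (at t)"
  proof (rule DERIV_sum)
    fix p assume "p \<in> idx_pairs n"
    then have "fst p \<in> {1..n}" "snd p \<in> {1..n}" "n \<in> {1..n}" by (auto simp: idx_pairs_def)
    from this[THEN assms]
    show "((\<lambda>t. x t (fst p) * x t (snd p) * x t n ^ (n - fst p - snd p)) has_real_derivative
      (v (fst p) * x t (snd p) * x t n ^ (n - fst p - snd p) + v (snd p) * x t (fst p) * x t n ^ (n - fst p - snd p)
      + real (n - fst p - snd p) * x t (fst p) * x t (snd p) * x t n ^ (n - fst p - snd p - 1) * v n)) (at t)"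
      by (auto intro!: derivative_eq_intros simp: algebra_simps)
  qed
  moreover have "(\<Sum>p\<in>idx_pairs n. v (fst p) * x t (snd p) * x t n ^ (n - fst p - snd p) + v (snd p) * x t (fst p) * x t n ^ (n - fst p - snd p)
      + real (n - fst p - snd p) * x t (fst p) * x t (snd p) * x t n ^ (n - fst p - snd p - 1) * v n) = d_hyp_poly n (x t) v"
    (is "?L = _")
  proof -
    have "?L = (\<Sum>(j, k)\<in>idx_pairs n. v j * x t k * x t n ^ (n - j - k)) + (\<Sum>(j, k)\<in>idx_pairs n. v k * x t j * x t n ^ (n - j - k))
      + (\<Sum>(j, k)\<in>idx_pairs n. real (n - j - k) * x t j * x t k * x t n ^ (n - j - k - 1) * v n)"
      by (simp add: sum.distrib split_beta)
    also have "(\<Sum>(j, k)\<in>idx_pairs n. v k * x t j * x t n ^ (n - j - k)) = (\<Sum>(j, k)\<in>idx_pairs n. v j * x t k * x t n ^ (n - j - k))"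
      by (rule trans[OF sum_idx_pairs_swap[of "\<lambda>a b. v a * x t b * x t n ^ (n - b - a)" n] sum.cong])
         (auto simp: add.commute)
    finally show ?thesis unfolding d_hyp_poly_def by (simp add: sum.distrib split_beta algebra_simps sum_distrib_left)
  qed
  ultimately show ?thesis unfolding hyp_poly_def by (simp add: split_beta)
qed

section \<open>Tangency as one linear equation at each point\<close>

lemma holomorphic_vf_on_iff:
  "holomorphic_vf_on X U \<longleftrightarrow> (\<forall>i. chol (\<lambda>z. X z $ i) U)"
proof
  assume h: "holomorphic_vf_on X U"
  show "\<forall>i. chol (\<lambda>z. X z $ i) U"
  proof
    fix i
    show "chol (\<lambda>z. X z $ i) U"
      unfolding chol_def
    proof
      fix z assume "z \<in> U"
      with h obtain D where D: "(X has_derivative D) (at z)" "Vector_Spaces.linear (*s) (*s) D"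
        unfolding holomorphic_vf_on_def by metis
      interpret D: Vector_Spaces.linear "(*s)" "(*s)" D by (rule D(2))
      have e: "(\<lambda>h. D h $ i) = (\<lambda>h. \<Sum>k\<in>UNIV. h $ k * D (axis k 1) $ i)"
      proof
        fix h
        have "D h $ i = D (\<Sum>k\<in>UNIV. h $ k *s axis k 1) $ i" by (simp only: basis_expansion)
        also have "\<dots> = (\<Sum>k\<in>UNIV. h $ k * D (axis k 1) $ i)" by (simp add: D.sum D.scale)
        finally show "D h $ i = (\<Sum>k\<in>UNIV. h $ k * D (axis k 1) $ i)" .
      qed
      have "((\<lambda>z. X z $ i) has_derivative (\<lambda>h. D h $ i)) (at z)"
        using D(1) by (rule bounded_linear.has_derivative[OF bounded_linear_vec_nth])
      then show "\<exists>g. ((\<lambda>z. X z $ i) has_derivative (\<lambda>h. \<Sum>k\<in>UNIV. h $ k * g k)) (at z)"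
        unfolding e by (intro exI[of _ "\<lambda>k. D (axis k 1) $ i"])
    qed
  qed
next
  assume h: "\<forall>i. chol (\<lambda>z. X z $ i) U"
  show "holomorphic_vf_on X U"
    unfolding holomorphic_vf_on_def
  proof
    fix z assume z: "z \<in> U"
    define D where "D = (\<lambda>h :: complex ^ 'a. \<chi> i. \<Sum>k\<in>UNIV. h $ k * pd k (\<lambda>z. X z $ i) z)"
    have "(X has_derivative D) (at z)"
    proof (rule iffD2[OF has_derivative_componentwise_within], rule ballI)
      fix b :: "complex ^ 'a" assume "b \<in> Basis"
      then obtain i u where b: "b = axis i u" by (auto simp: Basis_vec_def)
      have "((\<lambda>z. X z $ i) has_derivative (\<lambda>h. D h $ i)) (at z)"
        using chol_has_derivative[OF h[rule_format] z] unfolding D_def by simp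
      then show "((\<lambda>z. X z \<bullet> b) has_derivative (\<lambda>h. D h \<bullet> b)) (at z)"
        unfolding b inner_axis by (rule bounded_linear.has_derivative[OF bounded_linear_inner_left])
    qed
    moreover have "D = (*v) (\<chi> i k. pd k (\<lambda>z. X z $ i) z)"
      by (simp add: D_def matrix_vector_mult_def fun_eq_iff vec_eq_iff mult.commute)
    then have "Vector_Spaces.linear (*s) (*s) D"
      by (simp only: matrix_vector_mul_linear_gen)
    ultimately show "\<exists>D. (X has_derivative D) (at z) \<and> Vector_Spaces.linear (*s) (*s) D"
      by (intro exI[of _ D] conjI)
  qed
qed

lemma smooth_deriv: "smooth f \<Longrightarrow> (f has_real_derivative deriv f t) (at t)"
  using smooth_DERIV[of f 0] by simp

locale indexed =
  fixes n :: nat and c :: "nat \<Rightarrow> 'm::finite"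
  assumes n4: "n > 4" and bij: "bij_betw c {0..n} UNIV"
begin

lemma c_eq_iff: "i \<le> n \<Longrightarrow> j \<le> n \<Longrightarrow> c i = c j \<longleftrightarrow> i = j"
  using bij unfolding bij_betw_def inj_on_def by auto

lemma sum_c: "(\<Sum>k\<in>UNIV. g k) = (\<Sum>k\<in>{0..n}. g (c k))"
  using sum.reindex_bij_betw[OF bij, of g] by simp

definition rc :: "complex ^ 'm \<Rightarrow> nat \<Rightarrow> real" where
  "rc z i = Re (z $ c i)"

lemma mem_M_hyp: "z \<in> M_hyp n c f \<longleftrightarrow> rc z 0 = f (rc z 1) + hyp_poly n (rc z)"
  unfolding M_hyp_def hyp_poly_def idx_pairs_def rc_def Let_def by simp

lemma tangent_space_M_hyp:
  assumes "smooth f" "p \<in> M_hyp n c f"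
  shows "v \<in> tangent_space (M_hyp n c f) p \<longleftrightarrow> rc v 0 = deriv f (rc p 1) * rc v 1 + d_hyp_poly n (rc p) (rc v)"
proof -
  have comp: "((\<lambda>t. rc (\<gamma> t) i) has_real_derivative rc v i) (at 0)"
    if "(\<gamma> has_vector_derivative v) (at 0)" for \<gamma> i and v :: "complex ^ 'm"
  proof -
    have "bounded_linear (\<lambda>z :: complex ^ 'm. rc z i)"
      unfolding rc_def by (intro bounded_linear_compose[OF bounded_linear_Re] bounded_linear_vec_nth)
    from bounded_linear.has_vector_derivative[OF this that]
    show ?thesis by (simp add: has_real_derivative_iff_has_vector_derivative)
  qed
  have der: "((\<lambda>t. f (x t 1) + hyp_poly n (x t)) has_real_derivative (deriv f (rc p 1) * w 1 + d_hyp_poly n (rc p) w)) (at 0)"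
    if "\<And>i. i \<in> {1..n} \<Longrightarrow> ((\<lambda>t. x t i) has_real_derivative w i) (at 0)" "x 0 = rc p" for x w
  proof -
    have "((\<lambda>t. f (x t 1)) has_real_derivative deriv f (x 0 1) * w 1) (at 0)"
      using n4 by (intro DERIV_chain2[OF smooth_deriv[OF assms(1)]] that(1)) auto
    from DERIV_add[OF this hyp_poly_has_derivative[of n x w 0]] show ?thesis using that by simp
  qed
  show ?thesis
  proof
    assume "v \<in> tangent_space (M_hyp n c f) p"
    then obtain \<gamma> where \<gamma>: "\<gamma> 0 = p" "\<forall>\<^sub>F t in nhds 0. \<gamma> t \<in> M_hyp n c f" "(\<gamma> has_vector_derivative v) (at 0)"
      unfolding tangent_space_def by blast
    have "((\<lambda>t. f (rc (\<gamma> t) 1) + hyp_poly n (rc (\<gamma> t))) has_real_derivative (deriv f (rc p 1) * rc v 1 + d_hyp_poly n (rc p) (rc v))) (at 0)"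
      by (rule der) (use comp[OF \<gamma>(3)] \<gamma>(1) in auto)
    moreover have "\<forall>\<^sub>F t in nhds 0. f (rc (\<gamma> t) 1) + hyp_poly n (rc (\<gamma> t)) = rc (\<gamma> t) 0"
      using \<gamma>(2) by eventually_elim (simp add: mem_M_hyp)
    ultimately have "((\<lambda>t. rc (\<gamma> t) 0) has_real_derivative (deriv f (rc p 1) * rc v 1 + d_hyp_poly n (rc p) (rc v))) (at 0)"
      using DERIV_cong_ev by fastforce
    with comp[OF \<gamma>(3), of 0] show "rc v 0 = deriv f (rc p 1) * rc v 1 + d_hyp_poly n (rc p) (rc v)"
      by (rule DERIV_unique)
  next
    assume v: "rc v 0 = deriv f (rc p 1) * rc v 1 + d_hyp_poly n (rc p) (rc v)"
    define x where "x = (\<lambda>t i. rc p i + t * rc v i)"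
    \<comment> \<open>The straight line in direction \<open>v\<close> leaves the hypersurface by
      \<open>h t\<close>. Since \<open>v\<close> satisfies the equation, \<open>h\<close> has
      derivative 0 at 0, and adding \<open>h\<close> to the real part of \<open>z_0\<close> brings
      the line onto the hypersurface without changing its velocity.\<close>
    define h where "h = (\<lambda>t. f (x t 1) + hyp_poly n (x t) - rc p 0 - t * rc v 0)"
    define \<gamma> where "\<gamma> = (\<lambda>t. p + t *\<^sub>R v + axis (c 0) (complex_of_real (h t)))"
    have x0: "x 0 = rc p" by (simp add: x_def)
    have h0: "h 0 = 0" using assms(2) by (simp add: h_def x0 mem_M_hyp)
    have "((\<lambda>t. f (x t 1) + hyp_poly n (x t)) has_real_derivative (deriv f (rc p 1) * rc v 1 + d_hyp_poly n (rc p) (rc v))) (at 0)"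
      by (rule der) (auto simp: x0, auto simp: x_def intro!: derivative_eq_intros)
    from DERIV_diff[OF DERIV_diff[OF this DERIV_const[of "rc p 0"]] DERIV_cmult_right[OF DERIV_ident, of "rc v 0"]]
    have "(h has_real_derivative 0) (at 0)"
      unfolding h_def using v by simp
    then have "(h has_vector_derivative 0) (at 0)"
      by (simp add: has_real_derivative_iff_has_vector_derivative)
    from bounded_linear.has_vector_derivative[OF bounded_linear_compose[OF bounded_linear_axis bounded_linear_of_real] this]
    have "((\<lambda>t. axis (c 0) (complex_of_real (h t)) :: complex ^ 'm) has_vector_derivative 0) (at 0)"
      by simp
    moreover have "((\<lambda>t. p + t *\<^sub>R v) has_vector_derivative v) (at 0)"
      by (auto intro!: derivative_eq_intros)
    ultimately have "(\<gamma> has_vector_derivative v) (at 0)"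
      unfolding \<gamma>_def using has_vector_derivative_add by fastforce
    moreover have "\<gamma> t \<in> M_hyp n c f" for t
    proof -
      have r0: "rc (\<gamma> t) 0 = rc p 0 + t * rc v 0 + h t" by (simp add: \<gamma>_def rc_def)
      have ri: "rc (\<gamma> t) i = x t i" if "i \<in> {1..n}" for i
        using that c_eq_iff[of 0 i] by (auto simp: \<gamma>_def rc_def x_def axis_def)
      have "hyp_poly n (rc (\<gamma> t)) = hyp_poly n (x t)"
        unfolding hyp_poly_def by (rule sum.cong) (auto simp: idx_pairs_def ri)
      then show ?thesis using n4 by (simp add: mem_M_hyp r0 ri h_def)
    qed
    ultimately show "v \<in> tangent_space (M_hyp n c f) p"
      unfolding tangent_space_def mem_Collect_eq
      using h0 by (intro exI[of _ \<gamma>] conjI always_eventually allI) (simp_all add: \<gamma>_def)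
  qed
qed

lemma d_hyp_poly_scale: "d_hyp_poly n x (\<lambda>i. a * v i) = a * d_hyp_poly n x v"
  unfolding d_hyp_poly_def by (simp add: sum_distrib_left split_beta algebra_simps)

text \<open>The factor 1/2 of \<open>re_part\<close> is dropped, the equation being homogeneous in
  the field.\<close>

definition tang :: "(real \<Rightarrow> real) \<Rightarrow> (complex ^ 'm \<Rightarrow> complex ^ 'm) \<Rightarrow> (complex ^ 'm) set \<Rightarrow> bool" where
  "tang f X U \<longleftrightarrow> (\<forall>p \<in> M_hyp n c f \<inter> U. rc (X p) 0 = deriv f (rc p 1) * rc (X p) 1 + d_hyp_poly n (rc p) (rc (X p)))"

lemma mem_hol_M_hyp:
  assumes "smooth f"
  shows "g \<in> hol (M_hyp n c f) \<longleftrightarrow> (\<exists>X r. g = germ X \<and> r > 0 \<and> (\<forall>i. chol (\<lambda>z. X z $ i) (ball 0 r)) \<and> tang f X (ball 0 r))"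
proof -
  have half: "re_part X p \<in> tangent_space (M_hyp n c f) p \<longleftrightarrow>
     rc (X p) 0 = deriv f (rc p 1) * rc (X p) 1 + d_hyp_poly n (rc p) (rc (X p))" if "p \<in> M_hyp n c f" for X p
  proof -
    have h: "rc (re_part X p) = (\<lambda>i. 1/2 * rc (X p) i)" by (auto simp: rc_def re_part_def)
    have "d_hyp_poly n (rc p) (rc (re_part X p)) = 1/2 * d_hyp_poly n (rc p) (rc (X p))" unfolding h by (rule d_hyp_poly_scale)
    then show ?thesis unfolding tangent_space_M_hyp[OF assms that] by (auto simp: h)
  qed
  show ?thesis
  proof
    assume "g \<in> hol (M_hyp n c f)"
    then obtain X U where X: "g = germ X" "open U" "0 \<in> U" "holomorphic_vf_on X U"
      "\<forall>p\<in>M_hyp n c f \<inter> U. re_part X p \<in> tangent_space (M_hyp n c f) p"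
      unfolding hol_def by blast
    obtain r where r: "r > 0" "ball 0 r \<subseteq> U" using X(2,3) open_contains_ball by blast
    have "\<forall>i. chol (\<lambda>z. X z $ i) (ball 0 r)"
      using X(4) chol_subset[OF _ r(2)] unfolding holomorphic_vf_on_iff by simp
    moreover have "tang f X (ball 0 r)"
      unfolding tang_def using X(5) r(2) half by blast
    ultimately show "\<exists>X r. g = germ X \<and> r > 0 \<and> (\<forall>i. chol (\<lambda>z. X z $ i) (ball 0 r)) \<and> tang f X (ball 0 r)"
      using X(1) r(1) by blast
  next
    assume "\<exists>X r. g = germ X \<and> r > 0 \<and> (\<forall>i. chol (\<lambda>z. X z $ i) (ball 0 r)) \<and> tang f X (ball 0 r)"
    then obtain X r where X: "g = germ X" "r > 0" "\<forall>i. chol (\<lambda>z. X z $ i) (ball 0 r)" "tang f X (ball 0 r)"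
      by blast
    have "\<forall>p\<in>M_hyp n c f \<inter> ball 0 r. re_part X p \<in> tangent_space (M_hyp n c f) p"
      using X(4) half unfolding tang_def by blast
    then show "g \<in> hol (M_hyp n c f)"
      unfolding hol_def mem_Collect_eq holomorphic_vf_on_iff
      using X by (metis centre_in_ball open_ball)
  qed
qed

end

text \<open>Pairs with the same sum \<open>s\<close> carry the same power
  \<open>x_n ^ (n - s)\<close>. For \<open>g j k = x j * x k\<close> and
  \<open>s = n, n - 1, n - 2\<close>, the sums times this power are the parts of
  \<open>hyp_poly\<close> of degree 2, 3, 4.\<close>

definition conv_sum :: "nat \<Rightarrow> (nat \<Rightarrow> nat \<Rightarrow> real) \<Rightarrow> real" where
  "conv_sum s g = (\<Sum>(j, k) | 0 < j \<and> 0 < k \<and> j + k = s. g j k)"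

lemma sum_idx_pairs_eq_conv_sum:
  assumes "s < n"
  shows "(\<Sum>(j, k)\<in>idx_pairs n. if n - j - k = s then g j k else 0) = conv_sum (n - s) g"
proof -
  have "(\<Sum>(j, k)\<in>idx_pairs n. if n - j - k = s then g j k else 0) = (\<Sum>p\<in>idx_pairs n. if n - fst p - snd p = s then g (fst p) (snd p) else 0)"
    by (simp add: split_beta)
  also have "\<dots> = (\<Sum>p | p \<in> idx_pairs n \<and> n - fst p - snd p = s. g (fst p) (snd p))"
    by (simp add: sum.inter_filter)
  also have "{p. p \<in> idx_pairs n \<and> n - fst p - snd p = s} = {(j, k). 0 < j \<and> 0 < k \<and> j + k = n - s}"
    using assms by (auto simp: idx_pairs_def)
  finally show ?thesis unfolding conv_sum_def by (simp add: split_beta)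
qed

lemma jet_mono:
  assumes "jet N h a" "M \<le> N"
  shows "jet M h a"
proof -
  have sp: "{..N} = {..M} \<union> {M<..N}" using assms(2) by auto
  have "((\<lambda>t. (h t - (\<Sum>i\<le>N. a i * t ^ i)) / t ^ N * t ^ (N - M) + (\<Sum>i\<in>{M<..N}. a i * t ^ (i - M)))
    \<longlongrightarrow> 0 * 0 ^ (N - M) + (\<Sum>i\<in>{M<..N}. a i * 0 ^ (i - M))) (at 0)"
    using assms(1) unfolding jet_def by (intro tendsto_intros) auto
  moreover have "(\<Sum>i\<in>{M<..N}. a i * 0 ^ (i - M)) = 0" by (rule sum.neutral) auto
  ultimately have "((\<lambda>t. (h t - (\<Sum>i\<le>N. a i * t ^ i)) / t ^ N * t ^ (N - M) + (\<Sum>i\<in>{M<..N}. a i * t ^ (i - M))) \<longlongrightarrow> 0) (at 0)"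
    by simp
  moreover have "\<forall>\<^sub>F t in at 0. (h t - (\<Sum>i\<le>N. a i * t ^ i)) / t ^ N * t ^ (N - M) + (\<Sum>i\<in>{M<..N}. a i * t ^ (i - M))
    = (h t - (\<Sum>i\<le>M. a i * t ^ i)) / t ^ M"
    unfolding eventually_at_filter
  proof (intro always_eventually allI impI)
    fix t :: real assume t: "t \<noteq> 0"
    have "(\<Sum>i\<in>{M<..N}. a i * t ^ (i - M)) = (\<Sum>i\<in>{M<..N}. a i * t ^ i) / t ^ M"
      unfolding sum_divide_distrib using t by (intro sum.cong) (auto simp: power_diff)
    moreover have "(\<Sum>i\<le>N. a i * t ^ i) = (\<Sum>i\<le>M. a i * t ^ i) + (\<Sum>i\<in>{M<..N}. a i * t ^ i)"
      unfolding sp by (rule sum.union_disjoint) auto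
    moreover have "t ^ N = t ^ M * t ^ (N - M)" using assms(2) by (simp flip: power_add)
    ultimately show "(h t - (\<Sum>i\<le>N. a i * t ^ i)) / t ^ N * t ^ (N - M) + (\<Sum>i\<in>{M<..N}. a i * t ^ (i - M))
      = (h t - (\<Sum>i\<le>M. a i * t ^ i)) / t ^ M"
      using t by (simp add: field_simps)
  qed
  ultimately have "((\<lambda>t. (h t - (\<Sum>i\<le>M. a i * t ^ i)) / t ^ M) \<longlongrightarrow> 0) (at 0)"
    by (rule Lim_transform_eventually)
  then show ?thesis using assms(1) unfolding jet_def by simp
qed

lemma jet_monom_mult:
  assumes "jet N h a"
  shows "jet N (\<lambda>t. c * t ^ d * h t) (\<lambda>i. if d \<le> i then c * a (i - d) else 0)"
  by (rule jet_cong[OF jet_mult[OF jet_monom[of N c d] assms]])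
     (simp add: if_distrib[of "\<lambda>x. x * _"] sum.delta cong: if_cong)

text \<open>At \<open>x = t \<xi>\<close> both terms of a pair \<open>(j, k)\<close> carry the power
  \<open>t ^ Suc (n - j - k)\<close>, which shifts the coefficients of the direction
  \<open>v\<close>.\<close>

lemma jet_d_hyp_poly:
  assumes v: "\<And>i. i \<in> {1..n} \<Longrightarrow> jet N (v i) (a i)"
  shows "jet N (\<lambda>t. d_hyp_poly n (\<lambda>i. t * \<xi> i) (\<lambda>i. v i t))
    (\<lambda>i. \<Sum>(j, k)\<in>idx_pairs n. if Suc (n - j - k) \<le> i then 2 * \<xi> k * \<xi> n ^ (n - j - k) * a j (i - Suc (n - j - k))
      + real (n - j - k) * \<xi> j * \<xi> k * \<xi> n ^ (n - j - k - 1) * a n (i - Suc (n - j - k)) else 0)"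
proof -
  define d where "d = (\<lambda>p. Suc (n - fst p - snd p))"
  define A where "A = (\<lambda>p. 2 * \<xi> (snd p) * \<xi> n ^ (n - fst p - snd p))"
  define B where "B = (\<lambda>p. real (n - fst p - snd p) * \<xi> (fst p) * \<xi> (snd p) * \<xi> n ^ (n - fst p - snd p - 1))"
  have "d_hyp_poly n (\<lambda>i. t * \<xi> i) (\<lambda>i. v i t) = (\<Sum>p\<in>idx_pairs n. A p * t ^ d p * v (fst p) t + B p * t ^ d p * v n t)" for t
    unfolding d_hyp_poly_def split_beta
  proof (rule sum.cong[OF refl])
    fix p
    show "2 * v (fst p) t * (t * \<xi> (snd p)) * (t * \<xi> n) ^ (n - fst p - snd p) +
        real (n - fst p - snd p) * (t * \<xi> (fst p)) * (t * \<xi> (snd p)) * (t * \<xi> n) ^ (n - fst p - snd p - 1) * v n t =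
        A p * t ^ d p * v (fst p) t + B p * t ^ d p * v n t"
      unfolding A_def B_def d_def
      by (cases "n - fst p - snd p") (simp_all add: power_mult_distrib algebra_simps)
  qed
  moreover have "jet N (\<lambda>t. \<Sum>p\<in>idx_pairs n. A p * t ^ d p * v (fst p) t + B p * t ^ d p * v n t)
    (\<lambda>i. \<Sum>p\<in>idx_pairs n. (if d p \<le> i then A p * a (fst p) (i - d p) else 0) + (if d p \<le> i then B p * a n (i - d p) else 0))"
    by (intro jet_sum jet_add jet_monom_mult v) (auto simp: idx_pairs_def)
  ultimately have "jet N (\<lambda>t. d_hyp_poly n (\<lambda>i. t * \<xi> i) (\<lambda>i. v i t))
    (\<lambda>i. \<Sum>p\<in>idx_pairs n. (if d p \<le> i then A p * a (fst p) (i - d p) else 0) + (if d p \<le> i then B p * a n (i - d p) else 0))"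
    by simp
  then show ?thesis
    by (rule jet_cong) (auto simp: A_def B_def d_def split_beta intro!: sum.cong)
qed

text \<open>Because of the shift by \<open>Suc (n - j - k)\<close>, the coefficients up to the third
  see only pairs with \<open>j + k\<close> equal to \<open>n\<close>, \<open>n - 1\<close> or
  \<open>n - 2\<close>.\<close>

lemma d_hyp_poly_coeff:
  fixes \<phi> :: "nat \<Rightarrow> nat \<Rightarrow> nat \<Rightarrow> real"
  assumes "n > 4"
  shows "(\<Sum>(j, k)\<in>idx_pairs n. if Suc (n - j - k) \<le> 0 then \<phi> j k 0 else 0) = 0"
    "(\<Sum>(j, k)\<in>idx_pairs n. if Suc (n - j - k) \<le> 1 then \<phi> j k (1 - Suc (n - j - k)) else 0) = conv_sum n (\<lambda>j k. \<phi> j k 0)"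
    "(\<Sum>(j, k)\<in>idx_pairs n. if Suc (n - j - k) \<le> 2 then \<phi> j k (2 - Suc (n - j - k)) else 0)
      = conv_sum n (\<lambda>j k. \<phi> j k 1) + conv_sum (n - 1) (\<lambda>j k. \<phi> j k 0)"
    "(\<Sum>(j, k)\<in>idx_pairs n. if Suc (n - j - k) \<le> 3 then \<phi> j k (3 - Suc (n - j - k)) else 0)
      = conv_sum n (\<lambda>j k. \<phi> j k 2) + conv_sum (n - 1) (\<lambda>j k. \<phi> j k 1) + conv_sum (n - 2) (\<lambda>j k. \<phi> j k 0)"
proof -
  have conv_sum: "conv_sum n g = (\<Sum>(j, k)\<in>idx_pairs n. if n - j - k = 0 then g j k else 0)"
    "conv_sum (n - 1) g = (\<Sum>(j, k)\<in>idx_pairs n. if n - j - k = 1 then g j k else 0)"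
    "conv_sum (n - 2) g = (\<Sum>(j, k)\<in>idx_pairs n. if n - j - k = 2 then g j k else 0)" for g
    using sum_idx_pairs_eq_conv_sum[of 0 n g] sum_idx_pairs_eq_conv_sum[of 1 n g] sum_idx_pairs_eq_conv_sum[of 2 n g] assms by auto
  show "(\<Sum>(j, k)\<in>idx_pairs n. if Suc (n - j - k) \<le> 0 then \<phi> j k 0 else 0) = 0" by simp
  show "(\<Sum>(j, k)\<in>idx_pairs n. if Suc (n - j - k) \<le> 1 then \<phi> j k (1 - Suc (n - j - k)) else 0) = conv_sum n (\<lambda>j k. \<phi> j k 0)"
    unfolding conv_sum by (intro sum.cong) auto
  show "(\<Sum>(j, k)\<in>idx_pairs n. if Suc (n - j - k) \<le> 2 then \<phi> j k (2 - Suc (n - j - k)) else 0)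
      = conv_sum n (\<lambda>j k. \<phi> j k 1) + conv_sum (n - 1) (\<lambda>j k. \<phi> j k 0)"
    unfolding conv_sum sum.distrib[symmetric] by (intro sum.cong) (auto simp: numeral_2_eq_2)
  show "(\<Sum>(j, k)\<in>idx_pairs n. if Suc (n - j - k) \<le> 3 then \<phi> j k (3 - Suc (n - j - k)) else 0)
      = conv_sum n (\<lambda>j k. \<phi> j k 2) + conv_sum (n - 1) (\<lambda>j k. \<phi> j k 1) + conv_sum (n - 2) (\<lambda>j k. \<phi> j k 0)"
    unfolding conv_sum sum.distrib[symmetric]
  proof (rule sum.cong[OF refl])
    fix p :: "nat \<times> nat"
    obtain j k where p: "p = (j, k)" by (cases p)
    have "n - j - k = 0 \<or> n - j - k = 1 \<or> n - j - k = 2 \<or> n - j - k > 2" by linarith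
    then show "(case p of (j, k) \<Rightarrow> if Suc (n - j - k) \<le> 3 then \<phi> j k (3 - Suc (n - j - k)) else 0) =
      (case p of (j, k) \<Rightarrow> if n - j - k = 0 then \<phi> j k 2 else 0) +
      (case p of (j, k) \<Rightarrow> if n - j - k = 1 then \<phi> j k 1 else 0) +
      (case p of (j, k) \<Rightarrow> if n - j - k = 2 then \<phi> j k 0 else 0)"
      unfolding p by (elim disjE) (auto simp: numeral_2_eq_2 numeral_3_eq_3)
  qed
qed

section \<open>Taylor coefficients along curves through imaginary points\<close>

context indexed
begin

abbreviation DD :: "nat \<Rightarrow> (complex ^ 'm \<Rightarrow> complex) \<Rightarrow> complex ^ 'm \<Rightarrow> complex" where
  "DD k \<equiv> pd (c k)"

text \<open>Only real parts move, linearly in \<open>z_1, ..., z_n\<close>. The function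
  \<open>F\<close> will be \<open>graph_fn f \<xi>\<close>, which keeps the curve in the
  hypersurface.\<close>

definition curve :: "complex ^ 'm \<Rightarrow> (nat \<Rightarrow> real) \<Rightarrow> (real \<Rightarrow> real) \<Rightarrow> real \<Rightarrow> complex ^ 'm" where
  "curve p \<xi> F t = p + (\<Sum>k\<in>{1..n}. axis (c k) (of_real (t * \<xi> k))) + axis (c 0) (of_real (F t))"

lemma sum_if_c:
  assumes "i \<le> n"
  shows "(\<Sum>k\<in>{Suc 0..n}. if c i = c k then g k else 0) = (if i = 0 then 0 else (g i :: complex))"
proof -
  have "(\<Sum>k\<in>{Suc 0..n}. if c i = c k then g k else 0) = (\<Sum>k\<in>{Suc 0..n}. if i = k then g k else 0)"
    by (rule sum.cong) (use assms in \<open>auto simp: c_eq_iff\<close>)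
  then show ?thesis using assms by (auto simp: sum.delta)
qed

lemma curve_nth:
  "curve p \<xi> F t $ c 0 = p $ c 0 + of_real (F t)"
  "i \<in> {1..n} \<Longrightarrow> curve p \<xi> F t $ c i = p $ c i + of_real (t * \<xi> i)"
  unfolding curve_def
  by (simp_all add: axis_def c_eq_iff sum_if_c)

lemma has_vector_derivative_curve:
  assumes "(F has_real_derivative F') (at t)"
  shows "(curve p \<xi> F has_vector_derivative ((\<Sum>k\<in>{1..n}. axis (c k) (of_real (\<xi> k))) + axis (c 0) (of_real F'))) (at t)"
proof -
  have ax: "((\<lambda>t. axis k (complex_of_real (g t)) :: complex ^ 'm) has_vector_derivative axis k (of_real g')) (at t)"
    if "(g has_real_derivative g') (at t)" for k g g'
    using bounded_linear.has_vector_derivative[OF bounded_linear_compose[OF bounded_linear_axis bounded_linear_of_real]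
        that[unfolded has_real_derivative_iff_has_vector_derivative]] .
  have "((\<lambda>t. p + (\<Sum>k\<in>{1..n}. axis (c k) (of_real (t * \<xi> k))) + axis (c 0) (of_real (F t))) has_vector_derivative
     (0 + (\<Sum>k\<in>{1..n}. axis (c k) (of_real (1 * \<xi> k))) + axis (c 0) (of_real F'))) (at t)"
    by (intro has_vector_derivative_add has_vector_derivative_sum has_vector_derivative_const ax assms
        DERIV_cmult_right DERIV_ident)
  then show ?thesis unfolding curve_def by simp
qed

lemma Re_curve_deriv:
  assumes "chol G U" "curve p \<xi> F t \<in> U" "(F has_real_derivative F') (at t)"
  shows "((\<lambda>t. Re (G (curve p \<xi> F t))) has_real_derivative
    ((\<Sum>k\<in>{1..n}. \<xi> k * Re (DD k G (curve p \<xi> F t))) + F' * Re (DD 0 G (curve p \<xi> F t)))) (at t)"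
proof -
  define v :: "complex ^ 'm" where "v = (\<Sum>k\<in>{1..n}. axis (c k) (complex_of_real (\<xi> k))) + axis (c 0) (of_real F')"
  let ?D = "\<lambda>h. \<Sum>k\<in>UNIV. h $ k * pd k G (curve p \<xi> F t)"
  have "(G \<circ> curve p \<xi> F has_derivative (?D \<circ> (\<lambda>h. h *\<^sub>R v))) (at t)"
    by (rule diff_chain_at) (use has_vector_derivative_curve[OF assms(3)] chol_has_derivative[OF assms(1,2)]
       in \<open>simp_all add: has_vector_derivative_def v_def\<close>)
  from bounded_linear.has_derivative[OF bounded_linear_Re this]
  have D: "((\<lambda>t. Re (G (curve p \<xi> F t))) has_derivative (\<lambda>h. Re (?D (h *\<^sub>R v)))) (at t)"
    by (simp add: o_def)
  have vk: "v $ c k = (if k = 0 then of_real F' else of_real (\<xi> k))" if "k \<le> n" for k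
    using that by (cases "k = 0") (simp_all add: v_def axis_def c_eq_iff sum_if_c)
  have "Re (?D (h *\<^sub>R v)) = h * ((\<Sum>k\<in>{1..n}. \<xi> k * Re (DD k G (curve p \<xi> F t))) + F' * Re (DD 0 G (curve p \<xi> F t)))" for h
  proof -
    have "{0..n} = insert 0 {1..n}" by auto
    then have "?D (h *\<^sub>R v) = (h *\<^sub>R v) $ c 0 * DD 0 G (curve p \<xi> F t) + (\<Sum>k\<in>{1..n}. (h *\<^sub>R v) $ c k * DD k G (curve p \<xi> F t))"
      unfolding sum_c by simp
    also have "\<dots> = h *\<^sub>R (of_real F' * DD 0 G (curve p \<xi> F t)) + (\<Sum>k\<in>{1..n}. h *\<^sub>R (of_real (\<xi> k) * DD k G (curve p \<xi> F t)))"
      unfolding vector_scaleR_component using vk by (intro arg_cong2[where f = "(+)"] sum.cong) auto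
    finally show ?thesis by (simp add: sum_distrib_left algebra_simps)
  qed
  with D show ?thesis
    by (intro has_derivative_imp_has_field_derivative) (auto simp: mult.commute)
qed

text \<open>The derivative of \<open>Re G\<close> along the curve combines the restrictions of the
  partial derivatives of \<open>G\<close>, which are holomorphic again. By \<open>jet_deriv\<close>
  one more order is thus gained for all holomorphic functions at once.\<close>

lemma jet_Re_curve_Suc:
  assumes "chol G U" "open U" "curve p \<xi> F 0 \<in> U"
    and F: "\<And>t. (F has_real_derivative F' t) (at t)" "jet N F' \<phi>"
    and a: "\<And>G. chol G U \<Longrightarrow> jet N (\<lambda>t. Re (G (curve p \<xi> F t))) (a G)"
  shows "jet (Suc N) (\<lambda>t. Re (G (curve p \<xi> F t))) (\<lambda>i. case i of 0 \<Rightarrow> Re (G (curve p \<xi> F 0))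
    | Suc j \<Rightarrow> ((\<Sum>k\<in>{1..n}. \<xi> k * a (DD k G) j) + (\<Sum>l\<le>j. \<phi> l * a (DD 0 G) (j - l))) / real (Suc j))"
proof (rule jet_deriv)
  have "isCont (curve p \<xi> F) t" for t
    using has_vector_derivative_continuous[OF has_vector_derivative_curve[OF F(1)[of t]]] .
  then have "continuous_on UNIV (curve p \<xi> F)" by (simp add: continuous_on_eq_continuous_at)
  from eventually_nhds_in_open[OF open_vimage[OF assms(2) this], of 0]
  have "\<forall>\<^sub>F t in nhds 0. curve p \<xi> F t \<in> U" using assms(3) by simp
  then show "\<forall>\<^sub>F t in nhds 0. ((\<lambda>t. Re (G (curve p \<xi> F t))) has_real_derivative
    ((\<Sum>k\<in>{1..n}. \<xi> k * Re (DD k G (curve p \<xi> F t))) + F' t * Re (DD 0 G (curve p \<xi> F t)))) (at t)"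
    by eventually_elim (rule Re_curve_deriv[OF assms(1) _ F(1)])
  show "jet N (\<lambda>t. (\<Sum>k\<in>{1..n}. \<xi> k * Re (DD k G (curve p \<xi> F t))) + F' t * Re (DD 0 G (curve p \<xi> F t)))
    (\<lambda>j. (\<Sum>k\<in>{1..n}. \<xi> k * a (DD k G) j) + (\<Sum>l\<le>j. \<phi> l * a (DD 0 G) (j - l)))"
    using assms(1,2) by (intro jet_add jet_sum jet_cmult jet_mult F(2) a chol_pd)
qed

text \<open>The Taylor coefficients of \<open>Re G\<close> along a curve whose last argument is
  \<open>F t = F2 t\<^sup>2 + F3 t\<^sup>3 + o(t\<^sup>3)\<close>.\<close>

definition curve_coeff :: "complex ^ 'm \<Rightarrow> (nat \<Rightarrow> real) \<Rightarrow> real \<Rightarrow> real \<Rightarrow> (complex ^ 'm \<Rightarrow> complex) \<Rightarrow> nat \<Rightarrow> real" where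
  "curve_coeff p \<xi> F2 F3 G i =
    (if i = 0 then Re (G p)
     else if i = 1 then (\<Sum>k\<in>{1..n}. \<xi> k * Re (DD k G p))
     else if i = 2 then (\<Sum>k\<in>{1..n}. \<xi> k * (\<Sum>l\<in>{1..n}. \<xi> l * Re (DD l (DD k G) p))) / 2 + F2 * Re (DD 0 G p)
     else (\<Sum>k\<in>{1..n}. \<xi> k * (\<Sum>l\<in>{1..n}. \<xi> l * (\<Sum>m\<in>{1..n}. \<xi> m * Re (DD m (DD l (DD k G)) p)))) / 6
       + F2 * (\<Sum>k\<in>{1..n}. \<xi> k * Re (DD k (DD 0 G) p)) + F3 * Re (DD 0 G p))"

lemma jet_Re_curve:
  assumes "chol G U" "open U" "p \<in> U" "F 0 = 0"
    and F: "\<And>t. (F has_real_derivative F' t) (at t)"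
      "jet 2 F' (\<lambda>i. if i = 0 then 0 else if i = 1 then 2 * F2 else 3 * F3)"
  shows "jet 3 (\<lambda>t. Re (G (curve p \<xi> F t))) (curve_coeff p \<xi> F2 F3 G)"
proof -
  let ?\<phi> = "\<lambda>i. if i = 0 then 0 else if i = 1 then 2 * F2 else 3 * F3 :: real"
  have c0: "curve p \<xi> F 0 = p" using assms(4) by (simp add: curve_def)
  note S = jet_Re_curve_Suc[where \<xi> = \<xi> and F = F and p = p and U = U and F' = F', unfolded c0, OF _ assms(2,3) F(1)]
  have J: "jet N F' ?\<phi>" if "N \<le> 2" for N using jet_mono[OF F(2) that] .
  have j0: "jet 0 (\<lambda>t. Re (G (curve p \<xi> F t))) (curve_coeff p \<xi> F2 F3 G)" if "chol G U" for G
  proof -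
    have "isCont (\<lambda>t. Re (G (curve p \<xi> F t))) 0"
      using DERIV_isCont[OF Re_curve_deriv[OF that _ F(1)[of 0]]] c0 assms(3) by simp
    from jet_0[OF this] show ?thesis by (rule jet_cong) (simp add: c0 curve_coeff_def)
  qed
  have j1: "jet (Suc 0) (\<lambda>t. Re (G (curve p \<xi> F t))) (curve_coeff p \<xi> F2 F3 G)" if "chol G U" for G
    by (rule jet_cong[OF S[OF that J j0]]) (auto simp: curve_coeff_def split: nat.split)
  have j2: "jet (Suc (Suc 0)) (\<lambda>t. Re (G (curve p \<xi> F t))) (curve_coeff p \<xi> F2 F3 G)" if "chol G U" for G
  proof (rule jet_cong[OF S[OF that J j1]])
    fix i :: nat assume "i \<le> Suc (Suc 0)"
    then consider "i = 0" | "i = 1" | "i = 2" by linarith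
    then show "(case i of 0 \<Rightarrow> Re (G p) | Suc j \<Rightarrow> ((\<Sum>k\<in>{1..n}. \<xi> k * curve_coeff p \<xi> F2 F3 (DD k G) j)
       + (\<Sum>l\<le>j. ?\<phi> l * curve_coeff p \<xi> F2 F3 (DD 0 G) (j - l))) / real (Suc j)) = curve_coeff p \<xi> F2 F3 G i"
      by cases (simp_all add: curve_coeff_def numeral_2_eq_2)
  qed simp
  have "jet (Suc (Suc (Suc 0))) (\<lambda>t. Re (G (curve p \<xi> F t))) (curve_coeff p \<xi> F2 F3 G)" if G: "chol G U" for G
  proof (rule jet_cong[OF S[OF that J j2]])
    fix i :: nat assume "i \<le> Suc (Suc (Suc 0))"
    then consider "i = 0" | "i = 1" | "i = 2" | "i = 3" by linarith
    then show "(case i of 0 \<Rightarrow> Re (G p) | Suc j \<Rightarrow> ((\<Sum>k\<in>{1..n}. \<xi> k * curve_coeff p \<xi> F2 F3 (DD k G) j)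
       + (\<Sum>l\<le>j. ?\<phi> l * curve_coeff p \<xi> F2 F3 (DD 0 G) (j - l))) / real (Suc j)) = curve_coeff p \<xi> F2 F3 G i"
    proof cases
      case 4
      \<comment> \<open>The mixed term with \<open>F2\<close> occurs once in the second coefficients
        of the \<open>DD k G\<close> and twice through the term \<open>2 * F2 * t\<close> of
        \<open>F'\<close>; the total factor 3 cancels against the division by 3.\<close>
      have com: "DD 0 (DD k G) p = DD k (DD 0 G) p" for k by (rule pd_commute[OF G assms(2,3)])
      define I where "I = (\<lambda>k. \<Sum>l\<in>{1..n}. \<xi> l * (\<Sum>m\<in>{1..n}. \<xi> m * Re (DD m (DD l (DD k G)) p)))"
      have "curve_coeff p \<xi> F2 F3 (DD k G) 2 = I k / 2 + F2 * Re (DD k (DD 0 G) p)" for k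
        unfolding curve_coeff_def I_def com by simp
      then have "(\<Sum>k\<in>{1..n}. \<xi> k * curve_coeff p \<xi> F2 F3 (DD k G) 2)
        = (\<Sum>k\<in>{1..n}. \<xi> k * I k) / 2 + F2 * (\<Sum>k\<in>{1..n}. \<xi> k * Re (DD k (DD 0 G) p))"
        by (simp add: distrib_left sum.distrib sum_distrib_left sum_divide_distrib mult.left_commute)
      moreover have "(\<Sum>l\<le>2. ?\<phi> l * curve_coeff p \<xi> F2 F3 (DD 0 G) (2 - l))
        = 2 * F2 * (\<Sum>k\<in>{1..n}. \<xi> k * Re (DD k (DD 0 G) p)) + 3 * F3 * Re (DD 0 G p)"
        by (simp add: curve_coeff_def numeral_2_eq_2)
      moreover have "curve_coeff p \<xi> F2 F3 G 3 = (\<Sum>k\<in>{1..n}. \<xi> k * I k) / 6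
        + F2 * (\<Sum>k\<in>{1..n}. \<xi> k * Re (DD k (DD 0 G) p)) + F3 * Re (DD 0 G p)"
        unfolding curve_coeff_def I_def by simp
      ultimately show ?thesis
        unfolding 4 by (simp add: numeral_3_eq_3 numeral_2_eq_2)
    next
      case 3
      have "curve_coeff p \<xi> F2 F3 (DD k G) 1 = (\<Sum>l\<in>{1..n}. \<xi> l * Re (DD l (DD k G) p))" for k
        unfolding curve_coeff_def by simp
      then show ?thesis
        unfolding 3 by (simp add: numeral_2_eq_2 curve_coeff_def)
    qed (simp_all add: curve_coeff_def)
  qed simp
  from this[OF assms(1)] show ?thesis by (simp add: numeral_3_eq_3)
qed

end

lemma conv_sum_cmult: "c * conv_sum s g = conv_sum s (\<lambda>j k. c * g j k)"
  unfolding conv_sum_def by (simp add: sum_distrib_left split_beta)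

lemma conv_sum_cong: "(\<And>j k. 0 < j \<Longrightarrow> 0 < k \<Longrightarrow> j + k = s \<Longrightarrow> g j k = h j k) \<Longrightarrow> conv_sum s g = conv_sum s h"
  unfolding conv_sum_def by (intro sum.cong) auto

section \<open>The tangency equation up to third order\<close>

context indexed
begin

definition graph_fn :: "(real \<Rightarrow> real) \<Rightarrow> (nat \<Rightarrow> real) \<Rightarrow> real \<Rightarrow> real" where
  "graph_fn f \<xi> t = f (t * \<xi> 1) + hyp_poly n (\<lambda>i. t * \<xi> i)"

lemma graph_fn_deriv:
  assumes "smooth f"
  shows "(graph_fn f \<xi> has_real_derivative (\<xi> 1 * deriv f (\<xi> 1 * t) + d_hyp_poly n (\<lambda>i. t * \<xi> i) \<xi>)) (at t)"
proof -
  have m: "((\<lambda>t. t * \<xi> i) has_real_derivative \<xi> i) (at t)" for i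
    using DERIV_cmult_right[OF DERIV_ident, of "\<xi> i"] by simp
  have "((\<lambda>t. f (t * \<xi> 1)) has_real_derivative deriv f (t * \<xi> 1) * \<xi> 1) (at t)"
    by (rule DERIV_chain2[OF smooth_deriv[OF assms] m])
  from DERIV_add[OF this hyp_poly_has_derivative[of n "\<lambda>t i. t * \<xi> i" \<xi> t, OF m]]
  show ?thesis unfolding graph_fn_def[abs_def] by (simp add: mult.commute)
qed

lemma graph_fn_0: "f 0 = 0 \<Longrightarrow> graph_fn f \<xi> 0 = 0"
proof -
  have "hyp_poly n (\<lambda>i. 0 * \<xi> i) = 0" unfolding hyp_poly_def by (rule sum.neutral) auto
  then show "f 0 = 0 \<Longrightarrow> graph_fn f \<xi> 0 = 0" by (simp add: graph_fn_def)
qed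

lemma rc_curve:
  assumes "p \<in> ipts r"
  shows "rc (curve p \<xi> F t) 0 = F t" "i \<in> {1..n} \<Longrightarrow> rc (curve p \<xi> F t) i = t * \<xi> i"
  using assms unfolding ipts_def rc_def by (simp_all add: curve_nth)

lemma hyp_poly_cong: "(\<And>i. i \<in> {1..n} \<Longrightarrow> x i = y i) \<Longrightarrow> hyp_poly n x = hyp_poly n y"
  unfolding hyp_poly_def by (rule sum.cong) (auto simp: idx_pairs_def)

lemma d_hyp_poly_cong:
  "(\<And>i. i \<in> {1..n} \<Longrightarrow> x i = y i) \<Longrightarrow> (\<And>i. i \<in> {1..n} \<Longrightarrow> v i = w i) \<Longrightarrow> d_hyp_poly n x v = d_hyp_poly n y w"
  unfolding d_hyp_poly_def by (rule sum.cong) (auto simp: idx_pairs_def)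

lemma curve_in_M_hyp:
  assumes "p \<in> ipts r"
  shows "curve p \<xi> (graph_fn f \<xi>) t \<in> M_hyp n c f"
proof -
  have "hyp_poly n (rc (curve p \<xi> (graph_fn f \<xi>) t)) = hyp_poly n (\<lambda>i. t * \<xi> i)"
    by (rule hyp_poly_cong) (rule rc_curve(2)[OF assms])
  then show ?thesis
    using n4 by (simp add: mem_M_hyp rc_curve[OF assms]) (simp add: graph_fn_def)
qed

lemma eventually_curve:
  assumes "smooth f" "f 0 = 0" "p \<in> ball 0 r"
  shows "\<forall>\<^sub>F t in nhds 0. curve p \<xi> (graph_fn f \<xi>) t \<in> ball 0 r"
proof -
  have "isCont (curve p \<xi> (graph_fn f \<xi>)) t" for t
    using has_vector_derivative_continuous[OF has_vector_derivative_curve[OF graph_fn_deriv[OF assms(1)]]] .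
  then have "continuous_on UNIV (curve p \<xi> (graph_fn f \<xi>))" by (simp add: continuous_on_eq_continuous_at)
  from eventually_nhds_in_open[OF open_vimage[OF open_ball[of 0 r] this], of 0]
  show ?thesis using assms(3) by (simp add: curve_def graph_fn_0[of f, OF assms(2)])
qed

text \<open>In the radial direction \<open>d_hyp_poly\<close> multiplies a homogeneous part by its
  degree (Euler's relation), hence the factors 2 and 3. The normalization of \<open>f\<close> leaves
  only its third derivative at this order.\<close>

lemma jet_graph_fn_deriv:
  assumes "smooth f" "deriv f 0 = 0" "(deriv ^^ 2) f 0 = 0"
  shows "jet 2 (\<lambda>t. \<xi> 1 * deriv f (\<xi> 1 * t) + d_hyp_poly n (\<lambda>i. t * \<xi> i) \<xi>)
    (\<lambda>i. if i = 0 then 0 else if i = 1 then 2 * conv_sum n (\<lambda>j k. \<xi> j * \<xi> k)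
      else 3 * (\<xi> n * conv_sum (n - 1) (\<lambda>j k. \<xi> j * \<xi> k) + (deriv ^^ 3) f 0 / 6 * \<xi> 1 ^ 3))"
proof -
  let ?a = "\<lambda>j (i :: nat). if i = 0 then \<xi> j else 0"
  define \<phi> where "\<phi> = (\<lambda>j k i. 2 * \<xi> k * \<xi> n ^ (n - j - k) * ?a j i + real (n - j - k) * \<xi> j * \<xi> k * \<xi> n ^ (n - j - k - 1) * ?a n i)"
  have "jet 2 (\<lambda>t. \<xi> 1 * deriv f (\<xi> 1 * t)) (\<lambda>i. \<xi> 1 * ((deriv ^^ (1 + i)) f 0 / fact i * \<xi> 1 ^ i))"
    using jet_cmult[OF jet_scale[OF jet_smooth[OF assms(1), of 2 1]]] by simp
  moreover have "jet 2 (\<lambda>t. d_hyp_poly n (\<lambda>i. t * \<xi> i) \<xi>)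
    (\<lambda>i. \<Sum>(j, k)\<in>idx_pairs n. if Suc (n - j - k) \<le> i then \<phi> j k (i - Suc (n - j - k)) else 0)"
    unfolding \<phi>_def by (rule jet_d_hyp_poly) (rule jet_const)
  ultimately have "jet 2 (\<lambda>t. \<xi> 1 * deriv f (\<xi> 1 * t) + d_hyp_poly n (\<lambda>i. t * \<xi> i) \<xi>)
    (\<lambda>i. \<xi> 1 * ((deriv ^^ (1 + i)) f 0 / fact i * \<xi> 1 ^ i)
      + (\<Sum>(j, k)\<in>idx_pairs n. if Suc (n - j - k) \<le> i then \<phi> j k (i - Suc (n - j - k)) else 0))"
    by (rule jet_add)
  then show ?thesis
  proof (rule jet_cong)
    fix i :: nat assume "i \<le> 2"
    then consider "i = 0" | "i = 1" | "i = 2" by linarith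
    then show "\<xi> 1 * ((deriv ^^ (1 + i)) f 0 / fact i * \<xi> 1 ^ i)
      + (\<Sum>(j, k)\<in>idx_pairs n. if Suc (n - j - k) \<le> i then \<phi> j k (i - Suc (n - j - k)) else 0)
      = (if i = 0 then 0 else if i = 1 then 2 * conv_sum n (\<lambda>j k. \<xi> j * \<xi> k)
      else 3 * (\<xi> n * conv_sum (n - 1) (\<lambda>j k. \<xi> j * \<xi> k) + (deriv ^^ 3) f 0 / 6 * \<xi> 1 ^ 3))"
    proof cases
      case 1
      then show ?thesis using assms(2) by simp
    next
      case 2
      have "(deriv ^^ (1 + 1)) f 0 = 0" using assms(3) by (simp add: numeral_2_eq_2)
      moreover have "conv_sum n (\<lambda>j k. \<phi> j k 0) = 2 * conv_sum n (\<lambda>j k. \<xi> j * \<xi> k)"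
        unfolding conv_sum_cmult by (rule conv_sum_cong) (simp add: \<phi>_def)
      ultimately show ?thesis unfolding 2 d_hyp_poly_coeff[OF n4] by simp
    next
      case 3
      have "conv_sum n (\<lambda>j k. \<phi> j k 1) = 0 * conv_sum n (\<lambda>j k. \<xi> j * \<xi> k)"
        unfolding conv_sum_cmult by (rule conv_sum_cong) (simp add: \<phi>_def)
      moreover have "conv_sum (n - 1) (\<lambda>j k. \<phi> j k 0) = (3 * \<xi> n) * conv_sum (n - 1) (\<lambda>j k. \<xi> j * \<xi> k)"
        unfolding conv_sum_cmult
      proof (rule conv_sum_cong)
        fix j k assume "0 < j" "0 < k" "j + k = n - 1"
        then have "n - j - k = 1" using n4 by linarith
        then show "\<phi> j k 0 = 3 * \<xi> n * (\<xi> j * \<xi> k)" by (simp add: \<phi>_def)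
      qed
      moreover have "(deriv ^^ (1 + 2)) f 0 = (deriv ^^ 3) f 0" by (simp add: numeral_3_eq_3)
      ultimately show ?thesis unfolding 3 d_hyp_poly_coeff[OF n4]
        by (simp add: power3_eq_cube power2_eq_square)
    qed
  qed
qed

text \<open>The coefficients of \<open>t\<close>, \<open>t^2\<close> and \<open>t^3\<close> of the
  tangency equation along the curves issuing from \<open>p\<close>. As \<open>\<xi>\<close> is
  arbitrary, each is an identity between polynomials in \<open>\<xi>\<close>; the point
  \<open>p\<close> enters only through \<open>X\<close> and its derivatives.\<close>

lemma tangency_equations:
  assumes f: "smooth f" "f 0 = 0" "deriv f 0 = 0" "(deriv ^^ 2) f 0 = 0"
    and X: "\<And>i. chol (\<lambda>z. X z $ i) (ball 0 r)" "tang f X (ball 0 r)" and p: "p \<in> ipts r"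
  defines "a \<equiv> \<lambda>j k. Re (DD k (\<lambda>z. X z $ c j) p)" and "u \<equiv> \<lambda>j. Re (X p $ c j)"
    and "b \<equiv> \<lambda>j k l. Re (DD l (DD k (\<lambda>z. X z $ c j)) p)"
    and "d \<equiv> \<lambda>j k l m. Re (DD m (DD l (DD k (\<lambda>z. X z $ c j))) p)"
  shows "(\<Sum>k\<in>{1..n}. \<xi> k * a 0 k) = conv_sum n (\<lambda>j k. 2 * \<xi> k * u j)"
    and "(\<Sum>k\<in>{1..n}. \<xi> k * (\<Sum>l\<in>{1..n}. \<xi> l * b 0 k l)) / 2 + conv_sum n (\<lambda>j k. \<xi> j * \<xi> k) * a 0 0
      = (deriv ^^ 3) f 0 / 2 * \<xi> 1 ^ 2 * u 1 + conv_sum n (\<lambda>j k. 2 * \<xi> k * (\<Sum>l\<in>{1..n}. \<xi> l * a j l))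
        + conv_sum (n - 1) (\<lambda>j k. 2 * \<xi> n * \<xi> k * u j + \<xi> j * \<xi> k * u n)"
    and "(\<Sum>k\<in>{1..n}. \<xi> k * (\<Sum>l\<in>{1..n}. \<xi> l * (\<Sum>m\<in>{1..n}. \<xi> m * d 0 k l m))) / 6
        + conv_sum n (\<lambda>j k. \<xi> j * \<xi> k) * (\<Sum>k\<in>{1..n}. \<xi> k * b 0 0 k)
        + (\<xi> n * conv_sum (n - 1) (\<lambda>j k. \<xi> j * \<xi> k) + (deriv ^^ 3) f 0 / 6 * \<xi> 1 ^ 3) * a 0 0
      = (deriv ^^ 3) f 0 / 2 * \<xi> 1 ^ 2 * (\<Sum>l\<in>{1..n}. \<xi> l * a 1 l) + (deriv ^^ 4) f 0 / 6 * \<xi> 1 ^ 3 * u 1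
        + conv_sum n (\<lambda>j k. 2 * \<xi> k * ((\<Sum>l\<in>{1..n}. \<xi> l * (\<Sum>m\<in>{1..n}. \<xi> m * b j l m)) / 2 + conv_sum n (\<lambda>j k. \<xi> j * \<xi> k) * a j 0))
        + conv_sum (n - 1) (\<lambda>j k. 2 * \<xi> n * \<xi> k * (\<Sum>l\<in>{1..n}. \<xi> l * a j l) + \<xi> j * \<xi> k * (\<Sum>l\<in>{1..n}. \<xi> l * a n l))
        + conv_sum (n - 2) (\<lambda>j k. 2 * \<xi> n ^ 2 * \<xi> k * u j + 2 * \<xi> n * \<xi> j * \<xi> k * u n)"
proof -
  define F2 where "F2 = conv_sum n (\<lambda>j k. \<xi> j * \<xi> k)"
  define F3 where "F3 = \<xi> n * conv_sum (n - 1) (\<lambda>j k. \<xi> j * \<xi> k) + (deriv ^^ 3) f 0 / 6 * \<xi> 1 ^ 3"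
  define \<gamma> where "\<gamma> = curve p \<xi> (graph_fn f \<xi>)"
  define J where "J = (\<lambda>j. curve_coeff p \<xi> F2 F3 (\<lambda>z. X z $ c j))"
  define \<phi> where "\<phi> = (\<lambda>j k i. 2 * \<xi> k * \<xi> n ^ (n - j - k) * J j i + real (n - j - k) * \<xi> j * \<xi> k * \<xi> n ^ (n - j - k - 1) * J n i)"
  have pb: "p \<in> ball 0 r" using p by (simp add: ipts_def)
  have J: "jet 3 (\<lambda>t. rc (X (\<gamma> t)) j) (J j)" for j
    unfolding J_def rc_def \<gamma>_def F2_def F3_def
    by (rule jet_Re_curve[OF X(1) open_ball pb graph_fn_0[of f, OF f(2)] graph_fn_deriv[OF f(1)] jet_graph_fn_deriv[OF f(1,3,4)]])
  have f': "jet 3 (\<lambda>t. deriv f (\<xi> 1 * t)) (\<lambda>i. (deriv ^^ (1 + i)) f 0 / fact i * \<xi> 1 ^ i)"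
    using jet_scale[OF jet_smooth[OF f(1), of 3 1]] by simp
  have "jet 3 (\<lambda>t. rc (X (\<gamma> t)) 0 + (-1) * (deriv f (\<xi> 1 * t) * rc (X (\<gamma> t)) 1 + d_hyp_poly n (\<lambda>i. t * \<xi> i) (\<lambda>i. rc (X (\<gamma> t)) i)))
    (\<lambda>i. J 0 i + (-1) * ((\<Sum>l\<le>i. ((deriv ^^ (1 + l)) f 0 / fact l * \<xi> 1 ^ l) * J 1 (i - l))
      + (\<Sum>(j, k)\<in>idx_pairs n. if Suc (n - j - k) \<le> i then \<phi> j k (i - Suc (n - j - k)) else 0)))"
    unfolding \<phi>_def by (intro jet_add jet_cmult jet_mult f' J jet_d_hyp_poly)
  moreover have "\<forall>\<^sub>F t in nhds 0. rc (X (\<gamma> t)) 0 + (-1) * (deriv f (\<xi> 1 * t) * rc (X (\<gamma> t)) 1 + d_hyp_poly n (\<lambda>i. t * \<xi> i) (\<lambda>i. rc (X (\<gamma> t)) i)) = 0"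
    using eventually_curve[OF f(1,2) pb, of \<xi>]
  proof eventually_elim
    case (elim t)
    have "rc (X (\<gamma> t)) 0 = deriv f (rc (\<gamma> t) 1) * rc (X (\<gamma> t)) 1 + d_hyp_poly n (rc (\<gamma> t)) (rc (X (\<gamma> t)))"
      using X(2) elim curve_in_M_hyp[OF p] unfolding tang_def \<gamma>_def by blast
    moreover have "rc (\<gamma> t) i = t * \<xi> i" if "i \<in> {1..n}" for i
      unfolding \<gamma>_def by (rule rc_curve(2)[OF p that])
    then have "d_hyp_poly n (rc (\<gamma> t)) (rc (X (\<gamma> t))) = d_hyp_poly n (\<lambda>i. t * \<xi> i) (\<lambda>i. rc (X (\<gamma> t)) i)" "rc (\<gamma> t) 1 = \<xi> 1 * t"
      using n4 by (auto intro: d_hyp_poly_cong)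
    ultimately show ?case by simp
  qed
  ultimately have Z: "J 0 i = (\<Sum>l\<le>i. ((deriv ^^ (1 + l)) f 0 / fact l * \<xi> 1 ^ l) * J 1 (i - l))
      + (\<Sum>(j, k)\<in>idx_pairs n. if Suc (n - j - k) \<le> i then \<phi> j k (i - Suc (n - j - k)) else 0)" if "i \<le> 3" for i
    using jet_zero[of 3 _ _ i] that by fastforce
  have J0: "J j 0 = u j" and J1: "J j 1 = (\<Sum>k\<in>{1..n}. \<xi> k * a j k)"
    and J2: "J j 2 = (\<Sum>k\<in>{1..n}. \<xi> k * (\<Sum>l\<in>{1..n}. \<xi> l * b j k l)) / 2 + F2 * a j 0"
    and J3: "J j 3 = (\<Sum>k\<in>{1..n}. \<xi> k * (\<Sum>l\<in>{1..n}. \<xi> l * (\<Sum>m\<in>{1..n}. \<xi> m * d j k l m))) / 6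
        + F2 * (\<Sum>k\<in>{1..n}. \<xi> k * b j 0 k) + F3 * a j 0" for j
    unfolding J_def curve_coeff_def a_def u_def b_def d_def by simp_all
  have f3: "(deriv ^^ (1 + 0)) f 0 = 0" "(deriv ^^ (1 + 1)) f 0 = 0" using f(3,4) by (simp_all add: numeral_2_eq_2)
  have k0: "j + k = n \<Longrightarrow> n - j - k = 0" and k1: "0 < j \<Longrightarrow> j + k = n - 1 \<Longrightarrow> n - j - k = 1"
    and k2: "0 < j \<Longrightarrow> j + k = n - 2 \<Longrightarrow> n - j - k = 2" for j k
    using n4 by linarith+
  have S0: "conv_sum n (\<lambda>j k. \<phi> j k i) = conv_sum n (\<lambda>j k. 2 * \<xi> k * J j i)" for i
    by (rule conv_sum_cong) (simp add: \<phi>_def k0)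
  have S1: "conv_sum (n - 1) (\<lambda>j k. \<phi> j k i) = conv_sum (n - 1) (\<lambda>j k. 2 * \<xi> n * \<xi> k * J j i + \<xi> j * \<xi> k * J n i)" for i
    by (rule conv_sum_cong) (simp add: \<phi>_def k1)
  have S2: "conv_sum (n - 2) (\<lambda>j k. \<phi> j k i) = conv_sum (n - 2) (\<lambda>j k. 2 * \<xi> n ^ 2 * \<xi> k * J j i + 2 * \<xi> n * \<xi> j * \<xi> k * J n i)" for i
    by (rule conv_sum_cong) (simp add: \<phi>_def k2 power2_eq_square)
  have "(\<Sum>l\<le>1. ((deriv ^^ (1 + l)) f 0 / fact l * \<xi> 1 ^ l) * J 1 (1 - l)) = 0"
    using f3 by simp
  with Z[of 1] show "(\<Sum>k\<in>{1..n}. \<xi> k * a 0 k) = conv_sum n (\<lambda>j k. 2 * \<xi> k * u j)"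
    unfolding d_hyp_poly_coeff[OF n4] S0 J0 J1 by simp
  have "(\<Sum>l\<le>2. ((deriv ^^ (1 + l)) f 0 / fact l * \<xi> 1 ^ l) * J 1 (2 - l)) = (deriv ^^ 3) f 0 / 2 * \<xi> 1 ^ 2 * J 1 0"
    using f3 by (simp add: numeral_2_eq_2 numeral_3_eq_3)
  with Z[of 2] show "(\<Sum>k\<in>{1..n}. \<xi> k * (\<Sum>l\<in>{1..n}. \<xi> l * b 0 k l)) / 2 + conv_sum n (\<lambda>j k. \<xi> j * \<xi> k) * a 0 0
      = (deriv ^^ 3) f 0 / 2 * \<xi> 1 ^ 2 * u 1 + conv_sum n (\<lambda>j k. 2 * \<xi> k * (\<Sum>l\<in>{1..n}. \<xi> l * a j l))
        + conv_sum (n - 1) (\<lambda>j k. 2 * \<xi> n * \<xi> k * u j + \<xi> j * \<xi> k * u n)"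
    unfolding d_hyp_poly_coeff[OF n4] S0 S1 J0 J1 J2 F2_def by simp
  have "(\<Sum>l\<le>3. ((deriv ^^ (1 + l)) f 0 / fact l * \<xi> 1 ^ l) * J 1 (3 - l))
      = (deriv ^^ 3) f 0 / 2 * \<xi> 1 ^ 2 * J 1 1 + (deriv ^^ 4) f 0 / 6 * \<xi> 1 ^ 3 * J 1 0"
    using f3 by (simp add: numeral_2_eq_2 numeral_3_eq_3 eval_nat_numeral fact_numeral)
  with Z[of 3] show "(\<Sum>k\<in>{1..n}. \<xi> k * (\<Sum>l\<in>{1..n}. \<xi> l * (\<Sum>m\<in>{1..n}. \<xi> m * d 0 k l m))) / 6
        + conv_sum n (\<lambda>j k. \<xi> j * \<xi> k) * (\<Sum>k\<in>{1..n}. \<xi> k * b 0 0 k)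
        + (\<xi> n * conv_sum (n - 1) (\<lambda>j k. \<xi> j * \<xi> k) + (deriv ^^ 3) f 0 / 6 * \<xi> 1 ^ 3) * a 0 0
      = (deriv ^^ 3) f 0 / 2 * \<xi> 1 ^ 2 * (\<Sum>l\<in>{1..n}. \<xi> l * a 1 l) + (deriv ^^ 4) f 0 / 6 * \<xi> 1 ^ 3 * u 1
        + conv_sum n (\<lambda>j k. 2 * \<xi> k * ((\<Sum>l\<in>{1..n}. \<xi> l * (\<Sum>m\<in>{1..n}. \<xi> m * b j l m)) / 2 + conv_sum n (\<lambda>j k. \<xi> j * \<xi> k) * a j 0))
        + conv_sum (n - 1) (\<lambda>j k. 2 * \<xi> n * \<xi> k * (\<Sum>l\<in>{1..n}. \<xi> l * a j l) + \<xi> j * \<xi> k * (\<Sum>l\<in>{1..n}. \<xi> l * a n l))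
        + conv_sum (n - 2) (\<lambda>j k. 2 * \<xi> n ^ 2 * \<xi> k * u j + 2 * \<xi> n * \<xi> j * \<xi> k * u n)"
    unfolding d_hyp_poly_coeff[OF n4] S0 S1 S2 J0 J1 J2 J3 F2_def F3_def by simp
qed

end

section \<open>Linear algebra of the Taylor coefficients\<close>

definition lin :: "nat \<Rightarrow> (nat \<Rightarrow> real) \<Rightarrow> (nat \<Rightarrow> real) \<Rightarrow> real" where
  "lin n \<alpha> \<xi> = (\<Sum>a\<in>{1..n}. \<alpha> a * \<xi> a)"

definition bil :: "nat \<Rightarrow> (nat \<Rightarrow> nat \<Rightarrow> real) \<Rightarrow> (nat \<Rightarrow> real) \<Rightarrow> (nat \<Rightarrow> real) \<Rightarrow> real" where
  "bil n q \<xi> \<eta> = (\<Sum>a\<in>{1..n}. \<Sum>b\<in>{1..n}. q a b * \<xi> a * \<eta> b)"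

definition tri :: "nat \<Rightarrow> (nat \<Rightarrow> nat \<Rightarrow> nat \<Rightarrow> real) \<Rightarrow> (nat \<Rightarrow> real) \<Rightarrow> (nat \<Rightarrow> real) \<Rightarrow> (nat \<Rightarrow> real) \<Rightarrow> real" where
  "tri n q \<xi> \<eta> \<zeta> = (\<Sum>a\<in>{1..n}. \<Sum>b\<in>{1..n}. \<Sum>c\<in>{1..n}. q a b c * \<xi> a * \<eta> b * \<zeta> c)"

definition uvec :: "nat \<Rightarrow> nat \<Rightarrow> real" where
  "uvec a = (\<lambda>i. if i = a then 1 else 0)"

lemma lin_un: "a \<in> {1..n} \<Longrightarrow> lin n \<alpha> (uvec a) = \<alpha> a"
  unfolding lin_def uvec_def by (simp add: if_distrib[of "\<lambda>x. _ * x"] cong: if_cong)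

lemma bil_un: "a \<in> {1..n} \<Longrightarrow> b \<in> {1..n} \<Longrightarrow> bil n q (uvec a) (uvec b) = q a b"
  unfolding bil_def uvec_def by (simp add: if_distrib[of "\<lambda>x. _ * x"] cong: if_cong)

lemma tri_un: "a \<in> {1..n} \<Longrightarrow> b \<in> {1..n} \<Longrightarrow> c \<in> {1..n} \<Longrightarrow> tri n q (uvec a) (uvec b) (uvec c) = q a b c"
  unfolding tri_def uvec_def by (simp add: if_distrib[of "\<lambda>x. _ * x"] cong: if_cong)

lemma bil_add:
  "bil n q (\<lambda>i. x i + y i) z = bil n q x z + bil n q y z"
  "bil n q z (\<lambda>i. x i + y i) = bil n q z x + bil n q z y"
  unfolding bil_def by (simp_all add: sum.distrib algebra_simps)

lemma tri_add:
  "tri n q (\<lambda>i. x i + y i) z w = tri n q x z w + tri n q y z w"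
  "tri n q z (\<lambda>i. x i + y i) w = tri n q z x w + tri n q z y w"
  "tri n q z w (\<lambda>i. x i + y i) = tri n q z w x + tri n q z w y"
  unfolding tri_def by (simp_all add: sum.distrib algebra_simps)

lemma lin_zero: "(\<And>\<xi>. lin n \<alpha> \<xi> = 0) \<Longrightarrow> a \<in> {1..n} \<Longrightarrow> \<alpha> a = 0"
  using lin_un by metis

lemma bil_zero:
  assumes "\<And>\<xi>. bil n q \<xi> \<xi> = 0" "a \<in> {1..n}" "b \<in> {1..n}"
  shows "q a b + q b a = 0"
  using assms(1)[of "\<lambda>i. uvec a i + uvec b i"] assms(1)[of "uvec a"] assms(1)[of "uvec b"]
  by (simp add: bil_add bil_un[OF assms(2,3)] bil_un[OF assms(3,2)])

text \<open>Polarization: evaluating at the sum of three unit vectors, at the sums of two and at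
  single ones isolates the multilinear part by inclusion and exclusion. Since \<open>q\<close> need
  not be symmetric, only its symmetrization vanishes.\<close>

lemma tri_zero:
  assumes "\<And>\<xi>. tri n q \<xi> \<xi> \<xi> = 0" "a \<in> {1..n}" "b \<in> {1..n}" "c \<in> {1..n}"
  shows "q a b c + q b c a + q c a b + q b a c + q a c b + q c b a = 0"
proof -
  note T = assms(1)[of "\<lambda>i. uvec a i + uvec b i + uvec c i"] assms(1)[of "\<lambda>i. uvec a i + uvec b i"]
    assms(1)[of "\<lambda>i. uvec b i + uvec c i"] assms(1)[of "\<lambda>i. uvec a i + uvec c i"]
    assms(1)[of "uvec a"] assms(1)[of "uvec b"] assms(1)[of "uvec c"]
  show ?thesis
    using T unfolding tri_add tri_un[OF assms(2,3,4), symmetric] tri_un[OF assms(3,4,2), symmetric]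
      tri_un[OF assms(4,2,3), symmetric] tri_un[OF assms(3,2,4), symmetric] tri_un[OF assms(2,4,3), symmetric]
      tri_un[OF assms(4,3,2), symmetric]
    by linarith
qed

lemma lin_mult_lin: "lin n \<alpha> \<xi> * lin n \<beta> \<xi> = bil n (\<lambda>a b. \<alpha> a * \<beta> b) \<xi> \<xi>"
  unfolding lin_def bil_def by (simp add: sum_product mult_ac)

lemma lin_mult_bil: "lin n \<alpha> \<xi> * bil n q \<xi> \<xi> = tri n (\<lambda>a b c. \<alpha> a * q b c) \<xi> \<xi> \<xi>"
  unfolding lin_def bil_def tri_def
  by (subst sum_distrib_right, simp only: sum_distrib_left, intro sum.cong refl) (simp add: mult_ac)

lemma lin_plus: "lin n \<alpha> \<xi> + lin n \<beta> \<xi> = lin n (\<lambda>a. \<alpha> a + \<beta> a) \<xi>"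
  unfolding lin_def by (simp add: sum.distrib algebra_simps)

lemma bil_plus: "bil n p \<xi> \<xi> + bil n q \<xi> \<xi> = bil n (\<lambda>a b. p a b + q a b) \<xi> \<xi>"
  unfolding bil_def by (simp add: sum.distrib algebra_simps)

lemma tri_plus: "tri n p \<xi> \<xi> \<xi> + tri n q \<xi> \<xi> \<xi> = tri n (\<lambda>a b c. p a b c + q a b c) \<xi> \<xi> \<xi>"
  unfolding tri_def by (simp add: sum.distrib algebra_simps)

lemma lin_cmult: "x * lin n \<alpha> \<xi> = lin n (\<lambda>a. x * \<alpha> a) \<xi>"
  unfolding lin_def by (simp add: sum_distrib_left mult_ac)

lemma bil_cmult: "x * bil n q \<xi> \<xi> = bil n (\<lambda>a b. x * q a b) \<xi> \<xi>"
  unfolding bil_def by (simp add: sum_distrib_left mult_ac)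

lemma tri_cmult: "x * tri n q \<xi> \<xi> \<xi> = tri n (\<lambda>a b c. x * q a b c) \<xi> \<xi> \<xi>"
  unfolding tri_def by (simp add: sum_distrib_left mult_ac)

lemma lin_nth: "a \<in> {1..n} \<Longrightarrow> \<xi> a = lin n (uvec a) \<xi>"
  unfolding lin_def uvec_def by (simp add: if_distrib[of "\<lambda>x. x * _"] cong: if_cong)

lemma conv_sum_eq_sum: "conv_sum s g = (\<Sum>k\<in>{1..<s}. g (s - k) k)"
  unfolding conv_sum_def
  by (rule sum.reindex_bij_witness[of _ "\<lambda>k. (s - k, k)" snd]) auto

text \<open>The coefficient of \<open>\<xi> k\<close> belongs to \<open>j = s - k\<close>; this
  reversal of indices is the source of the entries \<open>n - k\<close> in the systems
  below.\<close>

lemma conv_sum_lin: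
  assumes "s \<le> n + 1"
  shows "conv_sum s (\<lambda>j k. \<xi> k * g j) = lin n (\<lambda>k. if k < s then g (s - k) else 0) \<xi>"
proof -
  have "lin n (\<lambda>k. if k < s then g (s - k) else 0) \<xi> = (\<Sum>k\<in>{1..<s}. (if k < s then g (s - k) else 0) * \<xi> k)"
    unfolding lin_def by (rule sum.mono_neutral_right) (use assms in auto)
  also have "\<dots> = conv_sum s (\<lambda>j k. \<xi> k * g j)"
    unfolding conv_sum_eq_sum by (rule sum.cong) auto
  finally show ?thesis by simp
qed

lemma conv_sum_lin_bil:
  assumes "s \<le> n + 1"
  shows "conv_sum s (\<lambda>j k. \<xi> k * lin n (g j) \<xi>) = bil n (\<lambda>k l. if k < s then g (s - k) l else 0) \<xi> \<xi>"
  unfolding conv_sum_lin[OF assms, of \<xi> "\<lambda>j. lin n (g j) \<xi>"]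
  unfolding bil_def lin_def by (intro sum.cong) (auto simp: sum_distrib_left mult_ac)

lemma conv_sum_lin_tri:
  assumes "s \<le> n + 1"
  shows "conv_sum s (\<lambda>j k. \<xi> k * bil n (g j) \<xi> \<xi>) = tri n (\<lambda>k l m. if k < s then g (s - k) l m else 0) \<xi> \<xi> \<xi>"
  unfolding conv_sum_lin[OF assms, of \<xi> "\<lambda>j. bil n (g j) \<xi> \<xi>"]
  unfolding bil_def lin_def tri_def by (intro sum.cong) (auto simp: sum_distrib_left mult_ac)

lemma conv_sum_bil:
  assumes "s \<le> n"
  shows "conv_sum s (\<lambda>j k. \<xi> j * \<xi> k) = bil n (\<lambda>a b. if a + b = s then 1 else 0) \<xi> \<xi>"
proof -
  have "bil n (\<lambda>a b. if a + b = s then 1 else 0) \<xi> \<xi> = (\<Sum>b\<in>{1..n}. \<Sum>a\<in>{1..n}. (if a + b = s then 1 else 0) * \<xi> a * \<xi> b)"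
    unfolding bil_def by (rule sum.swap)
  also have "\<dots> = (\<Sum>b\<in>{1..<s}. \<Sum>a\<in>{1..n}. (if a + b = s then 1 else 0) * \<xi> a * \<xi> b)"
    by (rule sum.mono_neutral_right) (use assms in \<open>auto intro!: sum.neutral\<close>)
  also have "\<dots> = (\<Sum>b\<in>{1..<s}. \<xi> (s - b) * \<xi> b)"
  proof (rule sum.cong[OF refl])
    fix b assume b: "b \<in> {1..<s}"
    have "(\<Sum>a\<in>{1..n}. (if a + b = s then 1 else 0) * \<xi> a * \<xi> b) = (\<Sum>a\<in>{1..n}. if a = s - b then \<xi> a * \<xi> b else 0)"
      by (rule sum.cong) (use b in auto)
    then show "(\<Sum>a\<in>{1..n}. (if a + b = s then 1 else 0) * \<xi> a * \<xi> b) = \<xi> (s - b) * \<xi> b"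
      using b assms by (auto simp: sum.delta')
  qed
  finally show ?thesis unfolding conv_sum_eq_sum by simp
qed

text \<open>The second and third order parts of the tangency equation at a point, with \<open>a j k\<close> and
  \<open>B j k l\<close> the real parts of the first and second derivatives of the \<open>j\<close>-th component.\<close>

definition second_order :: "nat \<Rightarrow> real \<Rightarrow> (nat \<Rightarrow> real) \<Rightarrow> (nat \<Rightarrow> nat \<Rightarrow> real) \<Rightarrow> bool" where
  "second_order n f3 u a \<longleftrightarrow> (\<forall>\<xi>. conv_sum n (\<lambda>j k. \<xi> j * \<xi> k) * a 0 0
      = f3 * \<xi> 1 ^ 2 * u 1 + 2 * conv_sum n (\<lambda>j k. \<xi> k * lin n (a j) \<xi>)
        + (2 * \<xi> n * conv_sum (n - 1) (\<lambda>j k. \<xi> k * u j) + u n * conv_sum (n - 1) (\<lambda>j k. \<xi> j * \<xi> k)))"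

definition third_order :: "nat \<Rightarrow> real \<Rightarrow> real \<Rightarrow> (nat \<Rightarrow> real) \<Rightarrow> (nat \<Rightarrow> nat \<Rightarrow> real) \<Rightarrow> (nat \<Rightarrow> nat \<Rightarrow> nat \<Rightarrow> real) \<Rightarrow> bool" where
  "third_order n f3 f4 u a B \<longleftrightarrow> (\<forall>\<xi>. (\<xi> n * conv_sum (n - 1) (\<lambda>j k. \<xi> j * \<xi> k) + f3 / 3 * \<xi> 1 ^ 3) * a 0 0
      = 2 / 3 * conv_sum n (\<lambda>j k. \<xi> k * bil n (B j) \<xi> \<xi>) + f3 * \<xi> 1 ^ 2 * lin n (a 1) \<xi> + f4 * \<xi> 1 ^ 3 * u 1
        + 2 * conv_sum n (\<lambda>j k. \<xi> j * \<xi> k) * conv_sum n (\<lambda>j k. \<xi> k * a j 0)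
        + (2 * \<xi> n * conv_sum (n - 1) (\<lambda>j k. \<xi> k * lin n (a j) \<xi>) + conv_sum (n - 1) (\<lambda>j k. \<xi> j * \<xi> k) * lin n (a n) \<xi>)
        + (2 * \<xi> n ^ 2 * conv_sum (n - 2) (\<lambda>j k. \<xi> k * u j) + 2 * u n * \<xi> n * conv_sum (n - 2) (\<lambda>j k. \<xi> j * \<xi> k)))"

text \<open>The coefficients of \<open>\<xi> i * \<xi> k\<close> and of
  \<open>\<xi> k * \<xi> n\<close> for indices below \<open>n\<close>. The quadratic form on the
  left does not contain \<open>\<xi> n\<close>, so the second family determines the
  \<open>z_n\<close>-derivatives of the middle components outright.\<close>

lemma second_order_polar:
  assumes "n > 4" "second_order n f3 u a"
  shows "i \<in> {1..<n} \<Longrightarrow> k \<in> {1..<n} \<Longrightarrow>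
      a (n - i) k + a (n - k) i = (if i + k = n then a 0 0 else 0) - (if i + k = n - 1 then u n else 0)
        - (if i = 1 \<and> k = 1 then f3 * u 1 else 0)"
    and "k \<in> {1..<n} \<Longrightarrow> a (n - k) n = - (if k < n - 1 then u (n - 1 - k) else 0)"
proof -
  define q where "q = (\<lambda>i k. (if i + k = n then 1 else 0) * a 0 0 - f3 * u 1 * (uvec 1 i * uvec 1 k)
    - 2 * (if i < n then a (n - i) k else 0) - 2 * (uvec n i * (if k < n - 1 then u (n - 1 - k) else 0))
    - u n * (if i + k = n - 1 then 1 else 0))"
  have I: "1 \<in> {1..n}" "n \<in> {1..n}" using assms(1) by auto
  have "bil n q \<xi> \<xi> = 0" for \<xi>
  proof -
    note E = assms(2)[unfolded second_order_def, rule_format, of \<xi>]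
    have "bil n q \<xi> \<xi> = a 0 0 * bil n (\<lambda>a b. if a + b = n then 1 else 0) \<xi> \<xi> + (- (f3 * u 1)) * (lin n (uvec 1) \<xi> * lin n (uvec 1) \<xi>)
      + (-2) * bil n (\<lambda>i k. if i < n then a (n - i) k else 0) \<xi> \<xi>
      + (-2) * (lin n (uvec n) \<xi> * lin n (\<lambda>k. if k < n - 1 then u (n - 1 - k) else 0) \<xi>)
      + (- u n) * bil n (\<lambda>a b. if a + b = n - 1 then 1 else 0) \<xi> \<xi>"
      unfolding lin_mult_lin bil_cmult bil_plus q_def by (rule arg_cong[where f = "\<lambda>q. bil n q \<xi> \<xi>"]) (auto simp: fun_eq_iff)
    also have "\<dots> = a 0 0 * conv_sum n (\<lambda>j k. \<xi> j * \<xi> k) + (- (f3 * u 1)) * (\<xi> 1 * \<xi> 1)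
      + (-2) * conv_sum n (\<lambda>j k. \<xi> k * lin n (a j) \<xi>)
      + (-2) * (\<xi> n * conv_sum (n - 1) (\<lambda>j k. \<xi> k * u j)) + (- u n) * conv_sum (n - 1) (\<lambda>j k. \<xi> j * \<xi> k)"
      using conv_sum_bil[of n n \<xi>] conv_sum_bil[of "n - 1" n \<xi>] conv_sum_lin_bil[of n n \<xi> a] conv_sum_lin[of "n - 1" n \<xi> u]
        lin_nth[OF I(1), of \<xi>] lin_nth[OF I(2), of \<xi>] by simp
    also have "\<dots> = 0" using E by (simp add: power2_eq_square algebra_simps)
    finally show ?thesis .
  qed
  note Q = bil_zero[OF this]
  show "a (n - i) k + a (n - k) i = (if i + k = n then a 0 0 else 0) - (if i + k = n - 1 then u n else 0)
        - (if i = 1 \<and> k = 1 then f3 * u 1 else 0)" if "i \<in> {1..<n}" "k \<in> {1..<n}"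
    using Q[of i k] that by (auto simp: q_def uvec_def add.commute split: if_splits)
  show "a (n - k) n = - (if k < n - 1 then u (n - 1 - k) else 0)" if "k \<in> {1..<n}"
    using Q[of n k] that assms(1) by (auto simp: q_def uvec_def split: if_splits)
qed

text \<open>Coefficients of the right-hand side minus the left-hand side of
  \<open>third_order\<close>, not symmetrized: each product contributes in the order in which its
  factors are written.\<close>

definition third_coeff :: "nat \<Rightarrow> real \<Rightarrow> real \<Rightarrow> (nat \<Rightarrow> real) \<Rightarrow> (nat \<Rightarrow> nat \<Rightarrow> real) \<Rightarrow> (nat \<Rightarrow> nat \<Rightarrow> nat \<Rightarrow> real) \<Rightarrow> nat \<Rightarrow> nat \<Rightarrow> nat \<Rightarrow> real" where
  "third_coeff n f3 f4 u a B i k l = 2 / 3 * (if i < n then B (n - i) k l else 0) - a 0 0 * (uvec n i * (if k + l = n - 1 then 1 else 0))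
    + (f4 * u 1 - f3 / 3 * a 0 0) * (uvec 1 i * (uvec 1 k * uvec 1 l)) + f3 * (uvec 1 i * (uvec 1 k * a 1 l))
    + 2 * ((if i < n then a (n - i) 0 else 0) * (if k + l = n then 1 else 0))
    + 2 * (uvec n i * (if k < n - 1 then a (n - 1 - k) l else 0)) + a n i * (if k + l = n - 1 then 1 else 0)
    + 2 * (uvec n i * (uvec n k * (if l < n - 2 then u (n - 2 - l) else 0))) + 2 * u n * (uvec n i * (if k + l = n - 2 then 1 else 0))"

lemma third_order_polar:
  assumes "n > 4" "third_order n f3 f4 u a B"
  defines "q \<equiv> third_coeff n f3 f4 u a B"
  shows "i \<in> {1..n} \<Longrightarrow> k \<in> {1..n} \<Longrightarrow> l \<in> {1..n} \<Longrightarrow>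
    q i k l + q k l i + q l i k + q k i l + q i l k + q l k i = 0"
proof -
  have I: "1 \<in> {1..n}" "n \<in> {1..n}" using assms(1) by auto
  have "tri n q \<xi> \<xi> \<xi> = 0" for \<xi>
  proof -
    note E = assms(2)[unfolded third_order_def, rule_format, of \<xi>]
    have "tri n q \<xi> \<xi> \<xi> = 2 / 3 * tri n (\<lambda>i k l. if i < n then B (n - i) k l else 0) \<xi> \<xi> \<xi>
      + (- a 0 0) * (lin n (uvec n) \<xi> * bil n (\<lambda>k l. if k + l = n - 1 then 1 else 0) \<xi> \<xi>)
      + (f4 * u 1 - f3 / 3 * a 0 0) * (lin n (uvec 1) \<xi> * (lin n (uvec 1) \<xi> * lin n (uvec 1) \<xi>))
      + f3 * (lin n (uvec 1) \<xi> * (lin n (uvec 1) \<xi> * lin n (a 1) \<xi>))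
      + 2 * (lin n (\<lambda>i. if i < n then a (n - i) 0 else 0) \<xi> * bil n (\<lambda>k l. if k + l = n then 1 else 0) \<xi> \<xi>)
      + 2 * (lin n (uvec n) \<xi> * bil n (\<lambda>k l. if k < n - 1 then a (n - 1 - k) l else 0) \<xi> \<xi>)
      + lin n (a n) \<xi> * bil n (\<lambda>k l. if k + l = n - 1 then 1 else 0) \<xi> \<xi>
      + 2 * (lin n (uvec n) \<xi> * (lin n (uvec n) \<xi> * lin n (\<lambda>l. if l < n - 2 then u (n - 2 - l) else 0) \<xi>))
      + 2 * u n * (lin n (uvec n) \<xi> * bil n (\<lambda>k l. if k + l = n - 2 then 1 else 0) \<xi> \<xi>)"
      unfolding lin_mult_lin lin_mult_bil tri_cmult tri_plus q_def
      by (rule arg_cong[where f = "\<lambda>q. tri n q \<xi> \<xi> \<xi>"]) (simp add: fun_eq_iff third_coeff_def)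
    also have "\<dots> = 2 / 3 * conv_sum n (\<lambda>j k. \<xi> k * bil n (B j) \<xi> \<xi>)
      + (- a 0 0) * (\<xi> n * conv_sum (n - 1) (\<lambda>j k. \<xi> j * \<xi> k))
      + (f4 * u 1 - f3 / 3 * a 0 0) * (\<xi> 1 * (\<xi> 1 * \<xi> 1))
      + f3 * (\<xi> 1 * (\<xi> 1 * lin n (a 1) \<xi>))
      + 2 * (conv_sum n (\<lambda>j k. \<xi> k * a j 0) * conv_sum n (\<lambda>j k. \<xi> j * \<xi> k))
      + 2 * (\<xi> n * conv_sum (n - 1) (\<lambda>j k. \<xi> k * lin n (a j) \<xi>))
      + lin n (a n) \<xi> * conv_sum (n - 1) (\<lambda>j k. \<xi> j * \<xi> k)
      + 2 * (\<xi> n * (\<xi> n * conv_sum (n - 2) (\<lambda>j k. \<xi> k * u j)))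
      + 2 * u n * (\<xi> n * conv_sum (n - 2) (\<lambda>j k. \<xi> j * \<xi> k))"
      using conv_sum_bil[of n n \<xi>] conv_sum_bil[of "n - 1" n \<xi>] conv_sum_bil[of "n - 2" n \<xi>] conv_sum_lin_bil[of "n - 1" n \<xi> a] conv_sum_lin[of "n - 2" n \<xi> u]
        conv_sum_lin[of n n \<xi> "\<lambda>j. a j 0"] conv_sum_lin_tri[of n n \<xi> B]
        lin_nth[OF I(1), of \<xi>] lin_nth[OF I(2), of \<xi>] by simp
    also have "\<dots> = 0" using E by (simp add: power2_eq_square power3_eq_cube algebra_simps)
    finally show ?thesis .
  qed
  from tri_zero[OF this] show "i \<in> {1..n} \<Longrightarrow> k \<in> {1..n} \<Longrightarrow> l \<in> {1..n} \<Longrightarrow>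
    q i k l + q k l i + q l i k + q k i l + q i l k + q l k i = 0" .
qed

text \<open>Part of the tangency equation says that \<open>M i b = a (n - b) i\<close> is an infinitesimal conformal map
  of the quadric; the part linear in \<open>x\<^sub>n\<close> makes \<open>M\<close> constant along antidiagonals, up to shifts.\<close>

lemma first_order_system:
  assumes n: "n > 4" and E2: "second_order n f3 u a" and E3: "third_order n f3 f4 u a B"
    and B: "\<And>j k l. j \<in> {1..<n} \<Longrightarrow> k = n \<or> l = n \<Longrightarrow> B j k l = 0"
  defines "\<kappa> \<equiv> a n n" and "m \<equiv> a 1 1 - a n n"
  shows "j \<in> {2..<n} \<Longrightarrow> a j n = - u (j - 1)" and "a 1 n = 0"
    and "a 0 0 = 2 * m + real n * \<kappa>"
    and "i \<in> {1..<n} \<Longrightarrow> j \<in> {1..<n} \<Longrightarrow> a j i = (if i = j then m + real i * \<kappa> else 0)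
      + (if j = i + 1 then (real i - real n / 2) * u n else 0) - (if i = 1 \<and> j = n - 1 then f3 / 2 * u 1 else 0)"
proof -
  define M where "M = (\<lambda>i b. a (n - b) i)"
  show "a j n = - u (j - 1)" if "j \<in> {2..<n}"
  proof -
    from that have "n - j \<in> {1..<n}" "n - j < n - 1" "n - (n - j) = j" "n - 1 - (n - j) = j - 1" by auto
    with second_order_polar(2)[OF n E2, of "n - j"] show ?thesis by simp
  qed
  have a1n: "a 1 n = 0"
  proof -
    have "n - 1 \<in> {1..<n}" "n - (n - 1) = 1" using n by auto
    with second_order_polar(2)[OF n E2, of "n - 1"] show ?thesis by simp
  qed
  then show "a 1 n = 0" .
  \<comment> \<open>The quadratic part of the hypersurface determines only the symmetric part of
    \<open>M\<close>.\<close>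
  have kill: "M k i + M i k = (if i + k = n then a 0 0 else 0) - (if i + k = n - 1 then u n else 0)
        - (if i = 1 \<and> k = 1 then f3 * u 1 else 0)" if "i \<in> {1..<n}" "k \<in> {1..<n}" for i k
    using second_order_polar(1)[OF n E2 that] unfolding M_def .
  \<comment> \<open>The coefficient of \<open>\<xi> n * \<xi> i * \<xi> k\<close>, from which the
    second derivatives drop out by the hypothesis \<open>B\<close>. It relates shifted entries of
    \<open>M\<close>.\<close>
  have third: "(if i < n - 1 then M k (i + 1) else 0) + (if k < n - 1 then M i (k + 1) else 0)
    = (if i + k = n - 1 then a 0 0 - \<kappa> else 0) - (if i + k = n - 2 then 2 * u n else 0)"
    if ik: "i \<in> {1..<n}" "k \<in> {1..<n}" for i k
  proof -
    have I: "i \<in> {1..n}" "k \<in> {1..n}" "n \<in> {1..n}" using ik n by auto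
    have c1: "third_coeff n f3 f4 u a B n i k = - (if i + k = n - 1 then a 0 0 - \<kappa> else 0)
      + 2 * (if i < n - 1 then M k (i + 1) else 0) + (if i + k = n - 2 then 2 * u n else 0)"
      if "i \<in> {1..<n}" "k \<in> {1..<n}" for i k
    proof -
      have "n - (i + 1) = n - 1 - i" by simp
      then show ?thesis using that n by (simp add: third_coeff_def uvec_def M_def \<kappa>_def)
    qed
    have c2: "third_coeff n f3 f4 u a B i n k = 0" if "i \<in> {1..<n}" "k \<in> {1..<n}" for i k
    proof -
      have "B (n - i) n k = 0" using that by (intro B) auto
      then show ?thesis using that n by (simp add: third_coeff_def uvec_def)
    qed
    have c3: "third_coeff n f3 f4 u a B i k n = 0" if "i \<in> {1..<n}" "k \<in> {1..<n}" for i k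
    proof -
      have "B (n - i) k n = 0" using that by (intro B) auto
      then show ?thesis using that n a1n by (simp add: third_coeff_def uvec_def)
    qed
    show ?thesis
      using third_order_polar[OF n E3 I(3,1,2)]
      unfolding c1[OF ik] c1[OF ik(2,1)] c2[OF ik] c2[OF ik(2,1)] c3[OF ik] c3[OF ik(2,1)] add.commute[of k i]
      by linarith
  qed
  \<comment> \<open>Subtracting \<open>third\<close> from \<open>kill\<close> at
    \<open>(i + 1, k)\<close> eliminates \<open>M k (i + 1)\<close> and leaves a recursion along the
    antidiagonal through \<open>(i + 1, k)\<close>.\<close>
  have step: "M (i + 1) k = M i (k + 1) + (if i + k = n - 1 then \<kappa> else 0) + (if i + k = n - 2 then u n else 0)"
    if "i \<in> {1..n-2}" "k \<in> {1..n-2}" for i k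
  proof -
    have "M k (i + 1) + M i (k + 1) = (if i + k = n - 1 then a 0 0 - \<kappa> else 0) - (if i + k = n - 2 then 2 * u n else 0)"
    proof -
      have b: "i < n - 1" "k < n - 1" "i \<in> {1..<n}" "k \<in> {1..<n}" using that n by auto
      show ?thesis using third[OF b(3,4)] b(1,2) by simp
    qed
    moreover have "i + 1 + k = n \<longleftrightarrow> i + k = n - 1" "i + 1 + k = n - 1 \<longleftrightarrow> i + k = n - 2"
      using that n by auto
    then have "M k (i + 1) + M (i + 1) k = (if i + k = n - 1 then a 0 0 else 0) - (if i + k = n - 2 then u n else 0)"
    proof -
      assume e: "i + 1 + k = n \<longleftrightarrow> i + k = n - 1" "i + 1 + k = n - 1 \<longleftrightarrow> i + k = n - 2"
      have b: "i + 1 \<in> {1..<n}" "k \<in> {1..<n}" "i + 1 \<noteq> 1" using that n by auto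
      show ?thesis using kill[OF b(1,2)] b(3) unfolding e by simp
    qed
    ultimately show ?thesis by (cases "i + k = n - 1"; cases "i + k = n - 2") simp_all
  qed
  \<comment> \<open>At \<open>i = n - 1\<close> one term of \<open>third\<close> is absent; this
    starts the recursion on the antidiagonals beyond \<open>n\<close>.\<close>
  have last: "M (n - 1) (k + 1) = 0" if "k \<in> {1..n-2}" for k
  proof -
    have b: "n - 1 \<in> {1..<n}" "k \<in> {1..<n}" "\<not> n - 1 < n - 1" "k < n - 1" "n - 1 + k \<noteq> n - 1" "n - 1 + k \<noteq> n - 2"
      using that n by auto
    show ?thesis using third[OF b(1,2)] b(3-6) by simp
  qed
  have diag: "M i (s - i) = M 1 (s - 1) + (real i - 1) * ((if s = n then \<kappa> else 0) + (if s = n - 1 then u n else 0))"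
    if "1 \<le> i" "i < s" "s \<le> n" for i s
    using that
  proof (induction i rule: nat_induct_at_least)
    case base
    show ?case by simp
  next
    case (Suc i)
    have "i \<in> {1..n-2}" "s - Suc i \<in> {1..n-2}" "s - Suc i + 1 = s - i" "i + (s - Suc i) = s - 1"
      using Suc by auto
    moreover have "i + (s - Suc i) = n - 1 \<longleftrightarrow> s = n" "i + (s - Suc i) = n - 2 \<longleftrightarrow> s = n - 1"
      using Suc.prems n by linarith+
    ultimately have "M (Suc i) (s - Suc i) = M i (s - i) + (if s = n then \<kappa> else 0) + (if s = n - 1 then u n else 0)"
      using step[of i "s - Suc i"] by simp
    then show ?case using Suc by (simp add: algebra_simps)
  qed
  \<comment> \<open>The recursion relates the two ends \<open>(1, s - 1)\<close> and
    \<open>(s - 1, 1)\<close> of the antidiagonal, and \<open>kill\<close> gives their sum.\<close>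
  have low: "M 1 (s - 1) = ((if s = n then a 0 0 else 0) - (if s = n - 1 then u n else 0) - (if s = 2 then f3 * u 1 else 0)
      - (real s - 2) * ((if s = n then \<kappa> else 0) + (if s = n - 1 then u n else 0))) / 2"
    if "2 \<le> s" "s \<le> n" for s
  proof -
    have "s - (s - 1) = 1" "real (s - 1) = real s - 1" using that by auto
    then have "M (s - 1) 1 = M 1 (s - 1) + (real s - 2) * ((if s = n then \<kappa> else 0) + (if s = n - 1 then u n else 0))"
      using diag[of "s - 1" s] that by simp
    moreover have "M (s - 1) 1 + M 1 (s - 1) = (if s = n then a 0 0 else 0) - (if s = n - 1 then u n else 0) - (if s = 2 then f3 * u 1 else 0)"
    proof -
      have b: "1 \<in> {1..<n}" "s - 1 \<in> {1..<n}" using that n by auto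
      have e: "1 + (s - 1) = s" "s - 1 = 1 \<longleftrightarrow> s = 2" using that by auto
      show ?thesis using kill[OF b] unfolding e by simp
    qed
    ultimately show ?thesis by (simp add: field_simps)
  qed
  have high: "M i (s - i) = 0" if "n < s" "i < n" "s - i < n" for i s
    using that
  proof (induction "n - 1 - i" arbitrary: i)
    case 0
    then have "i = n - 1" by simp
    moreover from this have "s - n \<in> {1..n-2}" "s - i = s - n + 1" using 0 n by auto
    ultimately show ?case using last[of "s - n"] by simp
  next
    case (Suc x)
    have "M (Suc i) (s - Suc i) = 0" using Suc by (intro Suc.hyps(1)) auto
    moreover have "i \<in> {1..n-2}" "s - Suc i \<in> {1..n-2}" "s - Suc i + 1 = s - i" "i + (s - Suc i) = s - 1"
      using Suc n by auto
    moreover have "s - 1 \<noteq> n - 1" "s - 1 \<noteq> n - 2" using Suc.prems n by auto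
    ultimately show ?case using step[of i "s - Suc i"] by simp
  qed
  have M: "M i b = (if i + b = n then (a 0 0 - real n * \<kappa>) / 2 + real i * \<kappa> else 0)
    + (if i + b = n - 1 then (real i - real n / 2) * u n else 0) - (if i = 1 \<and> b = 1 then f3 / 2 * u 1 else 0)"
    if "i \<in> {1..<n}" "b \<in> {1..<n}" for i b
  proof (cases "i + b \<le> n")
    case True
    have s: "i + b - i = b" "2 \<le> i + b" "i < i + b" "1 \<le> i" using that by auto
    have n1: "real (n - 1) = real n - 1" using n by simp
    note dg = diag[OF s(4,3) True, unfolded s(1)] and lo = low[OF s(2) True]
    have e2: "i = 1 \<and> b = 1 \<longleftrightarrow> i + b = 2" using s by auto
    have ne: "n \<noteq> n - 1" "n - 1 \<noteq> n" "n \<noteq> 2" "n - 1 \<noteq> 2" "2 \<noteq> n" "2 \<noteq> n - 1" using n by auto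
    consider "i + b = n" | "i + b = n - 1" | "i + b = 2" | "i + b \<noteq> n" "i + b \<noteq> n - 1" "i + b \<noteq> 2" by blast
    then show ?thesis
    proof cases
      case 1
      show ?thesis using dg lo unfolding e2 1 using ne by (simp add: field_simps)
    next
      case 2
      show ?thesis using dg lo unfolding e2 2 using ne n1 by (simp add: field_simps)
    next
      case 3
      then have "i = 1" by (simp flip: e2)
      then show ?thesis using dg lo unfolding e2 3 using ne by simp
    next
      case 4
      then show ?thesis using dg lo unfolding e2 by simp
    qed
  next
    case False
    then have "n < i + b" "i + b - i < n" "i < n" "i + b \<noteq> n" "i + b \<noteq> n - 1" "\<not> (i = 1 \<and> b = 1)"
      using that n by auto
    then show ?thesis using high[of "i + b" i] by simp
  qed
  \<comment> \<open>The entry \<open>(1, n - 1)\<close> identifies the constant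
    \<open>(a 0 0 - n * \<kappa>) / 2\<close> on the antidiagonal \<open>i + b = n\<close> with
    \<open>m\<close>.\<close>
  have "a 1 1 = M 1 (n - 1)" unfolding M_def using n by simp
  then have m: "(a 0 0 - real n * \<kappa>) / 2 = m" using M[of 1 "n - 1"] n unfolding m_def \<kappa>_def[symmetric] by auto
  then show "a 0 0 = 2 * m + real n * \<kappa>" by (simp add: field_simps)
  show "a j i = (if i = j then m + real i * \<kappa> else 0)
      + (if j = i + 1 then (real i - real n / 2) * u n else 0) - (if i = 1 \<and> j = n - 1 then f3 / 2 * u 1 else 0)"
    if "i \<in> {1..<n}" "j \<in> {1..<n}"
  proof -
    have e: "n - (n - j) = j" "n - j \<in> {1..<n}" using that by auto
    have eq: "i + (n - j) = n \<longleftrightarrow> i = j" "i + (n - j) = n - 1 \<longleftrightarrow> j = i + 1" "n - j = 1 \<longleftrightarrow> j = n - 1"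
      using that by auto
    show ?thesis using M[OF that(1) e(2)] unfolding M_def e(1) m eq .
  qed
qed

text \<open>The second derivatives of the components are \<open>N j k l\<close>; \<open>D j k\<close> is the part of the first derivatives
  which vanishes on homogeneous fields. Here \<open>n > 4\<close> is essential.\<close>

lemma second_derivative_system:
  assumes n: "n > 4"
    and sym: "\<And>j k l. j \<le> n \<Longrightarrow> k \<le> n \<Longrightarrow> l \<le> n \<Longrightarrow> N j k l = N j l k"
    and N0: "\<And>k l. k \<in> {1..<n} \<Longrightarrow> l \<le> n \<Longrightarrow> N 0 k l = 2 * D (n - k) l" "\<And>l. l \<le> n \<Longrightarrow> N 0 n l = 0"
    and Nn: "\<And>j l. j \<in> {2..<n} \<Longrightarrow> l \<le> n \<Longrightarrow> N j n l = - D (j - 1) l" "\<And>l. l \<le> n \<Longrightarrow> N 1 n l = 0"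
    and N00: "\<And>l. l \<le> n \<Longrightarrow> N 0 0 l = 2 * m l + real n * \<kappa> l"
    and N: "\<And>i j l. i \<in> {1..<n} \<Longrightarrow> j \<in> {1..<n} \<Longrightarrow> l \<le> n \<Longrightarrow> N j i l = (if i = j then m l + real i * \<kappa> l else 0)
      + (if j = i + 1 then (real i - real n / 2) * D n l else 0) - (if i = 1 \<and> j = n - 1 then f3 / 2 * D 1 l else 0)"
  shows "j \<in> {1..<n-1} \<Longrightarrow> l \<le> n \<Longrightarrow> D j l = 0"
    and "l \<le> n \<Longrightarrow> l \<noteq> 1 \<Longrightarrow> D (n - 1) l = 0"
    and "l \<in> {1..n} \<Longrightarrow> m l = 0" "l \<in> {1..n} \<Longrightarrow> \<kappa> l = 0" "l \<in> {1..n} \<Longrightarrow> D n l = 0"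
proof -
  obtain d where nd: "n = d + 5" using n le_Suc_ex[of 5 n] by auto
  have Dn: "D j n = 0" if "j \<in> {1..<n}" for j
  proof -
    have "n - j \<in> {1..<n}" "n - (n - j) = j" using that by auto
    then show ?thesis using N0(1)[of "n - j" n] N0(2)[of "n - j"] sym[of 0 "n - j" n] by simp
  qed
  have Dsym: "D (n - k) l = D (n - l) k" if "k \<in> {1..<n}" "l \<in> {1..<n}" for k l
    using N0(1)[of k l] N0(1)[of l k] sym[of 0 k l] that by simp
  \<comment> \<open>The symmetry \<open>N j n i = N j i n\<close> equates the formula for the
    \<open>z_n\<close>-derivatives with the formula for the others at \<open>l = n\<close>.\<close>
  have Dj: "D (j - 1) i = - (if i = j then m n + real i * \<kappa> n else 0) - (if j = i + 1 then (real i - real n / 2) * D n n else 0)"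
    if "j \<in> {2..<n}" "i \<in> {1..<n}" for i j
  proof -
    have D1: "D 1 n = 0" using Dn[of 1] n by simp
    show ?thesis using Nn(1)[of j i] N[of i j n] sym[of j n i] that n unfolding D1 by (simp split: if_splits)
  qed
  \<comment> \<open>\<open>D 2 2\<close> and \<open>D (n - 2) (n - 2)\<close> are equal by
    \<open>Dsym\<close>, while \<open>Dj\<close> gives them, up to a common sign, with the factors
    \<open>2 - n/2\<close> and \<open>n - 2 - n/2\<close>. These differ by \<open>n - 4\<close>: for
    \<open>n = 4\<close> the two entries coincide and the comparison is empty.\<close>
  have mun: "D n n = 0"
  proof -
    have "D 2 2 = - (2 - real n / 2) * D n n" using Dj[of 3 2] n by (simp add: algebra_simps)
    moreover have "D (n - 2) (n - 2) = - (real (n - 2) - real n / 2) * D n n"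
      using Dj[of "d + 4" "d + 3"] by (simp add: nd algebra_simps)
    moreover have "D 2 2 = D (n - 2) (n - 2)" using Dsym[of "n - 2" 2] n by simp
    moreover have "real (n - 2) = real n - 2" using n by simp
    ultimately have "(real n - 4) * D n n = 0" by (simp add: algebra_simps)
    then show ?thesis using n by simp
  qed
  \<comment> \<open>Likewise \<open>D 1 2 = D (n - 2) (n - 1)\<close> leaves the factor
    \<open>n - 3\<close>.\<close>
  have kan: "\<kappa> n = 0"
  proof -
    have "D 1 2 = - (m n + 2 * \<kappa> n)" using Dj[of 2 2] n mun by simp
    moreover have "D (n - 2) (n - 1) = - (m n + real (n - 1) * \<kappa> n)"
      using Dj[of "d + 4" "d + 4"] mun by (simp add: nd algebra_simps)
    moreover have "D 1 2 = D (n - 2) (n - 1)" using Dsym[of "n - 1" 2] n by simp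
    moreover have "real (n - 1) = real n - 1" using n by simp
    ultimately have "2 * \<kappa> n = (real n - 1) * \<kappa> n" by simp
    then have "(real n - 3) * \<kappa> n = 0" by (simp add: algebra_simps)
    then show ?thesis using n by simp
  qed
  have mn: "m n = 0"
    using N[of 1 1 n] Nn(2)[of 1] sym[of 1 1 n] n kan by simp
  have D1: "D j l = 0" if "j \<in> {1..<n-1}" "l \<in> {1..n}" for j l
    using Dj[of "j + 1" l] Dn[of j] that mn kan mun by (cases "l = n") auto
  have D2: "D (n - 1) l = 0" if "l \<in> {2..n}" for l
  proof (cases "l = n")
    case True
    then show ?thesis using Dn[of "n - 1"] n by simp
  next
    case False
    then have b: "1 \<in> {1..<n}" "l \<in> {1..<n}" "n - l \<in> {1..<n-1}" "1 \<in> {1..n}" using that n by auto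
    show ?thesis using Dsym[OF b(1,2)] D1[OF b(3,4)] by simp
  qed
  have Ns: "N j i l = (if i = j then m l + real i * \<kappa> l else 0)
      + (if j = i + 1 then (real i - real n / 2) * D n l else 0)"
    if "i \<in> {1..<n}" "j \<in> {1..<n}" "l \<in> {1..<n}" for i j l
    using N[of i j l] D1[of 1 l] that n by auto
  have S: "N j i l = N j l i" if "i \<in> {1..<n}" "j \<in> {1..<n}" "l \<in> {1..<n}" for i j l
    using sym[of j i l] that by simp
  \<comment> \<open>For \<open>l < n\<close> the value
    \<open>N i i l = m l + i * \<kappa> l\<close>, \<open>i\<close> different from \<open>l\<close>,
    equals \<open>N i l i\<close>, which vanishes unless \<open>i = l + 1\<close>. Two such
    \<open>i\<close> kill both unknowns; for \<open>l = 1\<close> they are 3 and 4, which again uses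
    \<open>n > 4\<close>.\<close>
  have m1: "m 1 = 0" "\<kappa> 1 = 0"
    using S[of 3 3 1] S[of 4 4 1] Ns[of 3 3 1] Ns[of 1 3 3] Ns[of 4 4 1] Ns[of 1 4 4] n by auto
  have mu2: "D n 2 = 0"
    using S[of 2 2 1] Ns[of 2 2 1] Ns[of 1 2 2] m1 n by auto
  have m2: "m 2 = 0" "\<kappa> 2 = 0"
    using S[of 1 1 2] S[of 4 4 2] Ns[of 1 1 2] Ns[of 2 1 1] Ns[of 4 4 2] Ns[of 2 4 4] n by auto
  have mb: "m l = 0 \<and> \<kappa> l = 0" if "l \<in> {3..<n}" for l
    using S[of 1 1 l] S[of 2 2 l] Ns[of 1 1 l] Ns[of l 1 1] Ns[of 2 2 l] Ns[of l 2 2] n that by auto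
  have mu1: "D n 1 = 0"
    using S[of 2 3 1] Ns[of 2 3 1] Ns[of 1 3 2] n by auto
  have mub: "D n l = 0" if "l \<in> {3..<n}" for l
    using S[of 1 2 l] Ns[of 1 2 l] Ns[of l 2 1] n that by auto
  have cases_l: "l = 1 \<or> l = 2 \<or> l \<in> {3..<n} \<or> l = n" if "l \<in> {1..n}" for l
    using that by auto
  show ml: "m l = 0" "\<kappa> l = 0" "D n l = 0" if "l \<in> {1..n}" for l
    using cases_l[OF that] m1 m2 mb mn kan mun mu1 mu2 mub by auto
  \<comment> \<open>The direction \<open>z_0\<close> is reached through
    \<open>N 0 (n - j) 0 = N 0 0 (n - j)\<close>, now known to be 0.\<close>
  have D0: "D j 0 = 0" if "j \<in> {1..<n}" for j
  proof -
    have "n - j \<in> {1..<n}" "n - (n - j) = j" using that by auto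
    then show ?thesis using N0(1)[of "n - j" 0] N00[of "n - j"] sym[of 0 0 "n - j"] ml[of "n - j"] by auto
  qed
  show "D j l = 0" if "j \<in> {1..<n-1}" "l \<le> n"
    using D1[of j l] D0[of j] that by (cases "l = 0") auto
  show "D (n - 1) l = 0" if "l \<le> n" "l \<noteq> 1"
    using D2[of l] D0[of "n - 1"] that n by (cases "l = 0") auto
qed

text \<open>Once the second derivatives are known, the cubic part in \<open>x\<^sub>1, \<dots>, x\<^bsub>n-1\<^esub>\<close> reads
  \<open>2 Q l + Q' l' = const x\<^sub>1\<^sup>3\<close> with quadratic forms \<open>Q\<close>, \<open>Q'\<close>, which forces \<open>l = l' = 0\<close>.\<close>

lemma cubic_system:
  assumes n: "n > 4" and E3: "third_order n f3 f4 u a B"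
    and B: "\<And>j k l. j \<in> {1..<n} \<Longrightarrow> k \<in> {1..<n} \<Longrightarrow> l \<in> {1..<n} \<Longrightarrow> \<not> (j = n - 1 \<and> k = 1 \<and> l = 1) \<Longrightarrow> B j k l = 0"
    and a1: "\<And>i. i \<in> {2..<n} \<Longrightarrow> a 1 i = 0"
  shows "j \<in> {1..<n} \<Longrightarrow> a j 0 = 0" and "i \<in> {1..<n} \<Longrightarrow> a n i = 0"
    and "2 * B (n - 1) 1 1 = f3 * a 0 0 - 3 * f3 * a 1 1 - 3 * f4 * u 1"
proof -
  obtain d where nd: "n = d + 5" using n le_Suc_ex[of 5 n] by auto
  define x where "x = (\<lambda>i. a (n - i) 0)"
  define y where "y = (\<lambda>i. a n i)"
  \<comment> \<open>Three times the coefficient of \<open>\<xi> 1 ^ 3\<close>, apart from the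
    products with the quadratic forms.\<close>
  define K where "K = 2 * B (n - 1) 1 1 + 3 * f4 * u 1 - f3 * a 0 0 + 3 * f3 * a 1 1"
  have T: "third_coeff n f3 f4 u a B i k l = 2 * x i * of_bool (k + l = n) + y i * of_bool (k + l = n - 1)
    + K / 3 * of_bool (i = 1 \<and> k = 1 \<and> l = 1)"
    if "i \<in> {1..<n}" "k \<in> {1..<n}" "l \<in> {1..<n}" for i k l
  proof -
    have "n - i \<in> {1..<n}" "n - i = n - 1 \<longleftrightarrow> i = 1" using that by auto
    then have "B (n - i) k l = B (n - 1) 1 1 * of_bool (i = 1 \<and> k = 1 \<and> l = 1)"
      using B[of "n - i" k l] that by auto
    moreover have "uvec 1 i * (uvec 1 k * a 1 l) = a 1 1 * of_bool (i = 1 \<and> k = 1 \<and> l = 1)"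
      using a1[of l] that by (cases "l = 1") (auto simp: uvec_def)
    moreover have "uvec 1 i * (uvec 1 k * uvec 1 l) = of_bool (i = 1 \<and> k = 1 \<and> l = 1)"
      by (auto simp: uvec_def)
    moreover have "uvec n i = 0" using that by (auto simp: uvec_def)
    moreover have "(if i < n then z else 0) = z" for z :: real using that by simp
    ultimately show ?thesis
      unfolding third_coeff_def x_def y_def K_def by (simp add: field_simps)
  qed
  have P: "2 * x i * of_bool (k + l = n) + 2 * x l * of_bool (i + k = n) + 2 * x k * of_bool (l + i = n)
    + y i * of_bool (k + l = n - 1) + y l * of_bool (i + k = n - 1) + y k * of_bool (l + i = n - 1)
    + K * of_bool (i = 1 \<and> k = 1 \<and> l = 1) = 0"
    if I: "i \<in> {1..<n}" "k \<in> {1..<n}" "l \<in> {1..<n}" for i k l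
  proof -
    have I': "i \<in> {1..n}" "k \<in> {1..n}" "l \<in> {1..n}" using I by auto
    have "of_bool (k = 1 \<and> l = 1 \<and> i = 1) = (of_bool (i = 1 \<and> k = 1 \<and> l = 1) :: real)"
      "of_bool (l = 1 \<and> i = 1 \<and> k = 1) = (of_bool (i = 1 \<and> k = 1 \<and> l = 1) :: real)"
      "of_bool (k = 1 \<and> i = 1 \<and> l = 1) = (of_bool (i = 1 \<and> k = 1 \<and> l = 1) :: real)"
      "of_bool (i = 1 \<and> l = 1 \<and> k = 1) = (of_bool (i = 1 \<and> k = 1 \<and> l = 1) :: real)"
      "of_bool (l = 1 \<and> k = 1 \<and> i = 1) = (of_bool (i = 1 \<and> k = 1 \<and> l = 1) :: real)"
      by auto
    note sym = this
    show ?thesis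
      using third_order_polar[OF n E3 I']
      unfolding T[OF I(1,2,3)] T[OF I(2,3,1)] T[OF I(3,1,2)] T[OF I(2,1,3)] T[OF I(1,3,2)] T[OF I(3,2,1)]
        add.commute[of l k] add.commute[of k i] add.commute[of i l] sym
      by linarith
  qed
  show "2 * B (n - 1) 1 1 = f3 * a 0 0 - 3 * f3 * a 1 1 - 3 * f4 * u 1"
  proof -
    have "Suc (Suc 0) \<noteq> n" "Suc (Suc 0) \<noteq> n - Suc 0" using n by auto
    then show ?thesis using P[of 1 1 1] n by (simp add: K_def)
  qed
  \<comment> \<open>Here \<open>d + 4 = n - 1\<close>. The triples are chosen so that the
    antidiagonal conditions hold only for the wanted unknown and for unknowns already known to
    vanish.\<close>
  have xn: "x (d + 4) = 0" using P[of 1 "d + 4" "d + 4"] by (simp add: nd)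
  have x1: "x 1 = 0" using P[of 1 1 "d + 4"] by (simp add: nd)
  have yn: "y (d + 4) = 0" using P[of 2 "d + 2" "d + 4"] by (simp add: nd)
  have x: "x i = 0" if "i \<in> {1..<n}" for i
    using P[of 1 "d + 4" i] that xn x1 yn by (cases "i = 1"; cases "i = d + 4") (auto simp: nd)
  have y: "y i = 0" if "i \<in> {1..<n}" for i
    using P[of 1 "d + 3" i] that x[of 1] x[of "d + 3"] x[OF that]
    by (cases "i = 1"; cases "i = d + 3") (auto simp: nd)
  show "a n i = 0" if "i \<in> {1..<n}" using y[OF that] by (simp add: y_def)
  show "a j 0 = 0" if "j \<in> {1..<n}" using x[of "n - j"] that by (auto simp: x_def)
qed

lemma conv_sum_add: "conv_sum s g + conv_sum s h = conv_sum s (\<lambda>j k. g j k + h j k)"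
  unfolding conv_sum_def by (simp add: sum.distrib split_beta)

lemma conv_sum_split:
  "conv_sum s (\<lambda>j k. 2 * \<xi> k * (T j / 2 + Q * a j)) = conv_sum s (\<lambda>j k. \<xi> k * T j) + 2 * Q * conv_sum s (\<lambda>j k. \<xi> k * a j)"
  unfolding conv_sum_cmult conv_sum_add by (rule conv_sum_cong) (simp add: algebra_simps)

section \<open>Differentiating relations on the imaginary points\<close>

lemma Re_pd_zero:
  assumes "chol G (ball 0 r)" "\<And>p. p \<in> ipts r \<Longrightarrow> Im (G p) = 0" "p \<in> ipts r"
  shows "Re (pd k G p) = 0"
proof -
  have "Im (pd k (\<lambda>z. (-\<i>) * G z) p) = 0"
    by (rule Im_pd_zero[OF chol_cmult[OF assms(1)]]) (use assms(2,3) in auto)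
  moreover have "pd k (\<lambda>z. (-\<i>) * G z) p = (-\<i>) * pd k G p"
    by (rule pd_cmult[OF assms(1)]) (use assms(3) in \<open>simp add: ipts_def\<close>)
  ultimately show ?thesis by simp
qed

text \<open>With real coefficients, a linear relation between real parts says that a holomorphic
  combination has real part 0, so \<open>Im_pd_zero\<close> applies. Four terms are what the longest
  relation has, the one for the middle components in \<open>first_derivatives\<close>.\<close>

lemma Im_pd_relation:
  assumes G: "chol G (ball 0 r)" "chol H1 (ball 0 r)" "chol H2 (ball 0 r)" "chol H3 (ball 0 r)" "chol H4 (ball 0 r)"
    and rel: "\<And>p. p \<in> ipts r \<Longrightarrow> Re (G p) = a1 * Re (H1 p) + a2 * Re (H2 p) + a3 * Re (H3 p) + a4 * Re (H4 p)"
    and p: "p \<in> ipts r"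
  shows "Im (pd k G p) = a1 * Im (pd k H1 p) + a2 * Im (pd k H2 p) + a3 * Im (pd k H3 p) + a4 * Im (pd k H4 p)"
proof -
  let ?H = "\<lambda>z. of_real a1 * H1 z + of_real a2 * H2 z + of_real a3 * H3 z + of_real a4 * H4 z"
  have H: "chol ?H (ball 0 r)" by (intro chol_add chol_cmult G)
  have pb: "p \<in> ball 0 r" using p by (simp add: ipts_def)
  have "Im (pd k (\<lambda>z. G z - ?H z) p) = 0"
    by (rule Im_pd_zero[OF chol_diff[OF G(1) H] _ p]) (use rel in simp)
  moreover have "pd k (\<lambda>z. G z - ?H z) p = pd k G p - pd k ?H p"
    by (rule pd_diff[OF G(1) H pb])
  moreover have "pd k ?H p = of_real a1 * pd k H1 p + of_real a2 * pd k H2 p + of_real a3 * pd k H3 p + of_real a4 * pd k H4 p"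
    by (simp add: pd_add[OF _ _ pb] pd_cmult[OF _ pb] chol_add chol_cmult G)
  ultimately show ?thesis by simp
qed

lemma const_if_pd_zero:
  assumes "chol G (ball 0 r)" "r > 0" "\<And>k p. p \<in> ipts r \<Longrightarrow> pd k G p = 0" "z \<in> ball 0 r"
  shows "G z = G 0"
  using affine_if_pd_const[OF assms(1,2), of "\<lambda>_. 0" z] assms(3,4) by simp

section \<open>The form of an infinitesimal automorphism\<close>

text \<open>The normalization of the first two derivatives of \<open>f\<close> is reached by a shear
  in \<open>normal_form\<close>; it keeps \<open>f\<close> out of the first-order equation and
  leaves only \<open>f3\<close> and \<open>f4\<close> in the others.\<close>

locale tangent_field = indexed n c for n :: nat and c :: "nat \<Rightarrow> 'm::finite" +
  fixes f :: "real \<Rightarrow> real" and X :: "complex ^ 'm \<Rightarrow> complex ^ 'm" and r :: real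
  assumes f: "smooth f" "f 0 = 0" "deriv f 0 = 0" "(deriv ^^ 2) f 0 = 0"
    and r: "r > 0"
    and X: "\<And>i. chol (\<lambda>z. X z $ i) (ball 0 r)"
    and tang: "tang f X (ball 0 r)"
begin

abbreviation Xc :: "nat \<Rightarrow> complex ^ 'm \<Rightarrow> complex" where
  "Xc j \<equiv> \<lambda>z. X z $ c j"

abbreviation A :: "nat \<Rightarrow> nat \<Rightarrow> complex ^ 'm \<Rightarrow> real" where
  "A j k p \<equiv> Re (DD k (Xc j) p)"

abbreviation D :: "nat \<Rightarrow> nat \<Rightarrow> complex ^ 'm \<Rightarrow> real" where
  "D j k p \<equiv> Im (DD k (Xc j) p)"

abbreviation N :: "nat \<Rightarrow> nat \<Rightarrow> nat \<Rightarrow> complex ^ 'm \<Rightarrow> real" where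
  "N j k l p \<equiv> Im (DD l (DD k (Xc j)) p)"

abbreviation B :: "nat \<Rightarrow> nat \<Rightarrow> nat \<Rightarrow> complex ^ 'm \<Rightarrow> real" where
  "B j k l p \<equiv> Re (DD l (DD k (Xc j)) p)"

text \<open>\<open>f3\<close> and \<open>f4\<close> are the coefficients of \<open>s^2\<close> and
  \<open>s^3\<close> in the Taylor expansion of \<open>deriv f\<close>, not of
  \<open>f\<close>.\<close>

definition f3 :: real where "f3 = (deriv ^^ 3) f 0 / 2"
definition f4 :: real where "f4 = (deriv ^^ 4) f 0 / 6"

lemma ipts_ball: "p \<in> ipts r \<Longrightarrow> p \<in> ball 0 r"
  by (simp add: ipts_def)

lemma zero_ipts: "0 \<in> ipts r"
  using r by (simp add: ipts_def)

lemma chol_DX: "chol (DD k (Xc j)) (ball 0 r)"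
  by (rule chol_pd[OF X open_ball])

lemma chol_DDX: "chol (DD l (DD k (Xc j))) (ball 0 r)"
  by (rule chol_pd[OF chol_DX open_ball])

lemma DD_commute: "z \<in> ball 0 r \<Longrightarrow> DD l (DD k (Xc j)) z = DD k (DD l (Xc j)) z"
  by (rule pd_commute[OF X open_ball])

lemma DDD_commute: "z \<in> ball 0 r \<Longrightarrow> DD m (DD l (DD k (Xc j))) z = DD l (DD m (DD k (Xc j))) z"
  by (rule pd_commute[OF chol_DX open_ball])

lemma Re_X0: "p \<in> ipts r \<Longrightarrow> Re (Xc 0 p) = 0"
proof -
  assume p: "p \<in> ipts r"
  have rc0: "rc p = (\<lambda>i. 0)" using p by (auto simp: rc_def ipts_def)
  have "hyp_poly n (\<lambda>i. 0) = 0" "d_hyp_poly n (\<lambda>i. 0) v = 0" for v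
    unfolding hyp_poly_def d_hyp_poly_def by (auto intro!: sum.neutral)
  then have "p \<in> M_hyp n c f" using f(2) by (simp add: mem_M_hyp rc0)
  then have "rc (X p) 0 = deriv f (rc p 1) * rc (X p) 1 + d_hyp_poly n (rc p) (rc (X p))"
    using tang ipts_ball[OF p] unfolding tang_def by blast
  then have "rc (X p) 0 = 0" unfolding rc0 using f(3) \<open>\<And>v. d_hyp_poly n (\<lambda>i. 0) v = 0\<close> by simp
  then show ?thesis by (simp add: rc_def)
qed

lemma Im_DX0: "p \<in> ipts r \<Longrightarrow> D 0 k p = 0"
  by (rule Im_pd_zero[OF X Re_X0])

lemma Re_DDX0: "p \<in> ipts r \<Longrightarrow> B 0 k l p = 0"
  by (rule Re_pd_zero[OF chol_DX Im_DX0])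

text \<open>Together with \<open>Im_DX0\<close>, the first-order equation expresses the derivatives
  of \<open>X_0\<close> in \<open>z_1, ..., z_n\<close> by the real parts of the other components,
  in reversed order.\<close>

lemma Re_DX0:
  assumes "p \<in> ipts r"
  shows "k \<in> {1..<n} \<Longrightarrow> A 0 k p = 2 * Re (Xc (n - k) p)" and "A 0 n p = 0"
proof -
  have "lin n (\<lambda>k. A 0 k p + (-1) * (if k < n then 2 * Re (Xc (n - k) p) else 0)) \<xi> = 0" for \<xi>
  proof -
    have "(\<Sum>k\<in>{1..n}. \<xi> k * A 0 k p) = conv_sum n (\<lambda>j k. \<xi> k * (2 * Re (Xc j p)))"
      using tangency_equations(1)[OF f X tang assms, of \<xi>] by (simp add: mult.left_commute mult.assoc)
    then have "lin n (\<lambda>k. A 0 k p) \<xi> = lin n (\<lambda>k. if k < n then 2 * Re (Xc (n - k) p) else 0) \<xi>"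
      by (subst (asm) conv_sum_lin[of n n]) (simp_all add: lin_def mult.commute)
    then show ?thesis unfolding lin_plus[symmetric] lin_cmult[symmetric] by simp
  qed
  from lin_zero[OF this] have *: "k \<in> {1..n} \<Longrightarrow> A 0 k p = (if k < n then 2 * Re (Xc (n - k) p) else 0)" for k
    by fastforce
  show "k \<in> {1..<n} \<Longrightarrow> A 0 k p = 2 * Re (Xc (n - k) p)" using *[of k] by simp
  show "A 0 n p = 0" using *[of n] n4 by simp
qed

lemma DnX0: "z \<in> ball 0 r \<Longrightarrow> DD n (Xc 0) z = 0"
proof (rule zero_on_ipts_imp_zero[OF chol_DX])
  fix p :: "complex ^ 'm" assume "p \<in> ipts r"
  then show "DD n (Xc 0) p = 0" using Im_DX0 Re_DX0(2) by (simp add: complex_eq_iff)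
qed

lemma DDnX0: "z \<in> ball 0 r \<Longrightarrow> DD l (DD n (Xc 0)) z = 0"
  using pd_cong[OF open_ball, of z 0 r "DD n (Xc 0)" "\<lambda>_. 0" "c l"] DnX0 by simp

lemma Im_DDX0:
  assumes "p \<in> ipts r" "k \<in> {1..<n}"
  shows "N 0 k l p = 2 * D (n - k) l p"
  using Im_pd_relation[OF chol_DX[where k = k and j = 0] X[of "c (n - k)"] X[of "c 0"] X[of "c 0"] X[of "c 0"], of 2 0 0 0 p "c l"]
    Re_DX0(1) assms by simp

lemma Re_DDDX0:
  assumes p: "p \<in> ipts r" and k: "k \<in> {1..<n}"
  shows "Re (DD m (DD l (DD k (Xc 0))) p) = 2 * B (n - k) l m p"
proof -
  let ?G = "\<lambda>z. DD l (DD k (Xc 0)) z - 2 * DD l (Xc (n - k)) z"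
  have "Re (pd (c m) ?G p) = 0"
    by (rule Re_pd_zero[OF chol_diff[OF chol_DDX chol_cmult[OF chol_DX]] _ p]) (use Im_DDX0 k in simp)
  moreover have "pd (c m) ?G p = DD m (DD l (DD k (Xc 0))) p - 2 * DD m (DD l (Xc (n - k))) p"
    using pd_diff[OF chol_DDX chol_cmult[OF chol_DX] ipts_ball[OF p]] pd_cmult[OF chol_DX ipts_ball[OF p]] by simp
  ultimately show ?thesis by simp
qed

text \<open>Up to the factor 2, \<open>B j k l\<close> is the real part of a third derivative of
  \<open>X_0\<close>, and \<open>X_0\<close> does not depend on \<open>z_n\<close>. This supplies
  the hypothesis \<open>B\<close> of \<open>first_order_system\<close>.\<close>

lemma B_n_zero:
  assumes p: "p \<in> ipts r" and "j \<in> {1..<n}" "k = n \<or> l = n"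
  shows "B j k l p = 0"
proof -
  have j: "n - j \<in> {1..<n}" "n - (n - j) = j" using assms(2) by auto
  have Z: "DD n (DD i (Xc 0)) z = 0" if "z \<in> ball 0 r" for i z
    using DD_commute[OF that, of n i 0] DDnX0[OF that] by simp
  have "Re (DD l (DD k (DD (n - j) (Xc 0))) p) = 0"
    using assms(3)
  proof
    assume [simp]: "k = n"
    have "DD l (DD n (DD (n - j) (Xc 0))) p = DD l (\<lambda>_. 0) p"
      by (rule pd_cong[OF open_ball ipts_ball[OF p] Z])
    then show ?thesis by simp
  next
    assume [simp]: "l = n"
    have "DD n (DD k (DD (n - j) (Xc 0))) p = DD k (DD n (DD (n - j) (Xc 0))) p"
      by (rule DDD_commute[OF ipts_ball[OF p]])
    also have "\<dots> = DD k (\<lambda>_. 0) p"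
      by (rule pd_cong[OF open_ball ipts_ball[OF p] Z])
    finally show ?thesis by simp
  qed
  then show ?thesis using Re_DDDX0[OF p j(1), of l k] j(2) by simp
qed

lemma second_order_at:
  assumes "p \<in> ipts r"
  shows "second_order n f3 (\<lambda>j. Re (Xc j p)) (\<lambda>j k. A j k p)"
  unfolding second_order_def
proof
  fix \<xi>
  note E = tangency_equations(2)[OF f X tang assms, of \<xi>]
  have 1: "(\<Sum>k\<in>{1..n}. \<xi> k * (\<Sum>l\<in>{1..n}. \<xi> l * B 0 k l p)) = 0"
    using Re_DDX0[OF assms] by simp
  have 2: "conv_sum n (\<lambda>j k. 2 * \<xi> k * (\<Sum>l\<in>{1..n}. \<xi> l * A j l p)) = 2 * conv_sum n (\<lambda>j k. \<xi> k * lin n (\<lambda>k. A j k p) \<xi>)"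
    unfolding conv_sum_cmult lin_def by (simp add: mult_ac)
  have 3: "conv_sum (n - 1) (\<lambda>j k. 2 * \<xi> n * \<xi> k * Re (Xc j p) + \<xi> j * \<xi> k * Re (Xc n p))
    = 2 * \<xi> n * conv_sum (n - 1) (\<lambda>j k. \<xi> k * Re (Xc j p)) + Re (Xc n p) * conv_sum (n - 1) (\<lambda>j k. \<xi> j * \<xi> k)"
    unfolding conv_sum_cmult unfolding conv_sum_def by (simp add: sum.distrib split_beta mult_ac)
  show "conv_sum n (\<lambda>j k. \<xi> j * \<xi> k) * A 0 0 p = f3 * (\<xi> 1)\<^sup>2 * Re (Xc 1 p) + 2 * conv_sum n (\<lambda>j k. \<xi> k * lin n (\<lambda>k. A j k p) \<xi>)
    + (2 * \<xi> n * conv_sum (n - 1) (\<lambda>j k. \<xi> k * Re (Xc j p)) + Re (Xc n p) * conv_sum (n - 1) (\<lambda>j k. \<xi> j * \<xi> k))"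
    using E unfolding 1 2 3 f3_def by simp
qed

text \<open>Third derivatives of \<open>X_0\<close> are traded for second derivatives of the other
  components by \<open>Re_DDDX0\<close>, and its second derivatives drop out because they are purely
  imaginary.\<close>

lemma third_order_at:
  assumes p: "p \<in> ipts r"
  shows "third_order n f3 f4 (\<lambda>j. Re (Xc j p)) (\<lambda>j k. A j k p) (\<lambda>j k l. B j k l p)"
  unfolding third_order_def
proof
  fix \<xi>
  note E = tangency_equations(3)[OF f X tang assms, of \<xi>]
  have bil: "bil n (\<lambda>k l. B j k l p) \<xi> \<xi> = (\<Sum>l\<in>{1..n}. \<xi> l * (\<Sum>m\<in>{1..n}. \<xi> m * B j l m p))" for j
    unfolding bil_def by (simp add: sum_distrib_left mult_ac)
  have 1: "(\<Sum>k\<in>{1..n}. \<xi> k * (\<Sum>l\<in>{1..n}. \<xi> l * (\<Sum>m\<in>{1..n}. \<xi> m * Re (DD m (DD l (DD k (Xc 0))) p))))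
    = 2 * conv_sum n (\<lambda>j k. \<xi> k * bil n (\<lambda>k l. B j k l p) \<xi> \<xi>)"
  proof -
    have Z: "Re (DD m (DD l (DD n (Xc 0))) p) = 0" for l m
      using pd_cong[OF open_ball ipts_ball[OF p], of "DD l (DD n (Xc 0))" "\<lambda>_. 0" "c m"] DDnX0 by simp
    have "(\<Sum>k\<in>{1..n}. \<xi> k * (\<Sum>l\<in>{1..n}. \<xi> l * (\<Sum>m\<in>{1..n}. \<xi> m * Re (DD m (DD l (DD k (Xc 0))) p))))
      = (\<Sum>k\<in>{1..n}. (if k < n then 2 * bil n (\<lambda>a b. B (n - k) a b p) \<xi> \<xi> else 0) * \<xi> k)"
    proof (rule sum.cong[OF refl])
      fix k assume k: "k \<in> {1..n}"
      show "\<xi> k * (\<Sum>l\<in>{1..n}. \<xi> l * (\<Sum>m\<in>{1..n}. \<xi> m * Re (DD m (DD l (DD k (Xc 0))) p)))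
        = (if k < n then 2 * bil n (\<lambda>a b. B (n - k) a b p) \<xi> \<xi> else 0) * \<xi> k"
      proof (cases "k = n")
        case True
        then show ?thesis by (simp add: Z)
      next
        case False
        then have "k \<in> {1..<n}" using k by auto
        then show ?thesis unfolding Re_DDDX0[OF p \<open>k \<in> {1..<n}\<close>] bil
          by (simp add: sum_distrib_left mult_ac)
      qed
    qed
    also have "\<dots> = conv_sum n (\<lambda>j k. \<xi> k * (2 * bil n (\<lambda>k l. B j k l p) \<xi> \<xi>))"
      by (subst conv_sum_lin[of n n]) (simp_all add: lin_def)
    finally show ?thesis unfolding conv_sum_cmult by (simp add: mult_ac)
  qed
  have 2: "(\<Sum>k\<in>{1..n}. \<xi> k * B 0 0 k p) = 0" using Re_DDX0[OF p] by simp
  have 3: "(\<Sum>l\<in>{1..n}. \<xi> l * A j l p) = lin n (\<lambda>k. A j k p) \<xi>" for j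
    unfolding lin_def by (simp add: mult_ac)
  have 4: "conv_sum n (\<lambda>j k. 2 * \<xi> k * ((\<Sum>l\<in>{1..n}. \<xi> l * (\<Sum>m\<in>{1..n}. \<xi> m * B j l m p)) / 2 + conv_sum n (\<lambda>j k. \<xi> j * \<xi> k) * A j 0 p))
    = conv_sum n (\<lambda>j k. \<xi> k * bil n (\<lambda>k l. B j k l p) \<xi> \<xi>) + 2 * conv_sum n (\<lambda>j k. \<xi> j * \<xi> k) * conv_sum n (\<lambda>j k. \<xi> k * A j 0 p)"
    unfolding bil[symmetric] by (rule conv_sum_split)
  have 5: "conv_sum (n - 1) (\<lambda>j k. 2 * \<xi> n * \<xi> k * lin n (\<lambda>k. A j k p) \<xi> + \<xi> j * \<xi> k * lin n (\<lambda>k. A n k p) \<xi>)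
    = 2 * \<xi> n * conv_sum (n - 1) (\<lambda>j k. \<xi> k * lin n (\<lambda>k. A j k p) \<xi>) + lin n (\<lambda>k. A n k p) \<xi> * conv_sum (n - 1) (\<lambda>j k. \<xi> j * \<xi> k)"
    unfolding conv_sum_cmult unfolding conv_sum_def by (simp add: sum.distrib split_beta mult_ac)
  have 6: "conv_sum (n - 2) (\<lambda>j k. 2 * (\<xi> n)\<^sup>2 * \<xi> k * Re (Xc j p) + 2 * \<xi> n * \<xi> j * \<xi> k * Re (Xc n p))
    = 2 * (\<xi> n)\<^sup>2 * conv_sum (n - 2) (\<lambda>j k. \<xi> k * Re (Xc j p)) + 2 * Re (Xc n p) * \<xi> n * conv_sum (n - 2) (\<lambda>j k. \<xi> j * \<xi> k)"
    unfolding conv_sum_cmult unfolding conv_sum_def by (simp add: sum.distrib split_beta mult_ac)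
  show "(\<xi> n * conv_sum (n - 1) (\<lambda>j k. \<xi> j * \<xi> k) + f3 / 3 * \<xi> 1 ^ 3) * A 0 0 p
      = 2 / 3 * conv_sum n (\<lambda>j k. \<xi> k * bil n (\<lambda>k l. B j k l p) \<xi> \<xi>) + f3 * (\<xi> 1)\<^sup>2 * lin n (\<lambda>k. A 1 k p) \<xi> + f4 * \<xi> 1 ^ 3 * Re (Xc 1 p)
        + 2 * conv_sum n (\<lambda>j k. \<xi> j * \<xi> k) * conv_sum n (\<lambda>j k. \<xi> k * A j 0 p)
        + (2 * \<xi> n * conv_sum (n - 1) (\<lambda>j k. \<xi> k * lin n (\<lambda>k. A j k p) \<xi>) + conv_sum (n - 1) (\<lambda>j k. \<xi> j * \<xi> k) * lin n (\<lambda>k. A n k p) \<xi>)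
        + (2 * (\<xi> n)\<^sup>2 * conv_sum (n - 2) (\<lambda>j k. \<xi> k * Re (Xc j p)) + 2 * Re (Xc n p) * \<xi> n * conv_sum (n - 2) (\<lambda>j k. \<xi> j * \<xi> k))"
    using E unfolding 1 2 3 4 5 6 f3_def f4_def by (simp add: algebra_simps)
qed

lemma first_derivatives:
  assumes p: "p \<in> ipts r"
  shows "j \<in> {2..<n} \<Longrightarrow> A j n p = - Re (Xc (j - 1) p)" and "A 1 n p = 0"
    and "A 0 0 p = 2 * (A 1 1 p - A n n p) + real n * A n n p"
    and "i \<in> {1..<n} \<Longrightarrow> j \<in> {1..<n} \<Longrightarrow> A j i p = (if i = j then A 1 1 p - A n n p + real i * A n n p else 0)
      + (if j = i + 1 then (real i - real n / 2) * Re (Xc n p) else 0) - (if i = 1 \<and> j = n - 1 then f3 / 2 * Re (Xc 1 p) else 0)"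
  using first_order_system[OF n4 second_order_at[OF p] third_order_at[OF p] B_n_zero[OF p]] by blast+

text \<open>The relations of \<open>first_derivatives\<close> hold at all imaginary points, hence
  can be differentiated by \<open>Im_pd_relation\<close>. The result is the system of
  \<open>second_derivative_system\<close>, with \<open>N 1 1 l p - N n n l p\<close> as
  \<open>m l\<close> and \<open>N n n l p\<close> as \<open>\<kappa> l\<close>.\<close>

lemma second_derivatives:
  assumes p: "p \<in> ipts r" and l: "l \<le> n"
  shows "k \<in> {1..<n} \<Longrightarrow> N 0 k l p = 2 * D (n - k) l p" and "N 0 n l p = 0"
    and "j \<in> {2..<n} \<Longrightarrow> N j n l p = - D (j - 1) l p" and "N 1 n l p = 0"
    and "N 0 0 l p = 2 * (N 1 1 l p - N n n l p) + real n * N n n l p"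
    and "i \<in> {1..<n} \<Longrightarrow> j \<in> {1..<n} \<Longrightarrow> N j i l p = (if i = j then N 1 1 l p - N n n l p + real i * N n n l p else 0)
      + (if j = i + 1 then (real i - real n / 2) * D n l p else 0) - (if i = 1 \<and> j = n - 1 then f3 / 2 * D 1 l p else 0)"
proof -
  show "k \<in> {1..<n} \<Longrightarrow> N 0 k l p = 2 * D (n - k) l p" by (rule Im_DDX0[OF p])
  show "N 0 n l p = 0" using DDnX0[OF ipts_ball[OF p]] by simp
  show "N j n l p = - D (j - 1) l p" if "j \<in> {2..<n}"
    using Im_pd_relation[OF chol_DX[where k = n and j = j] X[of "c (j - 1)"] X[of "c 0"] X[of "c 0"] X[of "c 0"], of "-1" 0 0 0 p "c l"]
      first_derivatives(1) that p by simp
  show "N 1 n l p = 0"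
    using Im_pd_zero[OF chol_DX[where k = n and j = 1] first_derivatives(2) p] .
  show "N 0 0 l p = 2 * (N 1 1 l p - N n n l p) + real n * N n n l p"
    using Im_pd_relation[OF chol_DX[where k = 0 and j = 0] chol_DX[where k = 1 and j = 1] chol_DX[where k = n and j = n] X[of "c 0"] X[of "c 0"],
        of 2 "real n - 2" 0 0 p "c l"] first_derivatives(3) p by (simp add: algebra_simps)
  show "N j i l p = (if i = j then N 1 1 l p - N n n l p + real i * N n n l p else 0)
      + (if j = i + 1 then (real i - real n / 2) * D n l p else 0) - (if i = 1 \<and> j = n - 1 then f3 / 2 * D 1 l p else 0)"
    if "i \<in> {1..<n}" "j \<in> {1..<n}"
  proof -
    let ?a1 = "if i = j then 1 else 0 :: real" and ?a2 = "if i = j then real i - 1 else 0 :: real"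
      and ?a3 = "if j = i + 1 then real i - real n / 2 else 0 :: real" and ?a4 = "if i = 1 \<and> j = n - 1 then - f3 / 2 else 0 :: real"
    have "A j i p = ?a1 * A 1 1 p + ?a2 * A n n p + ?a3 * Re (Xc n p) + ?a4 * Re (Xc 1 p)" if "p \<in> ipts r" for p
      unfolding first_derivatives(4)[OF that \<open>i \<in> {1..<n}\<close> \<open>j \<in> {1..<n}\<close>] by (simp add: algebra_simps)
    from Im_pd_relation[OF chol_DX chol_DX chol_DX X X this p]
    have "N j i l p = ?a1 * N 1 1 l p + ?a2 * N n n l p + ?a3 * D n l p + ?a4 * D 1 l p" by blast
    then show ?thesis by (simp add: algebra_simps)
  qed
qed

lemma second_derivatives_vanish:
  assumes p: "p \<in> ipts r"
  shows "j \<in> {1..<n-1} \<Longrightarrow> l \<le> n \<Longrightarrow> D j l p = 0"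
    and "l \<le> n \<Longrightarrow> l \<noteq> 1 \<Longrightarrow> D (n - 1) l p = 0"
    and "l \<in> {1..n} \<Longrightarrow> N 1 1 l p - N n n l p = 0" "l \<in> {1..n} \<Longrightarrow> N n n l p = 0" "l \<in> {1..n} \<Longrightarrow> D n l p = 0"
proof -
  have sym: "N j k l p = N j l k p" for j k l using DD_commute[OF ipts_ball[OF p]] by simp
  note S = second_derivative_system[OF n4, of "\<lambda>j k l. N j k l p" "\<lambda>j k. D j k p"
    "\<lambda>l. N 1 1 l p - N n n l p" "\<lambda>l. N n n l p" f3, OF sym second_derivatives[OF p]]
  show "j \<in> {1..<n-1} \<Longrightarrow> l \<le> n \<Longrightarrow> D j l p = 0" by (rule S(1))
  show "l \<le> n \<Longrightarrow> l \<noteq> 1 \<Longrightarrow> D (n - 1) l p = 0" by (rule S(2))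
  show "l \<in> {1..n} \<Longrightarrow> N 1 1 l p - N n n l p = 0" by (rule S(3))
  show "l \<in> {1..n} \<Longrightarrow> N n n l p = 0" by (rule S(4))
  show "l \<in> {1..n} \<Longrightarrow> D n l p = 0" by (rule S(5))
qed

lemma cubic_at:
  assumes p: "p \<in> ipts r"
  shows "j \<in> {1..<n} \<Longrightarrow> A j 0 p = 0" and "i \<in> {1..<n} \<Longrightarrow> A n i p = 0"
    and "2 * B (n - 1) 1 1 p = f3 * A 0 0 p - 3 * f3 * A 1 1 p - 3 * f4 * Re (Xc 1 p)"
proof -
  \<comment> \<open>The vanishing of \<open>D\<close> on all imaginary points passes to the real
    parts of its derivatives. In component \<open>n - 1\<close>, a first index 1 is exchanged with
    the second one, which works unless both are 1.\<close>
  have B: "B j k l p = 0" if j: "j \<in> {1..<n}" "k \<in> {1..<n}" "l \<in> {1..<n}" "\<not> (j = n - 1 \<and> k = 1 \<and> l = 1)" for j k l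
  proof (cases "j = n - 1")
    case True
    show ?thesis
    proof (cases "k = 1")
      case False
      then show ?thesis unfolding True using j(2)
        by (intro Re_pd_zero[OF chol_DX second_derivatives_vanish(2) p]) auto
    next
      case k: True
      then have "l \<noteq> 1" using j True by simp
      then have "B (n - 1) l 1 p = 0" using j(3)
        by (intro Re_pd_zero[OF chol_DX second_derivatives_vanish(2) p]) auto
      then show ?thesis unfolding True k using DD_commute[OF ipts_ball[OF p], of l 1 "n - 1"] by simp
    qed
  next
    case False
    then have "j \<in> {1..<n-1}" "k \<le> n" using j by auto
    then show ?thesis by (intro Re_pd_zero[OF chol_DX second_derivatives_vanish(1) p])
  qed
  have a1: "A 1 i p = 0" if "i \<in> {2..<n}" for i
  proof -
    have "i \<in> {1..<n}" "1 \<in> {1..<n}" using that by auto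
    from first_derivatives(4)[OF p this] show ?thesis using that n4 by simp
  qed
  note C = cubic_system[OF n4 third_order_at[OF p] B a1]
  show "j \<in> {1..<n} \<Longrightarrow> A j 0 p = 0" by (rule C(1))
  show "i \<in> {1..<n} \<Longrightarrow> A n i p = 0" by (rule C(2))
  show "2 * B (n - 1) 1 1 p = f3 * A 0 0 p - 3 * f3 * A 1 1 p - 3 * f4 * Re (Xc 1 p)" by (rule C(3))
qed

text \<open>The direction \<open>z_0\<close>, left open for \<open>m\<close>,
  \<open>\<kappa>\<close> and \<open>D n\<close> by \<open>second_derivative_system\<close>, follows
  from the third order: \<open>A j 0\<close> vanishes by \<open>cubic_at\<close>, hence so do
  \<open>N j 0 i\<close> and, by symmetry, \<open>N j i 0\<close>. The entries
  \<open>(1, 1)\<close>, \<open>(2, 2)\<close> and \<open>(1, 2)\<close> then give the three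
  unknowns.\<close>

lemma second_derivatives_vanish_0:
  assumes p: "p \<in> ipts r"
  shows "N 1 1 0 p = 0" "N n n 0 p = 0" "D n 0 p = 0"
proof -
  have D1: "D 1 0 p = 0" by (rule second_derivatives_vanish(1)[OF p]) (use n4 in auto)
  have Z: "N j i 0 p = 0" if "j \<in> {1..<n}" for i j
  proof -
    have "N j 0 i p = 0" by (rule Im_pd_zero[OF chol_DX cubic_at(1) p]) (use that in auto)
    then show ?thesis using DD_commute[OF ipts_ball[OF p], of 0 i j] by simp
  qed
  have I: "1 \<in> {1..<n}" "2 \<in> {1..<n}" using n4 by auto
  show m: "N 1 1 0 p = 0" by (rule Z[OF I(1)])
  show "N n n 0 p = 0" using second_derivatives(6)[OF p, of 0 2 2] Z[OF I(2), of 2] I m n4 by simp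
  have "2 \<noteq> n - 1" using n4 by auto
  then show "D n 0 p = 0" using second_derivatives(6)[OF p, of 0 1 2] Z[OF I(2), of 1] I D1 n4 by simp
qed

lemma N_vanish:
  assumes p: "p \<in> ipts r" and l: "l \<le> n"
  shows "N 1 1 l p = 0" "N n n l p = 0" "D n l p = 0"
  using second_derivatives_vanish(3-5)[OF p, of l] second_derivatives_vanish_0[OF p] l
  by (cases "l = 0"; simp)+

lemma D_vanish:
  assumes p: "p \<in> ipts r" and l: "l \<le> n"
  shows "j \<in> {1..<n-1} \<Longrightarrow> D j l p = 0" "l \<noteq> 1 \<Longrightarrow> D (n - 1) l p = 0"
  using second_derivatives_vanish(1)[OF p _ l] second_derivatives_vanish(2)[OF p l] by blast+

lemma c_surj: obtains l where "l \<le> n" "k = c l"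
  using bij that unfolding bij_betw_def by (metis UNIV_I atLeastAtMost_iff imageE)

lemma const_if_DD_zero:
  assumes "chol G (ball 0 r)" "\<And>l p. l \<le> n \<Longrightarrow> p \<in> ipts r \<Longrightarrow> DD l G p = 0" "z \<in> ball 0 r"
  shows "G z = G 0"
  by (rule const_if_pd_zero[OF assms(1) r _ assms(3)]) (metis c_surj assms(2))

end

context indexed
begin

text \<open>The factors \<open>j - 1 - n/2\<close> make the field with parameter \<open>be n\<close>, a translation in \<open>z\<^sub>n\<close> up to linear
  terms, tangent to the polynomial part of the hypersurface.\<close>

definition Xpar :: "(nat \<Rightarrow> real) \<Rightarrow> (nat \<Rightarrow> real) \<Rightarrow> real \<Rightarrow> real \<Rightarrow> real \<Rightarrow> real \<Rightarrow> real \<Rightarrow> real \<Rightarrow> complex ^ 'm \<Rightarrow> nat \<Rightarrow> complex" where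
  "Xpar al be a b q2 q3 r0 p0 z j =
    (if j = 0 then \<i> * al 0 + p0 + (\<Sum>k\<in>{1..<n}. 2 * be k * z $ c (n - k)) + r0 * z $ c 1
        + \<i> * be 0 * (z $ c 1)\<^sup>2 + 2 / 3 * q3 * (z $ c 1) ^ 3 + (2 * a + real n * b) * z $ c 0
     else if j = n then \<i> * al n + be n + b * z $ c n
     else \<i> * al j + be j + (a + real j * b) * z $ c j
       + (if 2 \<le> j then - be (j - 1) * z $ c n + (real j - 1 - n / 2) * be n * z $ c (j - 1) else 0)
       + (if j = n - 1 then (\<i> * be 0 + q2) * z $ c 1 + q3 * (z $ c 1)\<^sup>2 else 0))"

end

section \<open>Integrating the derivatives to polynomial components\<close>

context tangent_field
begin

text \<open>Subtracting \<open>E\<close>, a primitive of the part depending on \<open>z_1\<close>,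
  leaves constant partial derivatives, to which \<open>affine_if_pd_const\<close> applies.\<close>

lemma poly_from_pd:
  assumes "chol G (ball 0 r)"
    and "\<And>l p. l \<le> n \<Longrightarrow> p \<in> ipts r \<Longrightarrow> DD l G p = \<kappa> l + (if l = 1 then s * p $ c 1 + t * (p $ c 1)\<^sup>2 else 0)"
    and "z \<in> ball 0 r"
  shows "G z = G 0 + (\<Sum>l\<in>{0..n}. \<kappa> l * z $ c l) + s / 2 * (z $ c 1)\<^sup>2 + t / 3 * (z $ c 1) ^ 3"
proof -
  define E where "E = (\<lambda>z :: complex ^ 'm. s / 2 * (z $ c 1 * z $ c 1) + t / 3 * (z $ c 1 * (z $ c 1 * z $ c 1)))"
  have E: "chol E (ball 0 r)"
    unfolding E_def by (intro chol_add chol_cmult chol_mult chol_nth)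
  have pE: "DD l E p = (if l = 1 then s * p $ c 1 + t * (p $ c 1)\<^sup>2 else 0)" if "l \<le> n" "p \<in> ball 0 r" for l p
  proof -
    have "DD l (\<lambda>z. z $ c 1) p = (if l = 1 then 1 else 0)"
      unfolding pd_nth using that n4 by (simp add: c_eq_iff)
    moreover have "DD l E p = s / 2 * (DD l (\<lambda>z. z $ c 1) p * p $ c 1 + p $ c 1 * DD l (\<lambda>z. z $ c 1) p)
      + t / 3 * (DD l (\<lambda>z. z $ c 1) p * (p $ c 1 * p $ c 1) + p $ c 1 * (DD l (\<lambda>z. z $ c 1) p * p $ c 1 + p $ c 1 * DD l (\<lambda>z. z $ c 1) p))"
      unfolding E_def
      by (simp only: pd_add[OF _ _ that(2)] pd_cmult[OF _ that(2)] pd_mult[OF _ _ that(2)] chol_add chol_cmult chol_mult chol_nth)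
    ultimately show ?thesis by (simp add: power2_eq_square field_simps)
  qed
  define \<kappa>' where "\<kappa>' = (\<lambda>k. \<kappa> (the_inv_into {0..n} c k))"
  have k': "\<kappa>' (c l) = \<kappa> l" if "l \<le> n" for l
    unfolding \<kappa>'_def using that bij by (simp add: the_inv_into_f_f bij_betw_def)
  have "G z - E z = G 0 - E 0 + (\<Sum>k\<in>UNIV. \<kappa>' k * z $ k)"
  proof (rule affine_if_pd_const[OF chol_diff[OF assms(1) E] r _ assms(3)])
    fix k and p :: "complex ^ 'm" assume p: "p \<in> ipts r"
    obtain l where l: "l \<le> n" "k = c l" by (rule c_surj)
    show "pd k (\<lambda>z. G z - E z) p = \<kappa>' k"
      unfolding l(2) pd_diff[OF assms(1) E ipts_ball[OF p]] pE[OF l(1) ipts_ball[OF p]] assms(2)[OF l(1) p] k'[OF l(1)]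
      by simp
  qed
  moreover have "(\<Sum>k\<in>UNIV. \<kappa>' k * z $ k) = (\<Sum>l\<in>{0..n}. \<kappa> l * z $ c l)"
    unfolding sum_c by (rule sum.cong) (auto simp: k')
  ultimately show ?thesis
    by (simp add: E_def power2_eq_square power3_eq_cube algebra_simps)
qed

lemma N_zero:
  assumes p: "p \<in> ipts r" and "j \<in> {1..<n}" "i \<le> n" "l \<le> n"
  shows "N j i l p = 0"
proof -
  have D1: "D 1 l p = 0" by (rule D_vanish(1)[OF p assms(4)]) (use n4 in auto)
  consider "i = 0" | "i = n" | "i \<in> {1..<n}" using assms(3) by fastforce
  then show ?thesis
  proof cases
    case 1
    have "N j 0 l p = 0" by (rule Im_pd_zero[OF chol_DX cubic_at(1)[OF _ assms(2)] p])
    then show ?thesis using 1 by simp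
  next
    case 2
    show ?thesis
    proof (cases "j = 1")
      case True
      then show ?thesis using 2 second_derivatives(4)[OF p assms(4)] by simp
    next
      case False
      then have "j \<in> {2..<n}" "j - 1 \<in> {1..<n-1}" using assms(2) by auto
      then show ?thesis using 2 second_derivatives(3)[OF p assms(4)] D_vanish(1)[OF p assms(4)] by simp
    qed
  next
    case 3
    show ?thesis
      unfolding second_derivatives(6)[OF p assms(4) 3 assms(2)] N_vanish[OF p assms(4)] D1 by simp
  qed
qed

lemma B_zero:
  assumes p: "p \<in> ipts r" and "j \<in> {1..<n}" "i \<le> n" "l \<le> n" "\<not> (j = n - 1 \<and> i = 1 \<and> l = 1)"
  shows "B j i l p = 0"
proof (cases "j = n - 1")
  case True
  show ?thesis
  proof (cases "i = 1")
    case False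
    then show ?thesis unfolding True using assms(3)
      by (intro Re_pd_zero[OF chol_DX D_vanish(2) p]) auto
  next
    case i: True
    then have "l \<noteq> 1" using assms True by simp
    then have "B (n - 1) l 1 p = 0" using assms(4)
      by (intro Re_pd_zero[OF chol_DX D_vanish(2) p]) auto
    then show ?thesis unfolding True i using DD_commute[OF ipts_ball[OF p], of l 1 "n - 1"] by simp
  qed
next
  case False
  then have "j \<in> {1..<n-1}" using assms(2) by auto
  then show ?thesis using assms(3) by (intro Re_pd_zero[OF chol_DX D_vanish(1) p])
qed

lemma DD_const:
  assumes "j \<in> {1..<n}" "i \<le> n" "\<not> (j = n - 1 \<and> i = 1)" "z \<in> ball 0 r"
  shows "DD i (Xc j) z = DD i (Xc j) 0"
proof (rule const_if_DD_zero[OF chol_DX _ assms(4)])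
  fix l and p :: "complex ^ 'm" assume "l \<le> n" "p \<in> ipts r"
  then show "DD l (DD i (Xc j)) p = 0"
    using N_zero[of p j i l] B_zero[of p j i l, OF _ assms(1,2) \<open>l \<le> n\<close>] assms(1-3) by (auto simp: complex_eq_iff)
qed

text \<open>The derivative with respect to \<open>z_0\<close> is missing: \<open>A n 0\<close>
  occurs in none of the equations up to third order. \<open>X_last\<close> supplies it.\<close>

lemma DD_Xn:
  assumes "z \<in> ball 0 r"
  shows "i \<in> {1..<n} \<Longrightarrow> DD i (Xc n) z = 0" and "DD n (Xc n) z = of_real (A n n 0)"
proof -
  show "DD i (Xc n) z = 0" if "i \<in> {1..<n}"
    by (rule zero_on_ipts_imp_zero[OF chol_DX _ assms])
       (use that cubic_at(2) N_vanish(3) in \<open>auto simp: complex_eq_iff\<close>)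
  have "DD n (Xc n) z = DD n (Xc n) 0"
  proof (rule const_if_DD_zero[OF chol_DX _ assms])
    fix l and p :: "complex ^ 'm" assume l: "l \<le> n" and p: "p \<in> ipts r"
    have "B n n l p = 0" by (rule Re_pd_zero[OF chol_DX N_vanish(3) p]) auto
    then show "DD l (DD n (Xc n)) p = 0"
      using N_vanish(2)[OF p l] by (simp add: complex_eq_iff)
  qed
  then show "DD n (Xc n) z = of_real (A n n 0)"
    using N_vanish(3)[OF zero_ipts, of n] by (simp add: complex_eq_iff)
qed

text \<open>The parameters of \<open>Xpar\<close>, read off at 0. The slot \<open>be 0\<close> is
  free because \<open>Re (Xc 0 0) = 0\<close>; it stores the \<open>z_1\<close>-derivative of
  component \<open>n - 1\<close>, whose imaginary part is the only one among the first derivatives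
  that is not forced to vanish.\<close>

abbreviation (input) "al \<equiv> \<lambda>j. Im (Xc j 0)"
abbreviation (input) "be \<equiv> \<lambda>j. if j = 0 then D (n - 1) 1 0 else Re (Xc j 0)"
abbreviation (input) "a0 \<equiv> A 1 1 0 - A n n 0"
abbreviation (input) "b0 \<equiv> A n n 0"
abbreviation (input) "q2 \<equiv> - f3 / 2 * Re (Xc 1 0)"
abbreviation (input) "q3 \<equiv> B (n - 1) 1 1 0 / 2"

lemma sum_first_derivatives:
  fixes z :: "complex ^ 'm"
  assumes "j \<in> {1..<n}"
  shows "(\<Sum>k\<in>{0..n}. of_real (A j k 0) * z $ c k) = (a0 + real j * b0) * z $ c j
    + (if 2 \<le> j then - be (j - 1) * z $ c n + (real j - 1 - n / 2) * be n * z $ c (j - 1) else 0)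
    + (if j = n - 1 then q2 * z $ c 1 else 0)"
proof -
  have "of_real (A j k 0) * z $ c k = (if k = j then (a0 + real j * b0) * z $ c j else 0)
    + (if k = n then if 2 \<le> j then - be (j - 1) * z $ c n else 0 else 0)
    + (if k = j - 1 then if 2 \<le> j then (real j - 1 - n / 2) * be n * z $ c (j - 1) else 0 else 0)
    + (if k = 1 then if j = n - 1 then q2 * z $ c 1 else 0 else 0)" if "k \<le> n" for k
  proof -
    have "k = 0 \<or> k = n \<or> k \<in> {1..<n}" using that by auto
    then consider "k = 0" | "k = n" | "k \<in> {1..<n}" by blast
    then show ?thesis
    proof cases
      case 1
      then show ?thesis using cubic_at(1)[OF zero_ipts assms] assms n4 by auto
    next
      case 2
      have "n \<noteq> j" "n \<noteq> j - 1" "n \<noteq> 1" using assms n4 by auto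
      moreover have "A j n 0 = (if 2 \<le> j then - be (j - 1) else 0)"
        using first_derivatives(1)[OF zero_ipts, of j] first_derivatives(2)[OF zero_ipts] assms
        by (cases "j = 1") auto
      ultimately show ?thesis unfolding 2 by simp
    next
      case 3
      have "j = k + 1 \<longleftrightarrow> k = j - 1 \<and> 2 \<le> j" "k \<noteq> n" "n \<noteq> 0" "Suc (Suc 0) \<noteq> n - Suc 0"
        using 3 assms n4 by auto
      then show ?thesis
        unfolding first_derivatives(4)[OF zero_ipts 3 assms] using assms
        by (auto simp: algebra_simps of_nat_diff)
    qed
  qed
  then have "(\<Sum>k\<in>{0..n}. of_real (A j k 0) * z $ c k) = (\<Sum>k\<in>{0..n}. (if k = j then (a0 + real j * b0) * z $ c j else 0)
    + (if k = n then if 2 \<le> j then - be (j - 1) * z $ c n else 0 else 0)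
    + (if k = j - 1 then if 2 \<le> j then (real j - 1 - n / 2) * be n * z $ c (j - 1) else 0 else 0)
    + (if k = 1 then if j = n - 1 then q2 * z $ c 1 else 0 else 0))"
    by (intro sum.cong) auto
  also have "\<dots> = (a0 + real j * b0) * z $ c j
    + (if 2 \<le> j then - be (j - 1) * z $ c n + (real j - 1 - n / 2) * be n * z $ c (j - 1) else 0)
    + (if j = n - 1 then q2 * z $ c 1 else 0)"
  proof -
    have "j \<in> {0..n}" "n \<in> {0..n}" "j - 1 \<in> {0..n}" "1 \<in> {0..n}" using assms by auto
    then show ?thesis unfolding sum.distrib by (simp add: sum.delta')
  qed
  finally show ?thesis .
qed

lemma X_mid:
  assumes j: "j \<in> {1..<n}" and z: "z \<in> ball 0 r"
  shows "Xc j z = Xpar al be a0 b0 q2 q3 0 0 z j"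
proof (cases "j = n - 1")
  case False
  have "Xc j z = Xc j 0 + (\<Sum>l\<in>{0..n}. DD l (Xc j) 0 * z $ c l) + 0 / 2 * (z $ c 1)\<^sup>2 + 0 / 3 * (z $ c 1) ^ 3"
    by (rule poly_from_pd[OF X _ z]) (use DD_const[OF j] False ipts_ball in auto)
  moreover have "DD l (Xc j) 0 = of_real (A j l 0)" if "l \<le> n" for l
  proof -
    have "j \<in> {1..<n-1}" using j False by auto
    then show ?thesis using D_vanish(1)[OF zero_ipts that] by (simp add: complex_eq_iff)
  qed
  ultimately have "Xc j z = Xc j 0 + (\<Sum>l\<in>{0..n}. of_real (A j l 0) * z $ c l)"
    by simp
  then have "Xc j z = Xc j 0 + ((a0 + real j * b0) * z $ c j
    + (if 2 \<le> j then - be (j - 1) * z $ c n + (real j - 1 - n / 2) * be n * z $ c (j - 1) else 0)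
    + (if j = n - 1 then q2 * z $ c 1 else 0))"
    by (rule trans[OF _ arg_cong[where f = "(+) (Xc j 0)", OF sum_first_derivatives[OF j]]])
  moreover have "Xc j 0 = of_real (be j) + \<i> * al j" using j complex_eq[of "Xc j 0"] by simp
  moreover have "j \<noteq> 0" "j \<noteq> n" "n \<noteq> 0" using j by auto
  ultimately show ?thesis
    using False unfolding Xpar_def by (simp add: algebra_simps)
next
  case True
  have n1: "n - 1 \<in> {1..<n}" "1 \<le> n" using n4 by auto
  \<comment> \<open>The one second derivative of a middle component that may be nonzero. By
    \<open>cubic_at\<close> its real part is a real combination of quantities whose derivatives
    vanish, so \<open>H\<close> is constant and the component is quadratic in
    \<open>z_1\<close>.\<close>
  define H where "H = DD 1 (DD 1 (Xc (n - 1)))"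
  have H: "H z = H 0" if "z \<in> ball 0 r" for z
  proof (rule const_if_DD_zero[OF _ _ that])
    show "chol H (ball 0 r)" unfolding H_def by (rule chol_DDX)
    fix l and p :: "complex ^ 'm" assume l: "l \<le> n" and p: "p \<in> ipts r"
    have "Re (DD l H p) = 0"
      unfolding H_def by (rule Re_pd_zero[OF chol_DDX N_zero p]) (use n1 in auto)
    moreover have "Im (DD l H p) = 0"
    proof -
      have "Re (H p) = f3 / 2 * A 0 0 p + (- 3 / 2 * f3) * A 1 1 p + (- 3 / 2 * f4) * Re (Xc 1 p) + 0 * Re (Xc 1 p)" if "p \<in> ipts r" for p
        using cubic_at(3)[OF that] unfolding H_def by simp
      from Im_pd_relation[OF _ chol_DX chol_DX X X this p]
      have "Im (DD l H p) = f3 / 2 * N 0 0 l p + (- 3 / 2 * f3) * N 1 1 l p + (- 3 / 2 * f4) * D 1 l p + 0 * D 1 l p"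
        unfolding H_def using chol_DDX by blast
      moreover have "D 1 l p = 0" by (rule D_vanish(1)[OF p l]) (use n4 in auto)
      ultimately show ?thesis using second_derivatives(5)[OF p l] N_vanish[OF p l] by simp
    qed
    ultimately show "DD l H p = 0" by (simp add: complex_eq_iff)
  qed
  have H0: "H 0 = of_real (2 * q3)"
    unfolding H_def using N_zero[OF zero_ipts n1(1), of 1 1] n1 by (simp add: complex_eq_iff)
  have D1: "DD 1 (Xc (n - 1)) z = DD 1 (Xc (n - 1)) 0 + of_real (2 * q3) * z $ c 1" if "z \<in> ball 0 r" for z
  proof -
    have "DD 1 (Xc (n - 1)) z = DD 1 (Xc (n - 1)) 0 + (\<Sum>l\<in>{0..n}. of_real (if l = 1 then 2 * q3 else 0) * z $ c l)
      + 0 / 2 * (z $ c 1)\<^sup>2 + 0 / 3 * (z $ c 1) ^ 3"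
    proof (rule poly_from_pd[OF chol_DX _ that])
      fix l and p :: "complex ^ 'm" assume l: "l \<le> n" and p: "p \<in> ipts r"
      show "DD l (DD 1 (Xc (n - 1))) p = of_real (if l = 1 then 2 * q3 else 0) + (if l = 1 then 0 * p $ c 1 + 0 * (p $ c 1)\<^sup>2 else 0)"
      proof (cases "l = 1")
        case True
        then show ?thesis using H[OF ipts_ball[OF p]] H0 unfolding H_def by simp
      next
        case False
        then show ?thesis
          using N_zero[OF p n1(1), of 1 l] B_zero[OF p n1(1), of 1 l] n1 l by (simp add: complex_eq_iff)
      qed
    qed
    moreover have "(\<Sum>l\<in>{0..n}. of_real (if l = 1 then 2 * q3 else 0) * z $ c l) = of_real (2 * q3) * z $ c 1"
      using n1(2) by (simp add: if_distrib[of "\<lambda>x. x * _"] if_distrib[of complex_of_real] sum.delta' cong: if_cong)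
    ultimately show ?thesis by simp
  qed
  have "Xc (n - 1) z = Xc (n - 1) 0 + (\<Sum>l\<in>{0..n}. DD l (Xc (n - 1)) 0 * z $ c l) + of_real (2 * q3) / 2 * (z $ c 1)\<^sup>2 + 0 / 3 * (z $ c 1) ^ 3"
  proof (rule poly_from_pd[OF X _ z])
    fix l and p :: "complex ^ 'm" assume l: "l \<le> n" and p: "p \<in> ipts r"
    show "DD l (Xc (n - 1)) p = DD l (Xc (n - 1)) 0 + (if l = 1 then of_real (2 * q3) * p $ c 1 + 0 * (p $ c 1)\<^sup>2 else 0)"
      using D1[OF ipts_ball[OF p]] DD_const[OF n1(1) l _ ipts_ball[OF p]] by auto
  qed
  moreover have "(\<Sum>l\<in>{0..n}. DD l (Xc (n - 1)) 0 * z $ c l)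
    = (\<Sum>l\<in>{0..n}. of_real (A (n - 1) l 0) * z $ c l) + \<i> * be 0 * z $ c 1"
  proof -
    have "DD l (Xc (n - 1)) 0 * z $ c l = of_real (A (n - 1) l 0) * z $ c l + (if l = 1 then \<i> * be 0 * z $ c 1 else 0)" if "l \<le> n" for l
    proof -
      have "DD l (Xc (n - 1)) 0 = of_real (A (n - 1) l 0) + (if l = 1 then \<i> * be 0 else 0)"
        using D_vanish(2)[OF zero_ipts that] by (auto simp: complex_eq_iff)
      then have "DD l (Xc (n - 1)) 0 * z $ c l = (of_real (A (n - 1) l 0) + (if l = 1 then \<i> * be 0 else 0)) * z $ c l"
        by (rule arg_cong[where f = "\<lambda>x. x * z $ c l"])
      also have "\<dots> = of_real (A (n - 1) l 0) * z $ c l + (if l = 1 then \<i> * be 0 * z $ c 1 else 0)"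
        by (cases "l = 1") (simp_all add: distrib_right)
      finally show ?thesis .
    qed
    then have "(\<Sum>l\<in>{0..n}. DD l (Xc (n - 1)) 0 * z $ c l)
      = (\<Sum>l\<in>{0..n}. of_real (A (n - 1) l 0) * z $ c l + (if l = 1 then \<i> * be 0 * z $ c 1 else 0))"
      by (intro sum.cong) auto
    then show ?thesis using n1(2) by (simp add: sum.distrib sum.delta')
  qed
  moreover have "Xc (n - 1) 0 = of_real (be (n - 1)) + \<i> * al (n - 1)" using n4 complex_eq[of "Xc (n - 1) 0"] by simp
  ultimately have "Xc (n - 1) z = of_real (be (n - 1)) + \<i> * al (n - 1)
    + ((\<Sum>l\<in>{0..n}. of_real (A (n - 1) l 0) * z $ c l) + \<i> * be 0 * z $ c 1) + of_real q3 * (z $ c 1)\<^sup>2"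
    by simp
  moreover have "n - 1 \<noteq> n" "n - 1 \<noteq> 0" "2 \<le> n - 1" using n4 by auto
  ultimately show ?thesis
    unfolding True sum_first_derivatives[OF n1(1)] Xpar_def by (simp add: algebra_simps)
qed

text \<open>On the imaginary points \<open>\<i> * p $ c 1\<close> and the square of
  \<open>p $ c 1\<close> are real, so \<open>Re (Xc j p)\<close> is itself a polynomial there. This
  is the form in which \<open>X_zero\<close> integrates it.\<close>

lemma Re_X_mid:
  assumes j: "j \<in> {1..<n}" and p: "p \<in> ipts r"
  shows "of_real (Re (Xc j p)) = of_real (be j) + (if j = n - 1 then \<i> * be 0 * p $ c 1 + q3 * (p $ c 1)\<^sup>2 else 0)"
proof -
  have re: "Re (p $ k) = 0" for k using p by (simp add: ipts_def)
  show ?thesis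
    using j unfolding X_mid[OF j ipts_ball[OF p]] Xpar_def by (auto simp: complex_eq_iff re power2_eq_square)
qed

lemma X_zero:
  assumes z: "z \<in> ball 0 r"
  shows "Xc 0 z = Xpar al be a0 b0 q2 q3 0 0 z 0"
proof -
  define \<kappa> where "\<kappa> = (\<lambda>l. if l = 0 then 2 * a0 + real n * b0 else if l < n then 2 * be (n - l) else 0)"
  have "Xc 0 z = Xc 0 0 + (\<Sum>l\<in>{0..n}. of_real (\<kappa> l) * z $ c l) + (2 * (\<i> * of_real (be 0))) / 2 * (z $ c 1)\<^sup>2 + of_real (2 * q3) / 3 * (z $ c 1) ^ 3"
  proof (rule poly_from_pd[OF X _ z])
    fix l and p :: "complex ^ 'm" assume l: "l \<le> n" and p: "p \<in> ipts r"
    have im: "DD l (Xc 0) p = of_real (A 0 l p)" using Im_DX0[OF p] by (simp add: complex_eq_iff)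
    have "l = 0 \<or> l = n \<or> l \<in> {1..<n}" using l by auto
    then consider "l = 0" | "l = n" | "l \<in> {1..<n}" by blast
    then show "DD l (Xc 0) p = of_real (\<kappa> l) + (if l = 1 then 2 * (\<i> * of_real (be 0)) * p $ c 1 + of_real (2 * q3) * (p $ c 1)\<^sup>2 else 0)"
    proof cases
      case 1
      have "DD 1 (Xc 1) p = DD 1 (Xc 1) 0" by (rule DD_const[OF _ _ _ ipts_ball[OF p]]) (use n4 in auto)
      then have "A 0 0 p = 2 * a0 + real n * b0"
        using first_derivatives(3)[OF p] DD_Xn(2)[OF ipts_ball[OF p]] by simp
      then show ?thesis using im 1 by (simp add: \<kappa>_def)
    next
      case 2
      then show ?thesis using DnX0[OF ipts_ball[OF p]] n4 by (simp add: \<kappa>_def)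
    next
      case 3
      have nl: "n - l \<in> {1..<n}" "n - l = n - 1 \<longleftrightarrow> l = 1" using 3 by auto
      have "DD l (Xc 0) p = 2 * of_real (Re (Xc (n - l) p))"
        using im Re_DX0(1)[OF p 3] by simp
      also have "\<dots> = of_real (\<kappa> l) + (if l = 1 then 2 * (\<i> * of_real (be 0)) * p $ c 1 + of_real (2 * q3) * (p $ c 1)\<^sup>2 else 0)"
        unfolding Re_X_mid[OF nl(1) p] nl(2) using 3 by (simp add: \<kappa>_def algebra_simps)
      finally show ?thesis .
    qed
  qed
  moreover have "(\<Sum>l\<in>{0..n}. of_real (\<kappa> l) * z $ c l) = (2 * a0 + real n * b0) * z $ c 0 + (\<Sum>k\<in>{1..<n}. 2 * be k * z $ c (n - k))"
  proof -
    have s: "{0..n} = insert 0 (insert n {1..<n})" using n4 by auto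
    have "(\<Sum>l\<in>{1..<n}. of_real (\<kappa> l) * z $ c l) = (\<Sum>k\<in>{1..<n}. 2 * be k * z $ c (n - k))"
      by (rule sum.reindex_bij_witness[of _ "\<lambda>k. n - k" "\<lambda>k. n - k"]) (auto simp: \<kappa>_def)
    moreover have "n \<noteq> 0" using n4 by simp
    ultimately show ?thesis unfolding s by (simp add: \<kappa>_def)
  qed
  moreover have "Xc 0 0 = \<i> * al 0" using Re_X0[OF zero_ipts] by (simp add: complex_eq_iff)
  ultimately show ?thesis by (simp add: Xpar_def)
qed

end

section \<open>Tangency of the polynomial fields and the differential equation\<close>

definition low_pairs :: "nat \<Rightarrow> (nat \<times> nat) set" where
  "low_pairs n = {(j, k). 0 < j \<and> 0 < k \<and> j + k < n}"

lemma finite_low_pairs [simp]: "finite (low_pairs n)"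
  by (rule finite_subset[OF _ finite_idx_pairs[of n]]) (auto simp: low_pairs_def idx_pairs_def)

lemma sum_idx_pairs_shift:
  "(\<Sum>(j, k)\<in>idx_pairs n. if 2 \<le> j then g (j - 1) k else 0) = (\<Sum>(j, k)\<in>low_pairs n. g j k :: real)"
proof -
  have "(\<Sum>(j, k)\<in>idx_pairs n. if 2 \<le> j then g (j - 1) k else 0)
    = (\<Sum>(j, k)\<in>{p \<in> idx_pairs n. 2 \<le> fst p}. g (j - 1) k)"
    by (subst sum.inter_filter) (auto intro!: sum.cong)
  also have "\<dots> = (\<Sum>(j, k)\<in>low_pairs n. g j k)"
    by (rule sum.reindex_bij_witness[of _ "\<lambda>(j, k). (j + 1, k)" "\<lambda>(j, k). (j - 1, k)"])
       (auto simp: idx_pairs_def low_pairs_def)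
  finally show ?thesis .
qed

lemma sum_idx_pairs_split: "(\<Sum>(j, k)\<in>idx_pairs n. g j k) = (\<Sum>(j, k)\<in>low_pairs n. g j k) + conv_sum n g"
proof -
  have "idx_pairs n = low_pairs n \<union> {(j, k). 0 < j \<and> 0 < k \<and> j + k = n}"
    "low_pairs n \<inter> {(j, k). 0 < j \<and> 0 < k \<and> j + k = n} = {}"
    by (auto simp: idx_pairs_def low_pairs_def)
  moreover have "finite {(j, k). 0 < j \<and> 0 < k \<and> j + k = n}"
    by (rule finite_subset[OF _ finite_idx_pairs[of n]]) (auto simp: idx_pairs_def)
  ultimately show ?thesis unfolding conv_sum_def by (simp add: sum.union_disjoint)
qed

lemma sum_antisym:
  fixes g :: "nat \<Rightarrow> nat \<Rightarrow> real"
  assumes "\<And>j k. (j, k) \<in> S \<Longrightarrow> (k, j) \<in> S" "\<And>j k. (j, k) \<in> S \<Longrightarrow> g j k = - g k j"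
  shows "(\<Sum>(j, k)\<in>S. g j k) = 0"
proof -
  have "(\<Sum>(j, k)\<in>S. g j k) = (\<Sum>(j, k)\<in>S. g k j)"
    by (rule sum.reindex_bij_witness[of _ prod.swap prod.swap]) (use assms(1) in auto)
  also have "\<dots> = (\<Sum>(j, k)\<in>S. - g j k)" by (rule sum.cong) (use assms in auto)
  finally show ?thesis by (simp add: sum_negf split_beta)
qed

text \<open>The partial derivative of \<open>hyp_poly n\<close> with respect to
  \<open>x n\<close>.\<close>

definition hyp_poly_n :: "nat \<Rightarrow> (nat \<Rightarrow> real) \<Rightarrow> real" where
  "hyp_poly_n n x = (\<Sum>(j, k)\<in>idx_pairs n. real (n - j - k) * x j * x k * x n ^ (n - j - k - 1))"

lemma d_hyp_poly_split: "d_hyp_poly n x v = (\<Sum>(j, k)\<in>idx_pairs n. 2 * v j * x k * x n ^ (n - j - k)) + v n * hyp_poly_n n x"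
  unfolding d_hyp_poly_def hyp_poly_n_def by (simp add: sum.distrib split_beta sum_distrib_left mult_ac)

text \<open>A telescoping sum: the correction with \<open>be (j - 1)\<close> at
  \<open>(j, k)\<close> cancels the main term at \<open>(j - 1, k)\<close>, which has one more
  factor \<open>x n\<close>. What survives are the pairs with \<open>j + k = n\<close>, which cannot
  be shifted up.\<close>

lemma d_hyp_poly_translations:
  assumes "\<And>j. j \<in> {1..<n} \<Longrightarrow> v j = be j - (if 2 \<le> j then be (j - 1) * x n else 0)" "v n = 0"
  shows "d_hyp_poly n x v = (\<Sum>k\<in>{1..<n}. 2 * be k * x (n - k))"
proof -
  define g where "g = (\<lambda>j k. 2 * be j * x k * x n ^ (n - j - k))"
  have "d_hyp_poly n x v = (\<Sum>(j, k)\<in>idx_pairs n. g j k - (if 2 \<le> j then g (j - 1) k else 0))"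
    unfolding d_hyp_poly_split assms(2)
  proof (simp only: mult_zero_left add_0_right, rule sum.cong[OF refl], clarify)
    fix j k assume jk: "(j, k) \<in> idx_pairs n"
    then have "j \<in> {1..<n}" by (auto simp: idx_pairs_def)
    then have v: "v j = be j - (if 2 \<le> j then be (j - 1) * x n else 0)" by (rule assms(1))
    show "2 * v j * x k * x n ^ (n - j - k) = g j k - (if 2 \<le> j then g (j - 1) k else 0)"
    proof (cases "2 \<le> j")
      case True
      then have e: "n - (j - 1) - k = Suc (n - j - k)" using jk by (auto simp: idx_pairs_def)
      show ?thesis unfolding v g_def e using True by (simp add: algebra_simps)
    qed (simp add: v g_def)
  qed
  also have "\<dots> = (\<Sum>(j, k)\<in>idx_pairs n. g j k) - (\<Sum>(j, k)\<in>idx_pairs n. if 2 \<le> j then g (j - 1) k else 0)"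
    by (simp add: sum_subtractf split_beta)
  also have "\<dots> = conv_sum n g"
    unfolding sum_idx_pairs_shift sum_idx_pairs_split by simp
  also have "\<dots> = (\<Sum>k\<in>{1..<n}. 2 * be (n - k) * x k)"
    unfolding conv_sum_eq_sum by (rule sum.cong) (auto simp: g_def)
  also have "\<dots> = (\<Sum>k\<in>{1..<n}. 2 * be k * x (n - k))"
    by (rule sum.reindex_bij_witness[of _ "\<lambda>k. n - k" "\<lambda>k. n - k"]) auto
  finally show ?thesis .
qed

text \<open>Each monomial has weight \<open>2 * a + n * b\<close>. Since \<open>d_hyp_poly\<close>
  counts the factor \<open>x j\<close> twice instead of \<open>x j\<close> and \<open>x k\<close>
  once each, single terms agree only up to \<open>(j - k) * b\<close>, which cancels under the
  exchange of \<open>j\<close> and \<open>k\<close>.\<close>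

lemma d_hyp_poly_scalings:
  assumes "\<And>j. j \<in> {1..<n} \<Longrightarrow> v j = (a + real j * b) * x j" "v n = b * x n"
  shows "d_hyp_poly n x v = (2 * a + real n * b) * hyp_poly n x"
proof -
  have "d_hyp_poly n x v - (2 * a + real n * b) * hyp_poly n x = (\<Sum>(j, k)\<in>idx_pairs n. (real j - real k) * b * (x j * x k * x n ^ (n - j - k)))"
    unfolding d_hyp_poly_def hyp_poly_def sum_distrib_left sum_subtractf[symmetric]
  proof (rule sum.cong[OF refl])
    fix p assume p: "p \<in> idx_pairs n"
    obtain j k where jk: "p = (j, k)" by (cases p)
    have j: "j \<in> {1..<n}" using p jk by (auto simp: idx_pairs_def)
    have r: "real (n - j - k) = real n - real j - real k" using p jk by (auto simp: idx_pairs_def)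
    have pw: "real (n - j - k) * x n ^ (n - j - k - 1) * x n = real (n - j - k) * x n ^ (n - j - k)"
      by (cases "n - j - k") auto
    have "real (n - j - k) * x j * x k * x n ^ (n - j - k - 1) * v n = b * (x j * x k * (real (n - j - k) * x n ^ (n - j - k - 1) * x n))"
      unfolding assms(2) by (simp add: mult_ac)
    also have "\<dots> = b * (x j * x k * (real (n - j - k) * x n ^ (n - j - k)))" unfolding pw ..
    also have "\<dots> = b * (x j * x k * ((real n - real j - real k) * x n ^ (n - j - k)))" unfolding r ..
    finally show "(case p of (j, k) \<Rightarrow> 2 * v j * x k * x n ^ (n - j - k) + real (n - j - k) * x j * x k * x n ^ (n - j - k - 1) * v n)
      - (2 * a + real n * b) * (case p of (j, k) \<Rightarrow> x j * x k * x n ^ (n - j - k))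
      = (case p of (j, k) \<Rightarrow> (real j - real k) * b * (x j * x k * x n ^ (n - j - k)))"
      unfolding jk by (simp add: assms(1)[OF j] algebra_simps)
  qed
  also have "\<dots> = 0"
    by (rule sum_antisym) (auto simp: idx_pairs_def algebra_simps)
  finally show ?thesis by simp
qed

text \<open>A pair of sum below \<open>n\<close> collects \<open>2 * (j - n/2)\<close> from the
  shifted components and \<open>n - j - k\<close> from the derivative in \<open>x n\<close>; the
  total \<open>j - k\<close> is antisymmetric. This is where the factors in \<open>Xpar\<close> come
  from.\<close>

lemma d_hyp_poly_shift_n:
  assumes "\<And>j. j \<in> {1..<n} \<Longrightarrow> v j = (if 2 \<le> j then (real j - 1 - real n / 2) * x (j - 1) else 0)" "v n = 1"
  shows "d_hyp_poly n x v = 0"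
proof -
  define g where "g = (\<lambda>j k. 2 * (real j - real n / 2) * x j * x k * x n ^ (n - j - k - 1))"
  define h where "h = (\<lambda>j k. real (n - j - k) * x j * x k * x n ^ (n - j - k - 1))"
  have "(\<Sum>(j, k)\<in>idx_pairs n. 2 * v j * x k * x n ^ (n - j - k)) = (\<Sum>(j, k)\<in>idx_pairs n. if 2 \<le> j then g (j - 1) k else 0)"
  proof (rule sum.cong[OF refl], clarify)
    fix j k assume jk: "(j, k) \<in> idx_pairs n"
    then have "j \<in> {1..<n}" by (auto simp: idx_pairs_def)
    moreover have "2 \<le> j \<Longrightarrow> n - (j - 1) - k - 1 = n - j - k" "2 \<le> j \<Longrightarrow> real (j - 1) = real j - 1" using jk by auto
    ultimately show "2 * v j * x k * x n ^ (n - j - k) = (if 2 \<le> j then g (j - 1) k else 0)"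
      using assms(1)[of j] by (simp add: g_def algebra_simps)
  qed
  also have "\<dots> = (\<Sum>(j, k)\<in>low_pairs n. g j k)" by (rule sum_idx_pairs_shift)
  finally have 1: "(\<Sum>(j, k)\<in>idx_pairs n. 2 * v j * x k * x n ^ (n - j - k)) = (\<Sum>(j, k)\<in>low_pairs n. g j k)" .
  have "conv_sum n h = conv_sum n (\<lambda>j k. 0)" by (rule conv_sum_cong) (auto simp: h_def)
  then have 2: "hyp_poly_n n x = (\<Sum>(j, k)\<in>low_pairs n. h j k)"
    unfolding hyp_poly_n_def h_def[symmetric] sum_idx_pairs_split by (simp add: conv_sum_def)
  have "d_hyp_poly n x v = (\<Sum>(j, k)\<in>low_pairs n. g j k + h j k)"
    unfolding d_hyp_poly_split 1 2 assms(2) by (simp add: sum.distrib split_beta)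
  also have "\<dots> = (\<Sum>(j, k)\<in>low_pairs n. (real j - real k) * (x j * x k * x n ^ (n - j - k - 1)))"
    by (rule sum.cong) (auto simp: low_pairs_def g_def h_def of_nat_diff algebra_simps)
  also have "\<dots> = 0"
    by (rule sum_antisym) (auto simp: low_pairs_def algebra_simps)
  finally show ?thesis .
qed

text \<open>The only pair with first entry \<open>n - 1\<close> is \<open>(n - 1, 1)\<close>, and it
  carries no power of \<open>x n\<close>.\<close>

lemma d_hyp_poly_last:
  assumes "n > 1" "\<And>j. j \<in> {1..<n} \<Longrightarrow> v j = (if j = n - 1 then s else 0)" "v n = 0"
  shows "d_hyp_poly n x v = 2 * x 1 * s"
proof -
  have "d_hyp_poly n x v = (\<Sum>p\<in>idx_pairs n. if p = (n - 1, 1) then 2 * s * x 1 else 0)"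
    unfolding d_hyp_poly_split assms(3)
  proof (simp only: mult_zero_left add_0_right, rule sum.cong[OF refl], clarify)
    fix j k assume jk: "(j, k) \<in> idx_pairs n"
    then have j: "j \<in> {1..<n}" by (auto simp: idx_pairs_def)
    show "2 * v j * x k * x n ^ (n - j - k) = (if (j, k) = (n - 1, 1) then 2 * s * x 1 else 0)"
    proof (cases "j = n - 1")
      case True
      then have "k = 1" using jk by (auto simp: idx_pairs_def)
      then show ?thesis using True assms(2)[OF j] assms(1) by auto
    qed (use assms(2)[OF j] in auto)
  qed
  also have "\<dots> = 2 * s * x 1"
  proof -
    have "(n - 1, 1) \<in> idx_pairs n" using assms(1) by (auto simp: idx_pairs_def)
    then show ?thesis by (simp only: sum.delta[OF finite_idx_pairs] if_True)
  qed
  finally show ?thesis by simp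
qed

lemma d_hyp_poly_add: "d_hyp_poly n x (\<lambda>i. v i + w i) = d_hyp_poly n x v + d_hyp_poly n x w"
  unfolding d_hyp_poly_def by (simp add: sum.distrib[symmetric] split_beta algebra_simps)

context indexed
begin

definition ode_defect :: "(real \<Rightarrow> real) \<Rightarrow> (nat \<Rightarrow> real) \<Rightarrow> real \<Rightarrow> real \<Rightarrow> real \<Rightarrow> real \<Rightarrow> real \<Rightarrow> real \<Rightarrow> real \<Rightarrow> real" where
  "ode_defect f be a b q2 q3 r0 p0 s = (be 1 + (a + b) * s) * deriv f s - (2 * a + real n * b) * f s
    - (p0 + r0 * s - 2 * q2 * s\<^sup>2 - 4 / 3 * q3 * s ^ 3)"

text \<open>The contributions of \<open>Im z\<^sub>1\<close> cancel because \<open>2 x Re (i z) - Re (i z\<^sup>2) = 0\<close> and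
  \<open>2 x Re (z\<^sup>2) - 2/3 Re (z\<^sup>3) = 4/3 x\<^sup>3\<close> for \<open>z = x + i y\<close>.\<close>

lemma tangency_Xpar:
  fixes al be :: "nat \<Rightarrow> real" and a b q2 q3 r0 p0 :: real
  assumes z: "z \<in> M_hyp n c f"
  defines "w \<equiv> \<lambda>j. Re (Xpar al be a b q2 q3 r0 p0 z j)"
  shows "w 0 - deriv f (rc z 1) * w 1 - d_hyp_poly n (rc z) w = - ode_defect f be a b q2 q3 r0 p0 (rc z 1)"
proof -
  define x where "x = rc z"
  define y where "y = Im (z $ c 1)"
  have xz: "Re (z $ c j) = x j" for j by (simp add: x_def rc_def)
  have x0: "x 0 = f (x 1) + hyp_poly n x" using z by (simp add: mem_M_hyp x_def)
  have z1: "z $ c 1 = Complex (x 1) y" by (simp add: complex_eq_iff xz y_def)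
  have sq: "Re ((z $ c 1)\<^sup>2) = (x 1)\<^sup>2 - y\<^sup>2" "Im ((z $ c 1)\<^sup>2) = 2 * x 1 * y" "Re ((z $ c 1) ^ 3) = x 1 ^ 3 - 3 * x 1 * y\<^sup>2"
    unfolding z1 by (simp_all add: power2_eq_square power3_eq_cube algebra_simps)
  define s where "s = - be 0 * y + q2 * x 1 + q3 * ((x 1)\<^sup>2 - y\<^sup>2)"
  have w0: "w 0 = p0 + (\<Sum>k\<in>{1..<n}. 2 * be k * x (n - k)) + r0 * x 1 - be 0 * (2 * x 1 * y)
    + 2 / 3 * q3 * (x 1 ^ 3 - 3 * x 1 * y\<^sup>2) + (2 * a + real n * b) * x 0"
    unfolding w_def Xpar_def by (simp add: xz sq xz[of 1, simplified] sq[simplified])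
  have wn: "w n = be n + b * x n" unfolding w_def Xpar_def using n4 by (simp add: xz)
  have w: "w j = (be j - (if 2 \<le> j then be (j - 1) * x n else 0)) + (a + real j * b) * x j
    + be n * (if 2 \<le> j then (real j - 1 - real n / 2) * x (j - 1) else 0) + (if j = n - 1 then s else 0)"
    if "j \<in> {1..<n}" for j
  proof -
    have "j \<noteq> 0" "j \<noteq> n" using that by auto
    then show ?thesis unfolding w_def Xpar_def s_def
      by (simp add: xz sq y_def xz[of 1, simplified] sq[simplified] algebra_simps)
  qed
  define v1 where "v1 = (\<lambda>j. if j = n then 0 else be j - (if 2 \<le> j then be (j - 1) * x n else 0))"
  define v2 where "v2 = (\<lambda>j. if j = n then b * x n else (a + real j * b) * x j)"
  define v3 where "v3 = (\<lambda>j. if j = n then 1 else if 2 \<le> j then (real j - 1 - real n / 2) * x (j - 1) else 0)"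
  define v4 where "v4 = (\<lambda>j. if j = n then 0 else if j = n - 1 then s else 0)"
  have "d_hyp_poly n x w = d_hyp_poly n x (\<lambda>j. v1 j + v2 j + be n * v3 j + v4 j)"
  proof (rule d_hyp_poly_cong[OF refl])
    fix j assume "j \<in> {1..n}"
    then have "j = n \<or> j \<in> {1..<n}" by auto
    then show "w j = v1 j + v2 j + be n * v3 j + v4 j"
      by (elim disjE) (auto simp: v1_def v2_def v3_def v4_def wn w)
  qed
  also have "\<dots> = d_hyp_poly n x v1 + d_hyp_poly n x v2 + be n * d_hyp_poly n x v3 + d_hyp_poly n x v4"
    by (simp only: d_hyp_poly_add d_hyp_poly_scale)
  also have "d_hyp_poly n x v1 = (\<Sum>k\<in>{1..<n}. 2 * be k * x (n - k))"
    by (rule d_hyp_poly_translations) (auto simp: v1_def)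
  also have "d_hyp_poly n x v2 = (2 * a + real n * b) * hyp_poly n x"
    by (rule d_hyp_poly_scalings) (auto simp: v2_def)
  also have "d_hyp_poly n x v3 = 0"
    by (rule d_hyp_poly_shift_n) (auto simp: v3_def)
  also have "d_hyp_poly n x v4 = 2 * x 1 * s"
    by (rule d_hyp_poly_last) (use n4 in \<open>auto simp: v4_def\<close>)
  finally have d: "d_hyp_poly n x w = (\<Sum>k\<in>{1..<n}. 2 * be k * x (n - k)) + (2 * a + real n * b) * hyp_poly n x + 2 * x 1 * s"
    by simp
  have "1 \<in> {1..<n}" "1 \<noteq> n - 1" using n4 by auto
  then have w1: "w 1 = be 1 + (a + b) * x 1" using w[of 1] by simp
  show ?thesis
    unfolding x_def[symmetric] ode_defect_def d w0 w1 x0 s_def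
    by (simp add: power2_eq_square power3_eq_cube algebra_simps)
qed

text \<open>Only the pair \<open>(1, 1)\<close> could contribute, and it carries the positive power
  \<open>n - 3\<close> of \<open>x n = 0\<close>.\<close>

lemma hyp_poly_n_at_un_1:
  assumes "\<And>i. i \<in> {1..n} \<Longrightarrow> x i = t * uvec 1 i"
  shows "hyp_poly_n n x = 0"
  unfolding hyp_poly_n_def
proof (rule sum.neutral, clarify)
  fix j k assume jk: "(j, k) \<in> idx_pairs n"
  have x: "x j = t * uvec 1 j" "x k = t * uvec 1 k" "x n = 0"
    using jk n4 by (auto simp: idx_pairs_def assms uvec_def)
  show "real (n - j - k) * x j * x k * x n ^ (n - j - k - 1) = 0"
  proof (cases "j = 1 \<and> k = 1")
    case True
    then have "n - j - k - 1 > 0" using n4 by simp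
    then show ?thesis using x(3) by simp
  qed (use x in \<open>auto simp: uvec_def\<close>)
qed

text \<open>Nothing is assumed about the last component, which enters the tangency equation only
  with the factor \<open>hyp_poly_n\<close>. Along the curve in direction \<open>uvec 1\<close> this
  factor vanishes, which isolates the differential equation; the second part then controls the last
  component elsewhere.\<close>

lemma tang_imp_ode:
  assumes f: "smooth f" "f 0 = 0" and r: "r > 0" and tang: "tang f Y (ball 0 r)"
    and Y: "\<And>z j. z \<in> ball 0 r \<Longrightarrow> j < n \<Longrightarrow> Y z $ c j = Xpar al be a b q2 q3 r0 p0 z j"
  shows "\<forall>\<^sub>F s in nhds 0. ode_defect f be a b q2 q3 r0 p0 s = 0"
    and "z \<in> M_hyp n c f \<Longrightarrow> z \<in> ball 0 r \<Longrightarrow>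
      hyp_poly_n n (rc z) * (Re (Y z $ c n) - Re (Xpar al be a b q2 q3 r0 p0 z n)) = - ode_defect f be a b q2 q3 r0 p0 (rc z 1)"
proof -
  show *: "hyp_poly_n n (rc z) * (Re (Y z $ c n) - Re (Xpar al be a b q2 q3 r0 p0 z n)) = - ode_defect f be a b q2 q3 r0 p0 (rc z 1)"
    if z: "z \<in> M_hyp n c f" "z \<in> ball 0 r" for z
  proof -
    have w: "rc (Y z) j = Re (Xpar al be a b q2 q3 r0 p0 z j)" if "j < n" for j
      using Y[OF z(2) that] by (simp add: rc_def)
    have t: "rc (Y z) 0 = deriv f (rc z 1) * rc (Y z) 1 + d_hyp_poly n (rc z) (rc (Y z))"
      using tang z unfolding tang_def by blast
    have "(\<Sum>(j, k)\<in>idx_pairs n. 2 * rc (Y z) j * rc z k * rc z n ^ (n - j - k))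
      = (\<Sum>(j, k)\<in>idx_pairs n. 2 * Re (Xpar al be a b q2 q3 r0 p0 z j) * rc z k * rc z n ^ (n - j - k))"
      by (rule sum.cong) (auto simp: idx_pairs_def w)
    then have "d_hyp_poly n (rc z) (rc (Y z)) = d_hyp_poly n (rc z) (\<lambda>j. Re (Xpar al be a b q2 q3 r0 p0 z j))
      + hyp_poly_n n (rc z) * (Re (Y z $ c n) - Re (Xpar al be a b q2 q3 r0 p0 z n))"
      unfolding d_hyp_poly_split by (simp add: rc_def algebra_simps)
    then show ?thesis
      using t tangency_Xpar[OF z(1), of al be a b q2 q3 r0 p0] w[of 0] w[of 1] n4 by simp
  qed
  have 0: "0 \<in> ipts r" using r by (simp add: ipts_def)
  have zb: "(0 :: complex ^ 'm) \<in> ball 0 r" using r by simp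
  show "\<forall>\<^sub>F s in nhds 0. ode_defect f be a b q2 q3 r0 p0 s = 0"
    using eventually_curve[OF f zb, of "uvec 1"]
  proof eventually_elim
    case (elim t)
    have "rc (curve 0 (uvec 1) (graph_fn f (uvec 1)) t) i = t * uvec 1 i" if "i \<in> {1..n}" for i
      by (rule rc_curve(2)[OF 0 that])
    from hyp_poly_n_at_un_1[OF this] this[of 1]
    show ?case using *[OF curve_in_M_hyp[OF 0] elim] n4 by (auto simp: uvec_def)
  qed
qed

lemma ode_imp_tang:
  assumes "\<And>s. \<bar>s\<bar> < r \<Longrightarrow> ode_defect f be a b q2 q3 r0 p0 s = 0"
    and Y: "\<And>z j. z \<in> ball 0 r \<Longrightarrow> j \<le> n \<Longrightarrow> Y z $ c j = Xpar al be a b q2 q3 r0 p0 z j"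
  shows "tang f Y (ball 0 r)"
  unfolding tang_def
proof (intro ballI)
  fix z assume "z \<in> M_hyp n c f \<inter> ball 0 r"
  then have z: "z \<in> M_hyp n c f" "z \<in> ball 0 r" by auto
  have w: "rc (Y z) j = Re (Xpar al be a b q2 q3 r0 p0 z j)" if "j \<le> n" for j
    using Y[OF z(2) that] by (simp add: rc_def)
  have "\<bar>rc z 1\<bar> \<le> norm z"
    unfolding rc_def using abs_Re_le_cmod[of "z $ c 1"] Finite_Cartesian_Product.norm_nth_le[of z "c 1"]
    by linarith
  then have "ode_defect f be a b q2 q3 r0 p0 (rc z 1) = 0" using z(2) by (intro assms(1)) simp
  moreover have "d_hyp_poly n (rc z) (rc (Y z)) = d_hyp_poly n (rc z) (\<lambda>j. Re (Xpar al be a b q2 q3 r0 p0 z j))"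
    by (rule d_hyp_poly_cong) (auto simp: w)
  ultimately show "rc (Y z) 0 = deriv f (rc z 1) * rc (Y z) 1 + d_hyp_poly n (rc z) (rc (Y z))"
    using tangency_Xpar[OF z(1), of al be a b q2 q3 r0 p0] w[of 0] w[of 1] n4 by simp
qed

end

section \<open>The last component\<close>

context tangent_field
begin

text \<open>The derivatives of the difference \<open>Y\<close> in \<open>z_1, ..., z_n\<close>
  vanish already. By \<open>tang_imp_ode\<close> the product of \<open>hyp_poly_n\<close> and
  \<open>Re Y\<close> vanishes along suitable curves, where the \<open>t^2\<close> coefficient of
  \<open>Re Y\<close> is \<open>F2 * Re (DD 0 Y p)\<close>. As \<open>hyp_poly_n\<close> has order
  two itself, this uses tangency to fourth order.\<close>

lemma X_last:
  assumes z: "z \<in> ball 0 r"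
  shows "Xc n z = Xpar al be a0 b0 q2 q3 0 0 z n"
proof -
  define Y where "Y = (\<lambda>z. Xc n z - Xpar al be a0 b0 q2 q3 0 0 z n)"
  have n0: "n \<noteq> 0" using n4 by simp
  have Yn: "Y = (\<lambda>z. Xc n z - (\<i> * al n + be n + of_real b0 * z $ c n))"
    unfolding Y_def Xpar_def using n0 by simp
  have lc: "chol (\<lambda>z. \<i> * al n + be n + of_real b0 * z $ c n) (ball 0 r)"
    by (intro chol_add chol_cmult chol_const chol_nth)
  have Y: "chol Y (ball 0 r)" unfolding Yn by (rule chol_diff[OF X lc])
  have DY: "DD k Y z = DD k (Xc n) z - (if k = n then of_real b0 else 0)" if "k \<le> n" "z \<in> ball 0 r" for k z
  proof -
    have "DD k (\<lambda>z. \<i> * al n + be n + of_real b0 * z $ c n) z = 0 + of_real b0 * DD k (\<lambda>z. z $ c n) z"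
      by (simp only: pd_add[OF chol_const chol_cmult[OF chol_nth] that(2)] pd_cmult[OF chol_nth that(2)] pd_const)
    then show ?thesis
      unfolding Yn pd_diff[OF X lc that(2)] using that by (simp add: pd_nth c_eq_iff)
  qed
  have DkY: "DD k Y z = 0" if "k \<in> {1..n}" "z \<in> ball 0 r" for k z
    using DY[of k z] DD_Xn[OF that(2)] that by (cases "k = n") auto
  have DDkY: "DD l (DD k Y) z = 0" if "k \<in> {1..n}" "z \<in> ball 0 r" for k l z
    using pd_cong[OF open_ball that(2), of "DD k Y" "\<lambda>_. 0" "c l"] DkY[OF that(1)] by simp
  have mid: "X z $ c j = Xpar al be a0 b0 q2 q3 0 0 z j" if "z \<in> ball 0 r" "j < n" for z j
    using X_mid[of j z] X_zero[of z] that by (cases "j = 0") auto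
  have ode1: "\<forall>\<^sub>F s in nhds 0. ode_defect f be a0 b0 q2 q3 0 0 s = 0"
    by (rule tang_imp_ode(1)[OF f(1,2) r tang]) (rule mid)
  have ode2: "hyp_poly_n n (rc z) * Re (Y z) = - ode_defect f be a0 b0 q2 q3 0 0 (rc z 1)"
    if "z \<in> M_hyp n c f" "z \<in> ball 0 r" for z
    using tang_imp_ode(2)[OF f(1,2) r tang mid that] unfolding Y_def by simp
  \<comment> \<open>With \<open>\<xi> n = 0\<close> only the pairs with \<open>j + k = n - 1\<close>
    contribute to \<open>hyp_poly_n\<close>, which becomes \<open>(n - 2) * t^2\<close>; the ones
    elsewhere give \<open>F2 = n - 1\<close>. Both factors are nonzero.\<close>
  define \<xi> :: "nat \<Rightarrow> real" where "\<xi> = (\<lambda>i. if i < n then 1 else 0)"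
  have conv_sum\<xi>: "conv_sum s (\<lambda>j k. \<xi> j * \<xi> k) = real (s - 1)" if "s \<le> n" for s
  proof -
    have "(\<Sum>k\<in>{1..<s}. \<xi> (s - k) * \<xi> k) = (\<Sum>k\<in>{1..<s}. 1)"
      by (rule sum.cong) (use that in \<open>auto simp: \<xi>_def\<close>)
    then show ?thesis unfolding conv_sum_eq_sum by simp
  qed
  have "Re (DD 0 Y p) = 0" if p: "p \<in> ipts r" for p
  proof -
    define F2 where "F2 = conv_sum n (\<lambda>j k. \<xi> j * \<xi> k)"
    define F3 where "F3 = \<xi> n * conv_sum (n - 1) (\<lambda>j k. \<xi> j * \<xi> k) + (deriv ^^ 3) f 0 / 6 * \<xi> 1 ^ 3"
    let ?\<gamma> = "curve p \<xi> (graph_fn f \<xi>)"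
    have "jet 3 (\<lambda>t. Re (Y (?\<gamma> t))) (curve_coeff p \<xi> F2 F3 Y)"
      unfolding F2_def F3_def
      by (rule jet_Re_curve[OF Y open_ball ipts_ball[OF p] graph_fn_0[of f, OF f(2)] graph_fn_deriv[OF f(1)] jet_graph_fn_deriv[OF f(1,3,4)]])
    \<comment> \<open>The equation says nothing at \<open>t = 0\<close>, where
      \<open>hyp_poly_n\<close> vanishes; the extra factor \<open>t\<close> makes it hold there too
      and shifts the coefficients by one.\<close>
    from jet_monom_mult[OF this, of 1 1]
    have J: "jet 3 (\<lambda>t. t * Re (Y (?\<gamma> t))) (\<lambda>i. if 1 \<le> i then 1 * curve_coeff p \<xi> F2 F3 Y (i - 1) else 0)"
      by simp
    have "\<forall>\<^sub>F t in nhds 0. t * Re (Y (?\<gamma> t)) = 0"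
      using eventually_curve[OF f(1,2) ipts_ball[OF p], of \<xi>] ode1
    proof eventually_elim
      case (elim t)
      have rc: "rc (?\<gamma> t) i = t * \<xi> i" if "i \<in> {1..n}" for i
        by (rule rc_curve(2)[OF p that])
      have "hyp_poly_n n (rc (?\<gamma> t)) = (\<Sum>(j, k)\<in>idx_pairs n. if n - j - k = 1 then (t * \<xi> j) * (t * \<xi> k) else 0)"
        unfolding hyp_poly_n_def
      proof (rule sum.cong[OF refl], clarify)
        fix j k assume jk: "(j, k) \<in> idx_pairs n"
        have "rc (?\<gamma> t) j = t * \<xi> j" "rc (?\<gamma> t) k = t * \<xi> k" "rc (?\<gamma> t) n = 0"
          using jk by (auto simp: idx_pairs_def rc) (simp add: \<xi>_def)
        then show "real (n - j - k) * rc (?\<gamma> t) j * rc (?\<gamma> t) k * rc (?\<gamma> t) n ^ (n - j - k - 1)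
          = (if n - j - k = 1 then (t * \<xi> j) * (t * \<xi> k) else 0)"
          by (cases "n - j - k - 1"; cases "n - j - k") auto
      qed
      also have "\<dots> = conv_sum (n - 1) (\<lambda>j k. t * t * (\<xi> j * \<xi> k))"
        by (subst sum_idx_pairs_eq_conv_sum) (use n4 in \<open>auto simp: mult_ac\<close>)
      also have "\<dots> = t * t * real (n - 1 - 1)"
        unfolding conv_sum_cmult[symmetric] by (subst conv_sum\<xi>) auto
      finally have P: "hyp_poly_n n (rc (?\<gamma> t)) = t * t * real (n - 1 - 1)" .
      have "rc (?\<gamma> t) 1 = t" using rc[of 1] n4 by (simp add: \<xi>_def)
      then have "hyp_poly_n n (rc (?\<gamma> t)) * Re (Y (?\<gamma> t)) = 0"
        using ode2[OF curve_in_M_hyp[OF p] elim(1)] elim(2) by simp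
      then show ?case unfolding P using n4 by auto
    qed
    from jet_zero[OF J this, of 3] have "curve_coeff p \<xi> F2 F3 Y 2 = 0" by (simp add: numeral_2_eq_2 numeral_3_eq_3)
    then have "F2 * Re (DD 0 Y p) = 0"
      unfolding curve_coeff_def using DDkY[OF _ ipts_ball[OF p]] by simp
    moreover have "F2 \<noteq> 0" unfolding F2_def using conv_sum\<xi>[of n] n4 by simp
    ultimately show ?thesis by simp
  qed
  then have "DD l Y p = 0" if "l \<le> n" "p \<in> ipts r" for l p
    using DY[of 0 p] DkY[of l p] N_vanish(3)[OF that(2), of 0] that n0 ipts_ball[OF that(2)]
    by (cases "l = 0") (auto simp: complex_eq_iff)
  from const_if_DD_zero[OF Y this z] have "Y z = Y 0" by simp
  also have "Y 0 = 0" unfolding Yn using n0 by (simp add: complex_eq_iff)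
  finally show ?thesis by (simp add: Y_def)
qed

end

section \<open>Shears and the reduction to a normalized function\<close>

lemma smooth_add_poly:
  assumes "smooth f"
  shows "smooth (\<lambda>s. f s + poly p s)"
    and "(deriv ^^ k) (\<lambda>s. f s + poly p s) = (\<lambda>s. (deriv ^^ k) f s + poly ((pderiv ^^ k) p) s)"
proof -
  have *: "(deriv ^^ k) (\<lambda>s. f s + poly p s) = (\<lambda>s. (deriv ^^ k) f s + poly ((pderiv ^^ k) p) s)" for k
  proof (induction k)
    case (Suc k)
    have "((\<lambda>s. (deriv ^^ k) f s + poly ((pderiv ^^ k) p) s) has_real_derivative
      ((deriv ^^ Suc k) f s + poly (pderiv ((pderiv ^^ k) p)) s)) (at s)" for s
      by (intro DERIV_add smooth_DERIV assms poly_DERIV)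
    then show ?case using Suc by (auto intro!: DERIV_imp_deriv)
  qed simp
  then show "(deriv ^^ k) (\<lambda>s. f s + poly p s) = (\<lambda>s. (deriv ^^ k) f s + poly ((pderiv ^^ k) p) s)" .
  show "smooth (\<lambda>s. f s + poly p s)"
    unfolding smooth_def *
  proof (intro allI differentiable_on_add)
    show "(deriv ^^ k) f differentiable_on UNIV" for k using assms unfolding smooth_def by blast
    show "poly ((pderiv ^^ k) p) differentiable_on UNIV" for k
      unfolding differentiable_on_def using poly_DERIV real_differentiable_def
      by (metis differentiable_at_withinI)
  qed
qed

lemma smooth_poly:
  shows "smooth (poly p)" and "(deriv ^^ k) (poly p) = poly ((pderiv ^^ k) p)"
proof -
  have z: "(deriv ^^ k) (\<lambda>_ :: real. 0 :: real) = (\<lambda>_. 0)" for k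
    by (induction k) auto
  then have s: "smooth (\<lambda>_. 0)" unfolding smooth_def by simp
  show "smooth (poly p)" using smooth_add_poly(1)[OF s, of p] by simp
  show "(deriv ^^ k) (poly p) = poly ((pderiv ^^ k) p)" using smooth_add_poly(2)[OF s, of k p] by (simp add: z)
qed

context indexed
begin

text \<open>Shears remove the linear and quadratic Taylor coefficients of \<open>f\<close>.\<close>

definition shear :: "real \<Rightarrow> real \<Rightarrow> complex ^ 'm \<Rightarrow> complex ^ 'm" where
  "shear \<alpha> \<beta> z = z + axis (c 0) (of_real \<alpha> * z $ c 1) + axis (c (n - 1)) (of_real \<beta> * z $ c 1)"

lemma shear_nth:
  "shear \<alpha> \<beta> z $ c 0 = z $ c 0 + \<alpha> * z $ c 1"
  "shear \<alpha> \<beta> z $ c (n - 1) = z $ c (n - 1) + \<beta> * z $ c 1"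
  "j \<le> n \<Longrightarrow> j \<noteq> 0 \<Longrightarrow> j \<noteq> n - 1 \<Longrightarrow> shear \<alpha> \<beta> z $ c j = z $ c j"
  unfolding shear_def using n4 by (auto simp: axis_def c_eq_iff)

lemma c_cases: obtains j where "j \<le> n" "i = c j"
  using bij that unfolding bij_betw_def by (metis UNIV_I atLeastAtMost_iff imageE)

lemma vec_eq_c: "v = w \<longleftrightarrow> (\<forall>j\<le>n. v $ c j = w $ c j)"
  unfolding vec_eq_iff by (metis c_cases)

lemma shear_inverse: "shear (- \<alpha>) (- \<beta>) (shear \<alpha> \<beta> z) = z"
proof -
  have "shear \<alpha> \<beta> z $ c 1 = z $ c 1" for \<alpha> \<beta> z by (rule shear_nth(3)) (use n4 in auto)
  then have "shear (- \<alpha>) (- \<beta>) (shear \<alpha> \<beta> z) $ c j = z $ c j" if "j \<le> n" for j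
    using that by (cases "j = 0"; cases "j = n - 1") (auto simp: shear_nth shear_nth[unfolded One_nat_def])
  then show ?thesis unfolding vec_eq_c by blast
qed

lemma bounded_linear_shear: "bounded_linear (shear \<alpha> \<beta>)"
proof -
  have "bounded_linear (\<lambda>z :: complex ^ 'm. axis k (of_real \<gamma> * z $ l))" for k l \<gamma>
    by (rule bounded_linear_compose[OF bounded_linear_axis bounded_linear_compose[OF bounded_linear_mult_right bounded_linear_vec_nth]])
  then show ?thesis unfolding shear_def[abs_def] by (intro bounded_linear_add bounded_linear_ident)
qed

lemma rc_shear:
  "rc (shear \<alpha> \<beta> z) 0 = rc z 0 + \<alpha> * rc z 1"
  "rc (shear \<alpha> \<beta> z) (n - 1) = rc z (n - 1) + \<beta> * rc z 1"
  "j \<le> n \<Longrightarrow> j \<noteq> 0 \<Longrightarrow> j \<noteq> n - 1 \<Longrightarrow> rc (shear \<alpha> \<beta> z) j = rc z j"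
  unfolding rc_def shear_nth(1,2) by (simp_all add: shear_nth(3))

text \<open>The coordinate \<open>x (n - 1)\<close> occurs only in its product with
  \<open>x 1\<close>, without \<open>x n\<close>, and in both orders, hence the factor 2.\<close>

lemma hyp_poly_shear: "hyp_poly n (rc (shear \<alpha> \<beta> z)) = hyp_poly n (rc z) + 2 * \<beta> * (rc z 1)\<^sup>2"
proof -
  let ?x = "rc z" and ?y = "rc (shear \<alpha> \<beta> z)"
  have n1: "n - 1 \<noteq> 1" "n \<noteq> n - 1" "n - 1 \<noteq> 0" "n \<noteq> 0" using n4 by auto
  have y: "?y j = ?x j + (if j = n - 1 then \<beta> * ?x 1 else 0)" if "j \<in> {1..n}" for j
    using that rc_shear by (cases "j = n - 1") auto
  have "hyp_poly n ?y = (\<Sum>p\<in>idx_pairs n. ?x (fst p) * ?x (snd p) * ?x n ^ (n - fst p - snd p)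
      + (if p = (n - 1, 1) then \<beta> * (?x 1)\<^sup>2 else 0) + (if p = (1, n - 1) then \<beta> * (?x 1)\<^sup>2 else 0))"
    unfolding hyp_poly_def split_beta
  proof (rule sum.cong[OF refl])
    fix p assume p: "p \<in> idx_pairs n"
    obtain j k where jk: "p = (j, k)" by (cases p)
    have J: "j \<in> {1..n}" "k \<in> {1..n}" "n \<in> {1..n}" using p jk by (auto simp: idx_pairs_def)
    have "j = n - 1 \<Longrightarrow> k = 1" "k = n - 1 \<Longrightarrow> j = 1" using p jk by (auto simp: idx_pairs_def)
    then show "?y (fst p) * ?y (snd p) * ?y n ^ (n - fst p - snd p) = ?x (fst p) * ?x (snd p) * ?x n ^ (n - fst p - snd p)
      + (if p = (n - 1, 1) then \<beta> * (?x 1)\<^sup>2 else 0) + (if p = (1, n - 1) then \<beta> * (?x 1)\<^sup>2 else 0)"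
      unfolding jk fst_conv snd_conv y[OF J(1)] y[OF J(2)] y[OF J(3)] using n1
      by (cases "j = n - 1"; cases "k = n - 1") (auto simp: power2_eq_square algebra_simps)
  qed
  also have "\<dots> = hyp_poly n ?x + \<beta> * (?x 1)\<^sup>2 + \<beta> * (?x 1)\<^sup>2"
  proof -
    have "(n - 1, 1) \<in> idx_pairs n" "(1, n - 1) \<in> idx_pairs n" using n4 by (auto simp: idx_pairs_def)
    then show ?thesis
      unfolding sum.distrib by (simp only: sum.delta[OF finite_idx_pairs] if_True) (simp add: hyp_poly_def split_beta)
  qed
  finally show ?thesis by simp
qed

lemma shear_M_hyp:
  assumes "\<And>s. g s = f s + \<alpha> * s - 2 * \<beta> * s\<^sup>2"
  shows "shear \<alpha> \<beta> z \<in> M_hyp n c g \<longleftrightarrow> z \<in> M_hyp n c f"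
proof -
  have "rc (shear \<alpha> \<beta> z) 1 = rc z 1" by (rule rc_shear(3)) (use n4 in auto)
  then show ?thesis unfolding mem_M_hyp hyp_poly_shear rc_shear(1) assms by (simp add: algebra_simps)
qed

lemma tangent_space_shear:
  assumes "\<And>s. g s = f s + \<alpha> * s - 2 * \<beta> * s\<^sup>2" "v \<in> tangent_space (M_hyp n c f) p"
  shows "shear \<alpha> \<beta> v \<in> tangent_space (M_hyp n c g) (shear \<alpha> \<beta> p)"
proof -
  obtain \<gamma> where \<gamma>: "\<gamma> 0 = p" "\<forall>\<^sub>F t in nhds 0. \<gamma> t \<in> M_hyp n c f" "(\<gamma> has_vector_derivative v) (at 0)"
    using assms(2) unfolding tangent_space_def by blast
  show ?thesis
    unfolding tangent_space_def mem_Collect_eq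
    using \<gamma> bounded_linear.has_vector_derivative[OF bounded_linear_shear \<gamma>(3), of \<alpha> \<beta>]
    by (intro exI[of _ "\<lambda>t. shear \<alpha> \<beta> (\<gamma> t)"]) (simp add: shear_M_hyp[of g f, OF assms(1)])
qed

lemma chol_shear:
  assumes "chol G U" "\<And>z. z \<in> V \<Longrightarrow> shear \<alpha> \<beta> z \<in> U"
  shows "chol (\<lambda>z. G (shear \<alpha> \<beta> z)) V"
proof (rule cholI)
  fix z assume z: "z \<in> V"
  let ?g = "\<lambda>k. pd k G (shear \<alpha> \<beta> z)"
  have "(\<Sum>k\<in>UNIV. shear \<alpha> \<beta> h $ k * ?g k)
    = (\<Sum>k\<in>UNIV. h $ k * (?g k + (if k = c 1 then \<alpha> * ?g (c 0) + \<beta> * ?g (c (n - 1)) else 0)))" for h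
  proof -
    have "(\<Sum>k\<in>UNIV. shear \<alpha> \<beta> h $ k * ?g k) = (\<Sum>k\<in>UNIV. h $ k * ?g k)
      + (\<Sum>k\<in>UNIV. axis (c 0) (of_real \<alpha> * h $ c 1) $ k * ?g k) + (\<Sum>k\<in>UNIV. axis (c (n - 1)) (of_real \<beta> * h $ c 1) $ k * ?g k)"
      unfolding shear_def vector_add_component distrib_right sum.distrib ..
    also have "\<dots> = (\<Sum>k\<in>UNIV. h $ k * ?g k) + (\<Sum>k\<in>UNIV. if k = c 1 then h $ c 1 * (\<alpha> * ?g (c 0) + \<beta> * ?g (c (n - 1))) else 0)"
      unfolding sum_axis by (simp add: sum.delta algebra_simps)
    also have "\<dots> = (\<Sum>k\<in>UNIV. h $ k * (?g k + (if k = c 1 then \<alpha> * ?g (c 0) + \<beta> * ?g (c (n - 1)) else 0)))"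
      unfolding sum.distrib[symmetric] by (intro sum.cong) (auto simp: algebra_simps)
    finally show ?thesis .
  qed
  moreover have "((\<lambda>z. G (shear \<alpha> \<beta> z)) has_derivative (\<lambda>h. \<Sum>k\<in>UNIV. shear \<alpha> \<beta> h $ k * ?g k)) (at z)"
    by (rule has_derivative_compose[OF bounded_linear_imp_has_derivative[OF bounded_linear_shear] chol_has_derivative[OF assms(1,2)]]) (rule z)
  ultimately show "((\<lambda>z. G (shear \<alpha> \<beta> z)) has_derivative (\<lambda>h. \<Sum>k\<in>UNIV. h $ k * (?g k + (if k = c 1 then \<alpha> * ?g (c 0) + \<beta> * ?g (c (n - 1)) else 0)))) (at z)"
    by simp
qed

lemma shear_ball:
  assumes "r > 0"
  obtains s where "s > 0" "\<And>z. z \<in> ball 0 s \<Longrightarrow> shear \<alpha> \<beta> z \<in> ball 0 r"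
proof -
  have "continuous_on UNIV (shear \<alpha> \<beta>)"
    using bounded_linear.continuous_on[OF bounded_linear_shear continuous_on_id] .
  from open_vimage[OF open_ball[of 0 r] this] have "open (shear \<alpha> \<beta> -` ball 0 r)" .
  moreover have "0 \<in> shear \<alpha> \<beta> -` ball 0 r" using assms by (simp add: shear_def)
  ultimately obtain s where "s > 0" "ball 0 s \<subseteq> shear \<alpha> \<beta> -` ball 0 r" using open_contains_ball by blast
  then show ?thesis using that by blast
qed

text \<open>The field is conjugated by the shear that removes the first and second order of
  \<open>f\<close>, described through \<open>tangent_field\<close>, and carried back. The family
  \<open>Xpar\<close> is stable under this; its coefficients \<open>r0\<close> and
  \<open>p0\<close>, which are 0 in the normalized case, take up the terms of degree 1 and 0 that
  appear.\<close>

theorem normal_form: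
  assumes f: "smooth f" "f 0 = 0" and r: "r > 0" and X: "\<And>i. chol (\<lambda>z. X z $ i) (ball 0 r)" and t: "tang f X (ball 0 r)"
  obtains al be a b q2 q3 r0 p0 s where "s > 0" "s \<le> r"
    "\<And>z j. z \<in> ball 0 s \<Longrightarrow> j \<le> n \<Longrightarrow> X z $ c j = Xpar al be a b q2 q3 r0 p0 z j"
proof -
  define f1 where "f1 = deriv f 0"
  define f2 where "f2 = (deriv ^^ 2) f 0 / 2"
  define p where "p = [:0, - f1, - f2:]"
  define g where "g = (\<lambda>s. f s + poly p s)"
  have g: "smooth g" "g 0 = 0" "deriv g 0 = 0" "(deriv ^^ 2) g 0 = 0"
  proof -
    show "smooth g" unfolding g_def by (rule smooth_add_poly(1)[OF f(1)])
    show "g 0 = 0" by (simp add: g_def p_def f)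
    show "deriv g 0 = 0" using smooth_add_poly(2)[OF f(1), of 1 p] by (simp add: g_def p_def f1_def pderiv_pCons)
    show "(deriv ^^ 2) g 0 = 0" using smooth_add_poly(2)[OF f(1), of 2 p]
      by (simp add: g_def p_def f2_def pderiv_pCons numeral_2_eq_2)
  qed
  \<comment> \<open>The second parameter is \<open>f2 / 2\<close> because a shear changes the
    function by \<open>- 2 * \<beta> * s^2\<close>.\<close>
  let ?A = "shear (- f1) (f2 / 2)" and ?B = "shear f1 (- f2 / 2)"
  have AB: "?A (?B z) = z" and BA: "?B (?A z) = z" for z
    using shear_inverse[of f1 "- f2 / 2" z] shear_inverse[of "- f1" "f2 / 2" z] by simp_all
  have gf: "g s = f s + (- f1) * s - 2 * (f2 / 2) * s\<^sup>2" for s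
    by (simp add: g_def p_def power2_eq_square algebra_simps)
  obtain s1 where s1: "s1 > 0" "\<And>z. z \<in> ball 0 s1 \<Longrightarrow> ?B z \<in> ball 0 r" using shear_ball[OF r, where \<alpha> = f1 and \<beta> = "- f2 / 2"] by blast
  define Y where "Y = (\<lambda>w. ?A (X (?B w)))"
  have cX: "chol (\<lambda>w. X (?B w) $ i) (ball 0 s1)" for i
    by (rule chol_shear[OF X s1(2)])
  have cY: "chol (\<lambda>z. Y z $ i) (ball 0 s1)" for i
  proof -
    have ax: "chol (\<lambda>w. axis k (G w) $ i) (ball 0 s1)" if "chol G (ball 0 s1)" for k and G :: "complex ^ 'm \<Rightarrow> complex"
      using that by (cases "i = k") (simp_all add: axis_def chol_const)
    show ?thesis
      unfolding Y_def shear_def[of "- f1"] vector_add_component by (intro chol_add cX ax chol_cmult)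
  qed
  have tY: "tang g Y (ball 0 s1)"
    unfolding tang_def
  proof
    fix w assume w: "w \<in> M_hyp n c g \<inter> ball 0 s1"
    then have M: "?B w \<in> M_hyp n c f" using w shear_M_hyp[of g f, OF gf, of "?B w"] unfolding AB by blast
    have "X (?B w) \<in> tangent_space (M_hyp n c f) (?B w)"
      unfolding tangent_space_M_hyp[OF f(1) M] using t M s1(2) w unfolding tang_def by blast
    from tangent_space_shear[of g f, OF gf this] have "Y w \<in> tangent_space (M_hyp n c g) w"
      unfolding Y_def AB .
    then show "rc (Y w) 0 = deriv g (rc w 1) * rc (Y w) 1 + d_hyp_poly n (rc w) (rc (Y w))"
      using tangent_space_M_hyp[OF g(1)] w by blast
  qed
  interpret T: tangent_field n c g Y s1
    by unfold_locales (use g s1 cY tY in auto)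
  obtain al be a b q2 q3 where P: "\<And>z j. z \<in> ball 0 s1 \<Longrightarrow> j \<le> n \<Longrightarrow> Y z $ c j = Xpar al be a b q2 q3 0 0 z j"
  proof -
    have "Y z $ c j = Xpar (\<lambda>j. Im (Y 0 $ c j)) (\<lambda>j. if j = 0 then T.D (n - 1) 1 0 else Re (Y 0 $ c j))
      (T.A 1 1 0 - T.A n n 0) (T.A n n 0) (- T.f3 / 2 * Re (Y 0 $ c 1)) (T.B (n - 1) 1 1 0 / 2) 0 0 z j"
      if "z \<in> ball 0 s1" "j \<le> n" for z j
      using T.X_mid[of j z] T.X_zero[of z] T.X_last[of z] that by (cases "j = 0"; cases "j = n") auto
    then show ?thesis by (rule that)
  qed
  \<comment> \<open>The coefficients of the field carried back, found by expanding \<open>?B\<close>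
    applied to the \<open>Xpar\<close> field at \<open>?A z\<close>; the new constant term is
    \<open>p0 = f1 * be 1\<close>.\<close>
  define al' where "al' = (\<lambda>j. if j = 0 then al 0 + f1 * al 1 else if j = n - 1 then al (n - 1) - f2 / 2 * al 1 else al j)"
  define be' where "be' = (\<lambda>j. if j = n - 1 then be (n - 1) - f2 / 2 * be 1 else be j)"
  define q2' where "q2' = q2 + f2 / 2 * (real n - 2) * b"
  define r0' where "r0' = 2 * f2 * be 1 - f1 * (2 * a + real n * b) + f1 * (a + b)"
  obtain s2 where s2: "s2 > 0" "\<And>z. z \<in> ball 0 s2 \<Longrightarrow> ?A z \<in> ball 0 s1" using shear_ball[OF s1(1), where \<alpha> = "- f1" and \<beta> = "f2 / 2"] by blast
  have n1: "n - 1 \<noteq> 1" "n \<noteq> n - 1" "n - 1 \<noteq> 0" "n \<noteq> 0" "1 \<noteq> n" "1 \<le> n" using n4 by auto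
  show ?thesis
  proof (rule that[of "min s2 r"])
    show "min s2 r > 0" "min s2 r \<le> r" using s2 r by auto
    fix z :: "complex ^ 'm" and j assume z: "z \<in> ball 0 (min s2 r)" and j: "j \<le> n"
    define w where "w = ?A z"
    have wb: "w \<in> ball 0 s1" unfolding w_def using s2(2) z by auto
    have Xz: "X z = ?B (Y w)" unfolding Y_def w_def BA by (simp add: BA)
    have w0: "w $ c 0 = z $ c 0 - f1 * z $ c 1" and wn1: "w $ c (n - 1) = z $ c (n - 1) + f2 / 2 * z $ c 1"
      and wj: "\<And>j. j \<le> n \<Longrightarrow> j \<noteq> 0 \<Longrightarrow> j \<noteq> n - 1 \<Longrightarrow> w $ c j = z $ c j"
      unfolding w_def by (simp_all add: shear_nth shear_nth[unfolded One_nat_def])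
    have w1: "w $ c 1 = z $ c 1" by (rule wj) (use n1 in auto)
    have Y1: "Y w $ c 1 = \<i> * al 1 + be 1 + (a + b) * z $ c 1"
      using P[OF wb n1(6)] n1 by (simp add: Xpar_def w1[simplified])
    have "j = 0 \<or> j = n \<or> j = n - 1 \<or> j \<in> {1..<n-1}" using j by auto
    then show "X z $ c j = Xpar al' be' a b q2' q3 r0' (f1 * be 1) z j"
    proof (elim disjE)
      assume [simp]: "j = 0"
      have "(\<Sum>k\<in>{1..<n}. 2 * be k * w $ c (n - k)) = (\<Sum>k\<in>{1..<n}. 2 * be' k * z $ c (n - k)
        + (if k = 1 then be 1 * f2 * z $ c 1 else 0) + (if k = n - 1 then f2 * be 1 * z $ c 1 else 0))"
      proof (rule sum.cong[OF refl])
        fix k assume k: "k \<in> {1..<n}"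
        have nk: "n - k \<le> n" "n - k \<noteq> 0" "n - k = n - 1 \<longleftrightarrow> k = 1" using k by auto
        have "n - (n - 1) = 1" using n1 by auto
        then show "2 * be k * w $ c (n - k) = 2 * be' k * z $ c (n - k)
          + (if k = 1 then be 1 * f2 * z $ c 1 else 0) + (if k = n - 1 then f2 * be 1 * z $ c 1 else 0)"
          using wj[OF nk(1,2)] wn1 nk(3) n1 by (cases "k = 1"; cases "k = n - 1") (auto simp: be'_def algebra_simps)
      qed
      also have "\<dots> = (\<Sum>k\<in>{1..<n}. 2 * be' k * z $ c (n - k)) + 2 * f2 * be 1 * z $ c 1"
      proof -
        have "1 \<in> {1..<n}" "n - 1 \<in> {1..<n}" using n4 by auto
        then show ?thesis unfolding sum.distrib by (simp only: sum.delta[OF finite_atLeastLessThan] if_True) simp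
      qed
      finally have S: "(\<Sum>k\<in>{1..<n}. 2 * be k * w $ c (n - k)) = (\<Sum>k\<in>{1..<n}. 2 * be' k * z $ c (n - k)) + 2 * f2 * be 1 * z $ c 1" .
      have "X z $ c 0 = Y w $ c 0 + f1 * Y w $ c 1" unfolding Xz shear_nth(1) by simp
      then show ?thesis
        unfolding Y1 P[OF wb le0] Xpar_def using S n1
        by (simp add: w0 w1[simplified] al'_def be'_def r0'_def algebra_simps)
    next
      assume [simp]: "j = n"
      have "X z $ c n = Y w $ c n" unfolding Xz by (rule shear_nth(3)) (use n1 in auto)
      then show ?thesis
        unfolding P[OF wb le_refl] Xpar_def using n1 wj[of n] by (simp add: al'_def be'_def)
    next
      assume j': "j = n - 1"
      have "X z $ c (n - 1) = Y w $ c (n - 1) - f2 / 2 * Y w $ c 1" unfolding Xz shear_nth(2) by simp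
      moreover have e: "w $ c n = z $ c n" "w $ c (n - 1 - 1) = z $ c (n - 1 - 1)"
        using n4 by (auto intro!: wj)
      have j2: "2 \<le> n - 1" "n - 1 \<le> n" "n - 1 - 1 \<noteq> n - 1" using n4 by auto
      define T where "T = complex_of_real ((real (n - 1) - 1 - n / 2) * be n) * z $ c (n - 1 - 1)"
      have nr: "real (n - 1) = real n - 1" using n4 by auto
      have "Y w $ c (n - 1) = \<i> * al (n - 1) + be (n - 1) + (a + real (n - 1) * b) * (z $ c (n - 1) + f2 / 2 * z $ c 1)
        + (- be (n - 1 - 1) * z $ c n + T) + ((\<i> * be 0 + q2) * z $ c 1 + q3 * (z $ c 1)\<^sup>2)"
        unfolding P[OF wb j2(2)] Xpar_def e wn1 w1 T_def using n1 j2(1) by simp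
      moreover have "Xpar al' be' a b q2' q3 r0' (f1 * be 1) z (n - 1) = \<i> * (al (n - 1) - f2 / 2 * al 1) + (be (n - 1) - f2 / 2 * be 1)
        + (a + real (n - 1) * b) * z $ c (n - 1)
        + (- be (n - 1 - 1) * z $ c n + T) + ((\<i> * be 0 + (q2 + f2 / 2 * (real n - 2) * b)) * z $ c 1 + q3 * (z $ c 1)\<^sup>2)"
        unfolding Xpar_def T_def al'_def be'_def q2'_def using n4 n1 j2 by simp
      ultimately have "X z $ c (n - 1) = Xpar al' be' a b q2' q3 r0' (f1 * be 1) z (n - 1)"
        unfolding Y1 nr by (simp only: of_real_add of_real_mult of_real_diff of_real_divide of_real_1 of_real_numeral)
          (simp add: field_simps)
      then show ?thesis unfolding j' .
    next
      assume j': "j \<in> {1..<n-1}"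
      have jn: "j \<noteq> 0" "j \<noteq> n - 1" "j \<noteq> n" "j - 1 \<noteq> n - 1" using j' by auto
      have "X z $ c j = Y w $ c j" unfolding Xz by (rule shear_nth(3)) (use j jn in auto)
      moreover have "w $ c n = z $ c n" "w $ c j = z $ c j" "2 \<le> j \<Longrightarrow> w $ c (j - 1) = z $ c (j - 1)"
        using n4 j jn by (auto intro!: wj)
      ultimately show ?thesis
        using P[OF wb j] jn n1 unfolding Xpar_def by (simp add: al'_def be'_def)
    qed
  qed
qed

end

section \<open>Dimensions\<close>

text \<open>The space of germs has infinite dimension, so the argument runs through a basis of
  \<open>S\<close> instead of theorems on Euclidean spaces.\<close>

lemma dim_injective_linear_image:
  fixes g :: "'a::real_vector \<Rightarrow> 'b::real_vector"
  assumes "linear g" "inj g"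
  shows "dim (g ` S) = dim S"
proof -
  obtain B where B: "B \<subseteq> S" "independent B" "S \<subseteq> span B" "card B = dim S" by (rule basis_exists)
  have "g ` S \<subseteq> span (g ` B)" using B(3) unfolding linear_span_image[OF assms(1)] by blast
  moreover have "independent (g ` B)"
    using linear_independent_injective_image[OF assms(1) B(2)] assms(2) by (meson inj_on_subset subset_UNIV)
  ultimately have "card (g ` B) = dim (g ` S)" using B(1) by (intro basis_card_eq_dim) auto
  then show ?thesis using B(4) card_image[of g B] assms(2) by (metis inj_on_subset subset_UNIV)
qed

lemma dim_orthogonal_set:
  fixes V :: "'a::euclidean_space set"
  assumes "pairwise orthogonal V" "0 \<notin> V"
  shows "dim {y. \<forall>v\<in>V. v \<bullet> y = 0} + card V = DIM('a)"
proof -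
  have "{y \<in> UNIV. \<forall>x \<in> span V. orthogonal x y} = {y. \<forall>v\<in>V. v \<bullet> y = 0}"
    by (auto simp: orthogonal_def dest: span_base) (metis orthogonal_commute orthogonal_def orthogonal_to_span)
  with dim_subspace_orthogonal_to_vectors[of "span V" "UNIV :: 'a set"]
  have "dim {y. \<forall>v\<in>V. v \<bullet> y = 0} + dim V = DIM('a)" by simp
  then show ?thesis
    using dim_eq_card_independent[OF pairwise_orthogonal_independent[OF assms]] by simp
qed

context indexed
begin

text \<open>The Taylor coefficients of \<open>(b1 + (a + b) s) f' - (2 a + n b) f\<close>.\<close>

definition ode_coeff :: "(real \<Rightarrow> real) \<Rightarrow> real \<Rightarrow> real \<Rightarrow> real \<Rightarrow> nat \<Rightarrow> real" where
  "ode_coeff f b1 a b k = b1 * ((deriv ^^ Suc k) f 0 / fact k) + (real k * (a + b) - (2 * a + real n * b)) * ((deriv ^^ k) f 0 / fact k)"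

lemma jet_ode_coeff:
  assumes "smooth f"
  shows "jet N (\<lambda>s. (b1 + (a + b) * s) * deriv f s - (2 * a + real n * b) * f s) (ode_coeff f b1 a b)"
proof -
  have d: "jet N (deriv f) (\<lambda>i. (deriv ^^ Suc i) f 0 / fact i)"
    using jet_smooth[OF assms, of N 1] by simp
  have "jet N (\<lambda>s. b1 * deriv f s + (a + b) * s ^ 1 * deriv f s + - (2 * a + real n * b) * f s)
    (\<lambda>i. b1 * ((deriv ^^ Suc i) f 0 / fact i) + (if 1 \<le> i then (a + b) * ((deriv ^^ Suc (i - 1)) f 0 / fact (i - 1)) else 0)
      + - (2 * a + real n * b) * ((deriv ^^ i) f 0 / fact i))"
    using jet_smooth[OF assms, of N 0] by (intro jet_add jet_cmult jet_monom_mult d) simp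
  then have "jet N (\<lambda>s. b1 * deriv f s + (a + b) * s ^ 1 * deriv f s + - (2 * a + real n * b) * f s) (ode_coeff f b1 a b)"
  proof (rule jet_cong)
    fix i
    have "real i * ((deriv ^^ i) f 0 / fact i) = (deriv ^^ Suc (i - 1)) f 0 / fact (i - 1)" if "1 \<le> i"
      using that by (cases i) (simp_all del: of_nat_Suc)
    then have e: "(if 1 \<le> i then (a + b) * ((deriv ^^ Suc (i - 1)) f 0 / fact (i - 1)) else 0)
      = (a + b) * (real i * ((deriv ^^ i) f 0 / fact i))"
      by (cases "i = 0") auto
    show "b1 * ((deriv ^^ Suc i) f 0 / fact i) + (if 1 \<le> i then (a + b) * ((deriv ^^ Suc (i - 1)) f 0 / fact (i - 1)) else 0)
      + - (2 * a + real n * b) * ((deriv ^^ i) f 0 / fact i) = ode_coeff f b1 a b i"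
      unfolding ode_coeff_def e by (simp add: algebra_simps add_divide_distrib)
  qed
  then show ?thesis by (simp add: algebra_simps)
qed

text \<open>The correction in \<open>ode_defect\<close> is a general cubic polynomial, so the
  equation forces its coefficients to be the first four Taylor coefficients of the rest; dividing by
  \<open>-2\<close> and \<open>-4/3\<close> gives \<open>q2\<close> and \<open>q3\<close>.\<close>

lemma ode_defect_coeffs:
  assumes f: "smooth f" and ode: "\<forall>\<^sub>F s in nhds 0. ode_defect f be a b q2 q3 r0 p0 s = 0"
  shows "p0 = ode_coeff f (be 1) a b 0" "r0 = ode_coeff f (be 1) a b 1" "q2 = - ode_coeff f (be 1) a b 2 / 2" "q3 = - 3 / 4 * ode_coeff f (be 1) a b 3"
proof -
  have "jet 3 (\<lambda>s. (be 1 + (a + b) * s) * deriv f s - (2 * a + real n * b) * f s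
      + - p0 * s ^ 0 + - r0 * s ^ 1 + 2 * q2 * s ^ 2 + 4 / 3 * q3 * s ^ 3)
    (\<lambda>i. ode_coeff f (be 1) a b i + (if i = 0 then - p0 else 0) + (if i = 1 then - r0 else 0)
      + (if i = 2 then 2 * q2 else 0) + (if i = 3 then 4 / 3 * q3 else 0))"
    by (intro jet_add jet_ode_coeff[OF f] jet_monom)
  then have J: "jet 3 (ode_defect f be a b q2 q3 r0 p0)
    (\<lambda>i. ode_coeff f (be 1) a b i + (if i = 0 then - p0 else 0) + (if i = 1 then - r0 else 0)
      + (if i = 2 then 2 * q2 else 0) + (if i = 3 then 4 / 3 * q3 else 0))"
    by (simp add: ode_defect_def[abs_def] algebra_simps)
  show "p0 = ode_coeff f (be 1) a b 0" "r0 = ode_coeff f (be 1) a b 1" "q2 = - ode_coeff f (be 1) a b 2 / 2" "q3 = - 3 / 4 * ode_coeff f (be 1) a b 3"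
    using jet_zero[OF J ode, of 0] jet_zero[OF J ode, of 1] jet_zero[OF J ode, of 2] jet_zero[OF J ode, of 3]
    by simp_all
qed

text \<open>The dependent coefficients are substituted as linear functions of the parameters, which
  keeps the whole field linear in them. Only parameters whose \<open>vf_defect\<close> vanishes near
  0 give tangent fields.\<close>

definition vf :: "(real \<Rightarrow> real) \<Rightarrow> (real ^ 'm) \<times> (real ^ 'm) \<times> real \<times> real \<Rightarrow> complex ^ 'm \<Rightarrow> complex ^ 'm" where
  "vf f = (\<lambda>(\<alpha>, \<beta>, a, b) z. \<chi> i. Xpar (\<lambda>j. \<alpha> $ c j) (\<lambda>j. \<beta> $ c j) a b
     (- ode_coeff f (\<beta> $ c 1) a b 2 / 2) (- 3 / 4 * ode_coeff f (\<beta> $ c 1) a b 3) (ode_coeff f (\<beta> $ c 1) a b 1) (ode_coeff f (\<beta> $ c 1) a b 0)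
     z (inv_into {0..n} c i))"

definition vf_defect :: "(real \<Rightarrow> real) \<Rightarrow> (real ^ 'm) \<times> (real ^ 'm) \<times> real \<times> real \<Rightarrow> real \<Rightarrow> real" where
  "vf_defect f = (\<lambda>(\<alpha>, \<beta>, a, b). ode_defect f (\<lambda>j. \<beta> $ c j) a b
     (- ode_coeff f (\<beta> $ c 1) a b 2 / 2) (- 3 / 4 * ode_coeff f (\<beta> $ c 1) a b 3) (ode_coeff f (\<beta> $ c 1) a b 1) (ode_coeff f (\<beta> $ c 1) a b 0))"

lemma inv_c: "j \<le> n \<Longrightarrow> inv_into {0..n} c (c j) = j"
  using bij unfolding bij_betw_def by (simp add: inv_into_f_f)

lemma vf_nth:
  "j \<le> n \<Longrightarrow> vf f (\<alpha>, \<beta>, a, b) z $ c j = Xpar (\<lambda>j. \<alpha> $ c j) (\<lambda>j. \<beta> $ c j) a b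
     (- ode_coeff f (\<beta> $ c 1) a b 2 / 2) (- 3 / 4 * ode_coeff f (\<beta> $ c 1) a b 3) (ode_coeff f (\<beta> $ c 1) a b 1) (ode_coeff f (\<beta> $ c 1) a b 0) z j"
  unfolding vf_def by (simp add: inv_c)

lemma Xpar_cong:
  assumes "\<And>i. i \<le> n \<Longrightarrow> al i = al' i" "\<And>i. i \<le> n \<Longrightarrow> be i = be' i" "j \<le> n"
  shows "Xpar al be a b q2 q3 r0 p0 z j = Xpar al' be' a b q2 q3 r0 p0 z j"
proof -
  have "(\<Sum>k\<in>{1..<n}. 2 * of_real (be k) * z $ c (n - k)) = (\<Sum>k\<in>{1..<n}. 2 * of_real (be' k) * z $ c (n - k))"
    by (rule sum.cong) (auto simp: assms(2))
  then show ?thesis unfolding Xpar_def using assms by simp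
qed

lemma vf_add: "vf f (e + e') z = vf f e z + vf f e' z"
proof -
  obtain \<alpha> \<beta> a b \<alpha>' \<beta>' a' b' where e: "e = (\<alpha>, \<beta>, a, b)" "e' = (\<alpha>', \<beta>', a', b')"
    by (metis prod.exhaust)
  have ode_coeff: "ode_coeff f (\<beta> $ c 1 + \<beta>' $ c 1) (a + a') (b + b') k = ode_coeff f (\<beta> $ c 1) a b k + ode_coeff f (\<beta>' $ c 1) a' b' k" for k
    unfolding ode_coeff_def by (simp add: algebra_simps)
  show ?thesis
    unfolding vec_eq_c
  proof (intro allI impI)
    fix j assume j: "j \<le> n"
    have S: "(\<Sum>k\<in>{1..<n}. 2 * of_real (\<beta> $ c k + \<beta>' $ c k) * z $ c (n - k))
      = (\<Sum>k\<in>{1..<n}. 2 * of_real (\<beta> $ c k) * z $ c (n - k)) + (\<Sum>k\<in>{1..<n}. 2 * of_real (\<beta>' $ c k) * z $ c (n - k))"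
      unfolding sum.distrib[symmetric] by (intro sum.cong) (auto simp: algebra_simps)
    show "vf f (e + e') z $ c j = (vf f e z + vf f e' z) $ c j"
      unfolding e add_Pair vector_add_component vf_nth[OF j] ode_coeff Xpar_def S
      by (simp add: algebra_simps add_divide_distrib diff_divide_distrib)
  qed
qed

lemma vf_scaleR: "vf f (r *\<^sub>R e) z = r *\<^sub>R vf f e z"
proof -
  obtain \<alpha> \<beta> a b where e: "e = (\<alpha>, \<beta>, a, b)" by (metis prod.exhaust)
  have ode_coeff: "ode_coeff f (r * \<beta> $ c 1) (r * a) (r * b) k = r * ode_coeff f (\<beta> $ c 1) a b k" for k
    unfolding ode_coeff_def by (simp add: algebra_simps)
  show ?thesis
    unfolding vec_eq_c
  proof (intro allI impI)
    fix j assume j: "j \<le> n"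
    have S: "(\<Sum>k\<in>{1..<n}. 2 * of_real (r * \<beta> $ c k) * z $ c (n - k))
      = of_real r * (\<Sum>k\<in>{1..<n}. 2 * of_real (\<beta> $ c k) * z $ c (n - k))"
      unfolding sum_distrib_left by (intro sum.cong) (auto simp: algebra_simps)
    show "vf f (r *\<^sub>R e) z $ c j = (r *\<^sub>R vf f e z) $ c j"
      unfolding e scaleR_Pair vector_scaleR_component vf_nth[OF j] real_scaleR_def ode_coeff Xpar_def S
      by (simp add: scaleR_conv_of_real algebra_simps)
  qed
qed

lemma linear_germ_vf: "linear (\<lambda>e. germ (vf f e))"
proof (rule linearI)
  fix e e' :: "(real ^ 'm) \<times> (real ^ 'm) \<times> real \<times> real" and r :: real
  have "vf f (e + e') = (\<lambda>z. vf f e z + vf f e' z)" by (rule ext) (rule vf_add)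
  then show "germ (vf f (e + e')) = germ (vf f e) + germ (vf f e')" by (simp only: plus_vf_germ.abs_eq)
  have "vf f (r *\<^sub>R e) = (\<lambda>z. r *\<^sub>R vf f e z)" by (rule ext) (rule vf_scaleR)
  then show "germ (vf f (r *\<^sub>R e)) = r *\<^sub>R germ (vf f e)" by (simp only: scaleR_vf_germ.abs_eq)
qed

lemma Xpar_at_0: "Xpar al be a b q2 q3 r0 p0 0 j = \<i> * al j + (if j = 0 then p0 else be j)"
  unfolding Xpar_def by simp

lemma inj_germ_vf: "inj (\<lambda>e. germ (vf f e))"
  unfolding linear_injective_0[OF linear_germ_vf]
proof (intro allI impI)
  fix e assume "germ (vf f e) = 0"
  then have "\<forall>\<^sub>F z in nhds 0. vf f e z = 0" unfolding zero_vf_germ_def vf_germ.abs_eq_iff .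
  then obtain r where r: "r > 0" "\<And>z. z \<in> ball 0 r \<Longrightarrow> vf f e z = 0"
    unfolding eventually_nhds_metric by (auto simp: dist_commute)
  obtain \<alpha> \<beta> a b where e: "e = (\<alpha>, \<beta>, a, b)" by (metis prod.exhaust)
  \<comment> \<open>A small nonzero real number: points on the axes \<open>n\<close>, 2 and 1 yield
    in turn \<open>b\<close>, \<open>a\<close> and, through the imaginary part, the entry of
    \<open>\<beta>\<close> at \<open>c 0\<close>.\<close>
  define d where "d = complex_of_real (r / 2)"
  have d: "d \<noteq> 0" "axis k d \<in> ball 0 r" "(0 :: complex ^ 'm) \<in> ball 0 r" for k :: 'm
  proof -
    have "norm (axis k d) = norm d" by (simp add: norm_eq_sqrt_inner inner_axis_axis)
    then show "axis k d \<in> ball 0 r" using r(1) by (simp add: d_def)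
  qed (use r(1) in \<open>auto simp: d_def\<close>)
  let ?X = "Xpar (\<lambda>j. \<alpha> $ c j) (\<lambda>j. \<beta> $ c j) a b
     (- ode_coeff f (\<beta> $ c 1) a b 2 / 2) (- 3 / 4 * ode_coeff f (\<beta> $ c 1) a b 3) (ode_coeff f (\<beta> $ c 1) a b 1) (ode_coeff f (\<beta> $ c 1) a b 0)"
  have X: "?X z j = 0" if "z \<in> ball 0 r" "j \<le> n" for z j
    using vf_nth[OF that(2), of f \<alpha> \<beta> a b z] r(2)[OF that(1)] unfolding e by simp
  have n: "n \<noteq> 0" "n \<noteq> n - 1" "n - 1 \<noteq> 0" "2 \<noteq> n" "2 \<noteq> n - 1" "2 \<le> n" "2 \<le> n - 1" "1 \<le> n" "n - 1 \<le> n" "n - 1 - 1 \<noteq> 1" using n4 by auto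
  have \<alpha>\<beta>: "\<alpha> $ c j = 0 \<and> (j \<noteq> 0 \<longrightarrow> \<beta> $ c j = 0)" if "j \<le> n" for j
    using X[OF d(3) that] unfolding Xpar_at_0 by (cases "j = 0") (simp_all add: complex_eq_iff)
  have b: "b = 0"
    using X[OF d(2) le_refl, of "c n"] n(1) d(1) \<alpha>\<beta>[OF le_refl] unfolding Xpar_def by simp
  have a: "a = 0"
    using X[OF d(2) n(6), of "c 2"] n d(1) b \<alpha>\<beta>[OF n(6)] \<alpha>\<beta>[OF n(8)] \<alpha>\<beta>[OF le_refl] unfolding Xpar_def by simp
  have "axis (c 1) d $ c n = 0" "axis (c 1) d $ c (n - 1) = 0" "axis (c 1) d $ c (n - 1 - 1) = 0" "axis (c 1) d $ c 1 = d"
    using n4 by (auto simp: axis_def c_eq_iff)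
  then have "(\<i> * \<beta> $ c 0 + complex_of_real (- ode_coeff f (\<beta> $ c 1) a b 2 / 2)) * d + complex_of_real (- 3 / 4 * ode_coeff f (\<beta> $ c 1) a b 3) * d\<^sup>2 = 0"
    using X[OF d(2) n(9), of "c 1"] n a b \<alpha>\<beta>[OF n(9)] unfolding Xpar_def by simp
  from arg_cong[OF this, of Im] have "\<beta> $ c 0 = 0"
    using r(1) by (simp add: d_def power2_eq_square)
  with \<alpha>\<beta> have "\<alpha> $ c j = 0" "\<beta> $ c j = 0" if "j \<le> n" for j using that by (cases "j = 0"; auto)+
  then have "\<alpha> = 0" "\<beta> = 0" by (auto simp: vec_eq_c)
  then show "e = 0" unfolding e using a b by (simp add: zero_prod_def)
qed

lemma chol_Xpar: "chol (\<lambda>z. Xpar al be a b q2 q3 r0 p0 z j) U"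
proof -
  have p: "z ^ 3 = z * (z * z)" for z :: complex by (simp add: eval_nat_numeral)
  have i: "chol G U \<Longrightarrow> chol H U \<Longrightarrow> chol (\<lambda>z. if P then G z else H z) U" for P and G H :: "complex ^ 'm \<Rightarrow> complex"
    by (cases P) simp_all
  show ?thesis
    unfolding Xpar_def power2_eq_square p by (intro i chol_add chol_sum chol_mult chol_const chol_nth)
qed

lemma hol_M_hyp_eq:
  assumes f: "smooth f" "f 0 = 0"
  shows "hol (M_hyp n c f) = (\<lambda>e. germ (vf f e)) ` {e. \<forall>\<^sub>F s in nhds 0. vf_defect f e s = 0}"
proof (intro equalityI subsetI)
  fix g assume "g \<in> hol (M_hyp n c f)"
  then obtain X r where X: "g = germ X" "r > 0" "\<And>i. chol (\<lambda>z. X z $ i) (ball 0 r)" "tang f X (ball 0 r)"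
    unfolding mem_hol_M_hyp[OF f(1)] by blast
  obtain al be a b q2 q3 r0 p0 s where s: "s > 0" "s \<le> r"
    and P: "\<And>z j. z \<in> ball 0 s \<Longrightarrow> j \<le> n \<Longrightarrow> X z $ c j = Xpar al be a b q2 q3 r0 p0 z j"
    using normal_form[OF f X(2,3,4)] by metis
  define \<alpha> :: "real ^ 'm" where "\<alpha> = (\<chi> i. al (inv_into {0..n} c i))"
  define \<beta> :: "real ^ 'm" where "\<beta> = (\<chi> i. be (inv_into {0..n} c i))"
  have \<alpha>\<beta>: "\<alpha> $ c j = al j" "\<beta> $ c j = be j" if "j \<le> n" for j
    using that by (simp_all add: \<alpha>_def \<beta>_def inv_c)
  have n1: "1 \<le> n" using n4 by simp
  have ode: "\<forall>\<^sub>F s in nhds 0. ode_defect f be a b q2 q3 r0 p0 s = 0"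
  proof (rule tang_imp_ode(1)[OF f s(1)])
    show "tang f X (ball 0 s)" using X(4) s(2) unfolding tang_def by auto
  qed (use P in auto)
  note co = ode_defect_coeffs[OF f(1) ode, folded \<alpha>\<beta>(2)[OF n1]]
  have "\<forall>\<^sub>F s in nhds 0. vf_defect f (\<alpha>, \<beta>, a, b) s = 0"
    using ode unfolding vf_defect_def prod.case co[symmetric] unfolding ode_defect_def \<alpha>\<beta>(2)[OF n1] .
  moreover have "X z = vf f (\<alpha>, \<beta>, a, b) z" if "z \<in> ball 0 s" for z
    unfolding vec_eq_c
  proof (intro allI impI)
    fix j assume j: "j \<le> n"
    show "X z $ c j = vf f (\<alpha>, \<beta>, a, b) z $ c j"
      unfolding vf_nth[OF j] co[symmetric] P[OF that j] by (rule Xpar_cong) (use \<alpha>\<beta> j in auto)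
  qed
  then have "\<forall>\<^sub>F z in nhds 0. X z = vf f (\<alpha>, \<beta>, a, b) z"
    using s(1) by (intro eventually_nhds_in_open[THEN eventually_mono, of "ball 0 s"]) auto
  then have "g = germ (vf f (\<alpha>, \<beta>, a, b))" unfolding X(1) vf_germ.abs_eq_iff .
  ultimately show "g \<in> (\<lambda>e. germ (vf f e)) ` {e. \<forall>\<^sub>F s in nhds 0. vf_defect f e s = 0}" by blast
next
  fix g assume "g \<in> (\<lambda>e. germ (vf f e)) ` {e. \<forall>\<^sub>F s in nhds 0. vf_defect f e s = 0}"
  then obtain e where e: "g = germ (vf f e)" "\<forall>\<^sub>F s in nhds 0. vf_defect f e s = 0" by blast
  obtain \<alpha> \<beta> a b where e': "e = (\<alpha>, \<beta>, a, b)" by (metis prod.exhaust)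
  obtain r where r: "r > 0" "\<And>s. \<bar>s\<bar> < r \<Longrightarrow> vf_defect f e s = 0"
    using e(2) unfolding eventually_nhds_metric by (auto simp: dist_real_def)
  have "chol (\<lambda>z. vf f e z $ i) (ball 0 r)" for i
    unfolding e' vf_def prod.case vec_lambda_beta by (rule chol_Xpar)
  moreover have "tang f (vf f e) (ball 0 r)"
    by (rule ode_imp_tang[OF r(2)[unfolded e' vf_defect_def prod.case]]) (simp_all add: e' vf_nth)
  ultimately show "g \<in> hol (M_hyp n c f)"
    unfolding mem_hol_M_hyp[OF f(1)] using e(1) r(1) by blast
qed

lemma dim_hol_M_hyp:
  "smooth f \<Longrightarrow> f 0 = 0 \<Longrightarrow> dim (hol (M_hyp n c f)) = dim {e. \<forall>\<^sub>F s in nhds 0. vf_defect f e s = 0}"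
  unfolding hol_M_hyp_eq by (rule dim_injective_linear_image[OF linear_germ_vf inj_germ_vf])

section \<open>Counting the conditions on the parameters\<close>

lemma DIM_parameters: "DIM((real ^ 'm) \<times> (real ^ 'm) \<times> real \<times> real) = 2 * n + 4"
  using bij_betw_same_card[OF bij] by simp

text \<open>The defect is the remainder after the cubic Taylor polynomial, so its vanishing says
  that the left-hand side of the differential equation is a polynomial of degree at most three near
  0.\<close>

lemma vf_defect_eq:
  "vf_defect f (\<alpha>, \<beta>, a, b) s = (\<beta> $ c 1 + (a + b) * s) * deriv f s - (2 * a + real n * b) * f s
    - (\<Sum>k\<le>3. ode_coeff f (\<beta> $ c 1) a b k * s ^ k)"
  unfolding vf_defect_def ode_defect_def by (simp add: eval_nat_numeral)

lemma dim_parameters_zero: "dim ({(\<alpha>, \<beta>, a, b). \<beta> $ c 1 = 0 \<and> a = 0 \<and> b = 0} :: ((real ^ 'm) \<times> (real ^ 'm) \<times> real \<times> real) set) = 2 * n + 1"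
proof -
  let ?u = "(0, axis (c 1) 1, 0, 0) :: (real ^ 'm) \<times> (real ^ 'm) \<times> real \<times> real"
  let ?v = "(0, 0, 1, 0) :: (real ^ 'm) \<times> (real ^ 'm) \<times> real \<times> real"
  let ?w = "(0, 0, 0, 1) :: (real ^ 'm) \<times> (real ^ 'm) \<times> real \<times> real"
  have "dim {y. \<forall>x\<in>{?u, ?v, ?w}. x \<bullet> y = 0} + card {?u, ?v, ?w} = 2 * n + 4"
    unfolding DIM_parameters[symmetric]
    by (rule dim_orthogonal_set) (auto simp: pairwise_insert orthogonal_def zero_prod_def)
  moreover have "{y. \<forall>x\<in>{?u, ?v, ?w}. x \<bullet> y = 0} = {(\<alpha>, \<beta>, a, b). \<beta> $ c 1 = 0 \<and> a = 0 \<and> b = 0}"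
    by (auto simp: inner_axis')
  moreover have "card {?u, ?v, ?w} = 3" by simp
  ultimately show ?thesis by simp
qed

lemma dim_hol_bounds:
  assumes "smooth f" "f 0 = 0"
  shows "2 * n + 1 \<le> dim (hol (M_hyp n c f))" "dim (hol (M_hyp n c f)) \<le> 2 * n + 4"
proof -
  have "({(\<alpha>, \<beta>, a, b). \<beta> $ c 1 = 0 \<and> a = 0 \<and> b = 0} :: ((real ^ 'm) \<times> (real ^ 'm) \<times> real \<times> real) set) \<subseteq> {e. \<forall>\<^sub>F s in nhds 0. vf_defect f e s = 0}"
    by (auto simp: vf_defect_eq ode_coeff_def)
  from dim_subset[OF this] show "2 * n + 1 \<le> dim (hol (M_hyp n c f))"
    unfolding dim_hol_M_hyp[OF assms] dim_parameters_zero .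
  show "dim (hol (M_hyp n c f)) \<le> 2 * n + 4"
    unfolding dim_hol_M_hyp[OF assms] DIM_parameters[symmetric] by (rule dim_subset_UNIV)
qed

text \<open>The conditions are the coefficients of \<open>s^4\<close>, \<open>s^5\<close> and
  \<open>s^6\<close> in \<open>(b1 + (a + b) s) f' - (2 a + n b) f\<close>; the term
  \<open>4 x b1 s^3\<close> is absorbed by the cubic Taylor polynomial. A monomial
  \<open>s^4\<close> therefore leaves \<open>b1\<close> free, \<open>s^5\<close> does not, and
  \<open>s^5 + s^6\<close> separates \<open>a\<close> from \<open>b\<close>.\<close>

lemma dim_hol_sextic:
  fixes x y w :: real
  defines "f \<equiv> poly [:0, 0, 0, 0, x, y, w:]"
  shows "smooth f" "f 0 = 0"
    "dim (hol (M_hyp n c f)) = dim ({(\<alpha>, \<beta>, a, b).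
       5 * y * \<beta> $ c 1 + (4 * (a + b) - (2 * a + real n * b)) * x = 0 \<and>
       6 * w * \<beta> $ c 1 + (5 * (a + b) - (2 * a + real n * b)) * y = 0 \<and>
       (6 * (a + b) - (2 * a + real n * b)) * w = 0} :: ((real ^ 'm) \<times> (real ^ 'm) \<times> real \<times> real) set)"
proof -
  show s: "smooth f" unfolding f_def by (rule smooth_poly)
  show f0: "f 0 = 0" by (simp add: f_def)
  have dk: "(deriv ^^ k) f = poly ((pderiv ^^ k) [:0, 0, 0, 0, x, y, w:])" for k
    unfolding f_def by (rule smooth_poly(2))
  have d1: "deriv f s = 4 * x * s ^ 3 + 5 * y * s ^ 4 + 6 * w * s ^ 5" for s
    using fun_cong[OF dk[of 1], of s] by (simp add: pderiv_pCons algebra_simps eval_nat_numeral)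
  have t: "ode_coeff f b1 a b k = (if k = 3 then 4 * x * b1 else 0)" if "k \<le> 3" for b1 a b k
  proof -
    have "k = 0 \<or> k = 1 \<or> k = 2 \<or> k = 3" using that by auto
    then show ?thesis unfolding ode_coeff_def dk by (auto simp: pderiv_pCons eval_nat_numeral)
  qed
  have "(\<forall>\<^sub>F s in nhds 0. vf_defect f (\<alpha>, \<beta>, a, b) s = 0) \<longleftrightarrow>
       5 * y * \<beta> $ c 1 + (4 * (a + b) - (2 * a + real n * b)) * x = 0 \<and>
       6 * w * \<beta> $ c 1 + (5 * (a + b) - (2 * a + real n * b)) * y = 0 \<and>
       (6 * (a + b) - (2 * a + real n * b)) * w = 0" (is "?L \<longleftrightarrow> ?p = 0 \<and> ?q = 0 \<and> ?r = 0") for \<alpha> \<beta> a b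
  proof -
    have "(\<Sum>k\<le>3. ode_coeff f (\<beta> $ c 1) a b k * s ^ k) = 4 * x * \<beta> $ c 1 * s ^ 3" for s
      by (simp add: t eval_nat_numeral)
    then have *: "vf_defect f (\<alpha>, \<beta>, a, b) = (\<lambda>s. ?p * s ^ 4 + ?q * s ^ 5 + ?r * s ^ 6)"
      unfolding vf_defect_eq[abs_def] d1 by (auto simp: fun_eq_iff f_def algebra_simps eval_nat_numeral)
    have J: "jet 6 (\<lambda>s. ?p * s ^ 4 + ?q * s ^ 5 + ?r * s ^ 6)
      (\<lambda>i. (if i = 4 then ?p else 0) + (if i = 5 then ?q else 0) + (if i = 6 then ?r else 0))"
      by (intro jet_add jet_monom)
    show ?thesis
    proof
      assume ?L
      then have "\<forall>\<^sub>F s in nhds 0. ?p * s ^ 4 + ?q * s ^ 5 + ?r * s ^ 6 = 0" unfolding * .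
      from jet_zero[OF J this, of 4] jet_zero[OF J this, of 5] jet_zero[OF J this, of 6]
      show "?p = 0 \<and> ?q = 0 \<and> ?r = 0" by simp
    next
      assume "?p = 0 \<and> ?q = 0 \<and> ?r = 0"
      then show ?L unfolding * by simp
    qed
  qed
  then show "dim (hol (M_hyp n c f)) = dim ({(\<alpha>, \<beta>, a, b).
       5 * y * \<beta> $ c 1 + (4 * (a + b) - (2 * a + real n * b)) * x = 0 \<and>
       6 * w * \<beta> $ c 1 + (5 * (a + b) - (2 * a + real n * b)) * y = 0 \<and>
       (6 * (a + b) - (2 * a + real n * b)) * w = 0} :: ((real ^ 'm) \<times> (real ^ 'm) \<times> real \<times> real) set)"
    unfolding dim_hol_M_hyp[OF s f0] by (intro arg_cong[of _ _ dim]) auto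
qed

lemma dim_hol_0: "dim (hol (M_hyp n c (poly [:0, 0, 0, 0, 0, 0, 0:]))) = 2 * n + 4"
  unfolding dim_hol_sextic(3) DIM_parameters[symmetric] by (simp add: case_prod_unfold)

lemma dim_hol_x4: "dim (hol (M_hyp n c (poly [:0, 0, 0, 0, 1, 0, 0:]))) = 2 * n + 3"
proof -
  \<comment> \<open>The normal vector of the hyperplane
    \<open>4 (a + b) - (2 a + n b) = 2 a + (4 - n) b = 0\<close>.\<close>
  let ?u = "(0, 0, 2, 4 - real n) :: (real ^ 'm) \<times> (real ^ 'm) \<times> real \<times> real"
  have "dim {y. \<forall>x\<in>{?u}. x \<bullet> y = 0} + card {?u} = 2 * n + 4"
    unfolding DIM_parameters[symmetric]
    by (rule dim_orthogonal_set) (simp_all add: zero_prod_def)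
  moreover have "{y. \<forall>x\<in>{?u}. x \<bullet> y = 0} = {(\<alpha>, \<beta>, a, b). 4 * (a + b) - (2 * a + real n * b) = 0}"
    by (auto simp: algebra_simps)
  ultimately show ?thesis unfolding dim_hol_sextic(3) by simp
qed

lemma dim_hol_x5: "dim (hol (M_hyp n c (poly [:0, 0, 0, 0, 0, 1, 0:]))) = 2 * n + 2"
proof -
  let ?u = "(0, axis (c 1) 1, 0, 0) :: (real ^ 'm) \<times> (real ^ 'm) \<times> real \<times> real"
  \<comment> \<open>The normal vector of
    \<open>5 (a + b) - (2 a + n b) = 3 a + (5 - n) b = 0\<close>; it is orthogonal to
    \<open>?u\<close>, as \<open>dim_orthogonal_set\<close> requires.\<close>
  let ?v = "(0, 0, 3, 5 - real n) :: (real ^ 'm) \<times> (real ^ 'm) \<times> real \<times> real"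
  have "dim {y. \<forall>x\<in>{?u, ?v}. x \<bullet> y = 0} + card {?u, ?v} = 2 * n + 4"
    unfolding DIM_parameters[symmetric]
    by (rule dim_orthogonal_set) (simp_all add: pairwise_insert orthogonal_def zero_prod_def)
  moreover have "{y. \<forall>x\<in>{?u, ?v}. x \<bullet> y = 0} = {(\<alpha>, \<beta>, a, b). \<beta> $ c 1 = 0 \<and> 5 * (a + b) - (2 * a + real n * b) = 0}"
    by (auto simp: inner_axis' algebra_simps)
  moreover have "card {?u, ?v} = 2" by simp
  ultimately show ?thesis unfolding dim_hol_sextic(3) by simp
qed

lemma dim_hol_x5_x6: "dim (hol (M_hyp n c (poly [:0, 0, 0, 0, 0, 1, 1:]))) = 2 * n + 1"
proof -
  have *: "5 * 1 * t + (4 * (a + b) - (2 * a + real n * b)) * 0 = 0 \<and>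
       6 * 1 * t + (5 * (a + b) - (2 * a + real n * b)) * 1 = 0 \<and>
       (6 * (a + b) - (2 * a + real n * b)) * 1 = 0 \<longleftrightarrow> t = 0 \<and> a = 0 \<and> b = 0" (is "?L \<longleftrightarrow> ?R") for t a b :: real
  proof
    assume ?L
    then have t: "t = 0" and e: "5 * (a + b) - (2 * a + real n * b) = 0" "6 * (a + b) - (2 * a + real n * b) = 0"
      by simp_all
    \<comment> \<open>Invariance of both \<open>s^5\<close> and \<open>s^6\<close> under the same
      scaling forces \<open>a + b = 0\<close>; then \<open>n > 2\<close> forces
      \<open>b = 0\<close>.\<close>
    have "(6 * (a + b) - (2 * a + real n * b)) - (5 * (a + b) - (2 * a + real n * b)) = 0"
      unfolding e by simp
    then have "a + b = 0" by (simp only: diff_diff_eq2 diff_add_cancel) simp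
    then have a: "a = - b" by simp
    have "(real n - 2) * b = 0" using e(1) unfolding a by (simp add: left_diff_distrib)
    then show ?R using a t n4 by simp
  qed simp
  show ?thesis unfolding dim_hol_sextic(3) * by (rule dim_parameters_zero)
qed

end

theorem theorem1p5:
  fixes n :: nat and c :: "nat \<Rightarrow> 'm::finite"
  assumes "n > 4"
    and "bij_betw c {0..n} UNIV"
  shows "(\<forall>f. smooth f \<and> f 0 = 0 \<longrightarrow>
            2 * n + 1 \<le> dim (hol (M_hyp n c f)) \<and> dim (hol (M_hyp n c f)) \<le> 2 * n + 4) \<and>
         (\<forall>d \<in> {2 * n + 1, 2 * n + 2, 2 * n + 3, 2 * n + 4}.
            \<exists>f. smooth f \<and> f 0 = 0 \<and> dim (hol (M_hyp n c f)) = d)"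
proof -
  interpret indexed n c by unfold_locales (use assms in auto)
  show ?thesis
  proof (intro conjI allI impI ballI)
    fix d assume "d \<in> {2 * n + 1, 2 * n + 2, 2 * n + 3, 2 * n + 4}"
    then have "\<exists>x y w. dim (hol (M_hyp n c (poly [:0, 0, 0, 0, x, y, w:]))) = d"
      using dim_hol_0 dim_hol_x4 dim_hol_x5 dim_hol_x5_x6 by (metis insertE singletonD)
    then show "\<exists>f. smooth f \<and> f 0 = 0 \<and> dim (hol (M_hyp n c f)) = d"
      using dim_hol_sextic(1,2) by metis
  qed (use dim_hol_bounds in auto)
qed

end
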